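(* The topological space $\overline{X}$ is compact.
   Context: "Compact" includes the Hausdorff property (Bourbaki's convention). Setting. $K$ is a finite extension of $\mathbb{Q}_p$ with valuation $v$ normalized so that a prime element has valuation $1$ (and $v(0)=\infty$); $V$ is an $n$-dimensional $K$-vector space with fixed basis $v_1,\dots,v_n$; $\underline{n}=\{1,\dots,n\}$. $G=PGL(V)$ denotes the group of $K$-rational points, with its $p$-adic topology. $T\subseteq G$ is the image of the diagonal matrices, $N\subseteq G$ is its normalizer, i.e. the image of the monomial matrices; $N=T\rtimes W$ with $W$ the group of permutation matrices, $w(v_i)=v_{w(i)}$. $\Lambda=X_*(T)\otimes\mathbb{R}=\sum_{i=1}^n\mathbb{R}\eta_i$ subject to the single relation $\sum_i\eta_i=0$. Roots: $\Phi=\{a_{ij}:i\neq j\}$, $a_{ij}(\sum x_k\eta_k)=x_i-x_j$. Compactified apartment. For nonempty $I\subseteq\underline{n}$ let $\Lambda_I=\sum_{i\in I}\mathbb{R}\eta_i^I$ with the single relation $\sum_{i\in I}\eta_i^I=0$, and $r_I:\Lambda\to\Lambda_I$, $r_I(\sum_{i=1}^n x_i\eta_i)=\sum_{i\in I}x_i\eta_i^I$; $\Lambda_{\underline{n}}=\Lambda$. $\overline{\Lambda}$ is the disjoint union $\bigcup_{\emptyset\ne I\subseteq\underline{n}}\Lambda_I$, with topology having as base the open subsets of $\Lambda$ together with the sets $C_U^I=(U+D_I)\cup\bigcup_{I\subseteq J\subsetneq\underline{n}}r_J(U+D_I)$ for nonempty $I\subsetneq\underline{n}$ and bounded open $U\subseteq\Lambda$,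 where $D_I=\sum_{i\notin I}\mathbb{R}_{\ge0}(-\eta_i)$. $N$ acts on $\overline{\Lambda}$ via $\nu$: $w\in W$ maps $\Lambda_I$ to $\Lambda_{w(I)}$ linearly by $\eta_i^I\mapsto\eta_{w(i)}^{w(I)}$, and $t\in T$ induced by $\mathrm{diag}(t_1,\dots,t_n)$ acts on $\Lambda_I$ by translation by $-\sum_{i\in I}v(t_i)\eta_i^I$. Groups. For $a=a_{ij}$, $U_a\subseteq G$ is the image of the group of unipotent matrices $v_j\mapsto v_j+\omega v_i$, $v_l\mapsto v_l$ ($l\ne j$), $\omega\in K$; $\psi_a(u)=v(\omega)$. For $x\in\overline{\Lambda}$, $f_x(a)=\inf\{t\in\mathbb{R}: x\in\overline{\{z\in\Lambda:a(z)\ge -t\}}\}$ (closure in $\overline{\Lambda}$; $\inf\emptyset=\infty$, $\inf\mathbb{R}=-\infty$), $U_{a,x}=\{u\in U_a:\psi_a(u)\ge f_x(a)\}$ (so it is $\{1\}$ if $f_x(a)=\infty$ and $U_a$ if $f_x(a)=-\infty$), $U_x$ is the subgroup of $G$ generated by all $U_{a,x}$, $a\in\Phi$; $N_x=\{n\in N:\nu(n)x=x\}$; $P_x=U_xN_x$ (a group). $Z\subseteq T$ is the subgroup of elements acting trivially on $\Lambda$, and $U_0^\wedge=U_0Z$, where $U_0=U_x$ for $x=0\in\Lambda$; it is a compact subgroup of $G$. Compactified building. $\overline{X}=(U_0^\wedge\times\overline{\Lambda})/\!\sim$ with the quotient topology, where $(g,x)\sim(h,y)$ iff there is $n\in N$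 with $\nu(n)x=y$ and $g^{-1}hn\in P_x$. *)

theory Defs
  imports
    "HOL-Analysis.Analysis"
    "HOL-Algebra.Group_Action"
    "HOL-Algebra.Generated_Groups"
begin

section \<open>Quotient topologies\<close>

definition quotient_topology :: "'a topology \<Rightarrow> ('a \<Rightarrow> 'b) \<Rightarrow> 'b topology" where
  "quotient_topology X q =
     topology (\<lambda>U. U \<subseteq> q ` topspace X \<and> openin X {x \<in> topspace X. q x \<in> U})"

lemma openin_quotient_topology:
  "openin (quotient_topology X q) U \<longleftrightarrow>
     U \<subseteq> q ` topspace X \<and> openin X {x \<in> topspace X. q x \<in> U}"
proof -
  let ?P = "\<lambda>U. U \<subseteq> q ` topspace X \<and> openin X {x \<in> topspace X. q x \<in> U}"
  have "istopology ?P"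
    unfolding istopology_def
  proof (intro conjI allI impI)
    fix S T assume S: "?P S" and T: "?P T"
    then show "S \<inter> T \<subseteq> q ` topspace X" by blast
    have "{x \<in> topspace X. q x \<in> S \<inter> T} = {x \<in> topspace X. q x \<in> S} \<inter> {x \<in> topspace X. q x \<in> T}"
      by blast
    then show "openin X {x \<in> topspace X. q x \<in> S \<inter> T}"
      using S T by (simp add: openin_Int)
  next
    fix \<K> assume K: "\<forall>S\<in>\<K>. ?P S"
    then show "\<Union>\<K> \<subseteq> q ` topspace X" by blast
    have "{x \<in> topspace X. q x \<in> \<Union>\<K>} = (\<Union>S\<in>\<K>. {x \<in> topspace X. q x \<in> S})"
      by blast
    then show "openin X {x \<in> topspace X. q x \<in> \<Union>\<K>}"
      using K by auto
  qed
  then show ?thesis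
    by (simp add: quotient_topology_def topology_inverse')
qed

lemma quotient_map_quotient_topology: "quotient_map X (quotient_topology X q) q"
proof -
  have "openin (quotient_topology X q) (q ` topspace X)"
  proof -
    have eq: "{x \<in> topspace X. q x \<in> q ` topspace X} = topspace X" by blast
    show ?thesis
      unfolding openin_quotient_topology eq by (intro conjI subset_refl openin_topspace)
  qed
  then have 1: "q ` topspace X \<subseteq> topspace (quotient_topology X q)"
    by (rule openin_subset)
  have 2: "topspace (quotient_topology X q) \<subseteq> q ` topspace X"
    using openin_topspace[of "quotient_topology X q"] unfolding openin_quotient_topology by (rule conjunct1)
  show ?thesis
    unfolding quotient_map_def openin_quotient_topology using 1 2 by (intro conjI allI impI) auto
qed


section \<open>Finite extensions of the p-adic numbers\<close>

definition subfield_set :: "'k::field set \<Rightarrow> bool" where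
  "subfield_set F \<longleftrightarrow> 0 \<in> F \<and> 1 \<in> F \<and>
     (\<forall>x\<in>F. \<forall>y\<in>F. x - y \<in> F \<and> x * y \<in> F) \<and> (\<forall>x\<in>F. inverse x \<in> F)"

definition valuation_on :: "'k::field set \<Rightarrow> ('k \<Rightarrow> ereal) \<Rightarrow> bool" where
  "valuation_on F w \<longleftrightarrow>
     (\<forall>x\<in>F. w x \<noteq> - \<infinity> \<and> (w x = \<infinity> \<longleftrightarrow> x = 0)) \<and>
     (\<forall>x\<in>F. \<forall>y\<in>F. w (x * y) = w x + w y \<and> min (w x) (w y) \<le> w (x + y))"

definition padic_ord :: "nat \<Rightarrow> rat \<Rightarrow> ereal" where
  "padic_ord p q =
     (if q = 0 then \<infinity>
      else ereal (real (multiplicity (int p) (fst (quotient_of q))) -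
                  real (multiplicity (int p) (snd (quotient_of q)))))"

text \<open>The p-adic numbers are the completion of the rationals with respect to the p-adic
  valuation: \<open>F\<close> with valuation \<open>w\<close> is such a completion if \<open>w\<close> extends \<^const>\<open>padic_ord\<close>,
  the rationals are dense in \<open>F\<close>, and every Cauchy sequence of \<open>F\<close> converges in \<open>F\<close>.\<close>

definition padic_numbers :: "nat \<Rightarrow> 'k::field_char_0 set \<Rightarrow> ('k \<Rightarrow> ereal) \<Rightarrow> bool" where
  "padic_numbers p F w \<longleftrightarrow>
     subfield_set F \<and> valuation_on F w \<and>
     (\<forall>q. w (of_rat q) = padic_ord p q) \<and>
     (\<forall>x\<in>F. \<forall>r::real. \<exists>q. w (x - of_rat q) > ereal r) \<and>
     (\<forall>X::nat \<Rightarrow> 'k.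
        range X \<subseteq> F \<and> (\<forall>r::real. \<exists>N. \<forall>m\<ge>N. \<forall>n\<ge>N. w (X m - X n) > ereal r) \<longrightarrow>
        (\<exists>l\<in>F. \<forall>r::real. \<exists>N. \<forall>n\<ge>N. w (X n - l) > ereal r))"

definition finite_extension :: "'k::field set \<Rightarrow> bool" where
  "finite_extension F \<longleftrightarrow>
     (\<exists>B. finite B \<and> (\<forall>x. \<exists>c. (\<forall>b\<in>B. c b \<in> F) \<and> x = (\<Sum>b\<in>B. c b * b)))"

text \<open>The whole type \<open>'k\<close> is a finite extension of the p-adic numbers \<open>F\<close>, and \<open>val\<close> is the
  extension to \<open>'k\<close> of the p-adic valuation \<open>w\<close>, rescaled (by the ramification index \<open>e\<close>) so
  that a prime element has valuation 1.\<close>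

definition finite_extension_of_padic :: "nat \<Rightarrow> ('k::field_char_0 \<Rightarrow> ereal) \<Rightarrow> bool" where
  "finite_extension_of_padic p val \<longleftrightarrow>
     prime p \<and>
     (\<exists>F w. padic_numbers p F w \<and> finite_extension F \<and>
        (\<exists>e::nat. 0 < e \<and> (\<forall>x\<in>F. val x = ereal (real e) * w x))) \<and>
     valuation_on UNIV val \<and>
     (\<forall>x. x \<noteq> 0 \<longrightarrow> (\<exists>m::int. val x = ereal (real_of_int m))) \<and>
     (\<exists>\<pi>. val \<pi> = 1)"


section \<open>The compactified apartment\<close>

text \<open>The finite type \<open>'n\<close> plays the role of \<open>{1,\<dots>,n}\<close>. A point of \<open>\<Lambda>\<^sub>I\<close> is a pair \<open>(I, C)\<close>, where
  \<open>C\<close> is a coset in \<open>real^'n\<close> of the subspace spanned by all \<open>axis i 1\<close> with \<open>i \<notin> I\<close> and by the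
  sum of all \<open>axis i 1\<close> with \<open>i \<in> I\<close>; \<open>apt I x\<close> is the point \<open>\<Sum>\<^bsub>i\<in>I\<^esub> x\<^sub>i \<eta>\<^sub>i\<^sup>I\<close>. The component \<open>I\<close>
  makes the union of the \<open>\<Lambda>\<^sub>I\<close> disjoint.\<close>

type_synonym 'n apt_point = "'n set \<times> (real^'n) set"

definition apt :: "'n::finite set \<Rightarrow> real^'n \<Rightarrow> 'n apt_point" where
  "apt I x = (I, {y. \<exists>c. \<forall>i\<in>I. y $ i = x $ i + c})"

definition Lam :: "'n::finite set \<Rightarrow> 'n apt_point set" where
  "Lam I = range (apt I)"

definition Lam_bar :: "'n::finite apt_point set" where
  "Lam_bar = (\<Union>I\<in>{I. I \<noteq> {}}. Lam I)"

definition r_proj :: "'n::finite set \<Rightarrow> 'n apt_point \<Rightarrow> 'n apt_point" where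
  "r_proj I p = (I, {y. \<exists>x\<in>snd p. \<exists>c. \<forall>i\<in>I. y $ i = x $ i + c})"

lemma r_proj_apt: "r_proj I (apt UNIV x) = apt I x"
proof -
  have "(\<exists>z\<in>snd (apt UNIV x). \<exists>c. \<forall>i\<in>I. y $ i = z $ i + c) \<longleftrightarrow> (\<exists>c. \<forall>i\<in>I. y $ i = x $ i + c)" for y
  proof
    assume "\<exists>z\<in>snd (apt UNIV x). \<exists>c. \<forall>i\<in>I. y $ i = z $ i + c"
    then obtain z c c' where "\<forall>i. z $ i = x $ i + c'" "\<forall>i\<in>I. y $ i = z $ i + c"
      unfolding apt_def snd_conv by blast
    then have "\<forall>i\<in>I. y $ i = x $ i + (c' + c)" by (simp only: add.assoc simp_thms)
    then show "\<exists>c. \<forall>i\<in>I. y $ i = x $ i + c" ..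
  next
    assume *: "\<exists>c. \<forall>i\<in>I. y $ i = x $ i + c"
    have "\<forall>i\<in>UNIV. x $ i = x $ i + 0" by simp
    then have "x \<in> snd (apt UNIV x)"
      unfolding apt_def snd_conv by blast
    with * show "\<exists>z\<in>snd (apt UNIV x). \<exists>c. \<forall>i\<in>I. y $ i = z $ i + c"
      by (rule bexI)
  qed
  then show ?thesis
    by (simp only: r_proj_def apt_def[of I])
qed

definition Lam_topology :: "'n::finite apt_point topology" where
  "Lam_topology = quotient_topology euclidean (apt UNIV)"

definition Lam_bounded :: "'n::finite apt_point set \<Rightarrow> bool" where
  "Lam_bounded U \<longleftrightarrow> (\<exists>B. bounded B \<and> U \<subseteq> apt UNIV ` B)"

text \<open>Vectors of \<open>real^'n\<close> representing the elements of the cone \<open>D\<^sub>I\<close> in \<open>\<Lambda>\<close>.\<close>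

definition D_cone :: "'n::finite set \<Rightarrow> (real^'n) set" where
  "D_cone I = {d. \<exists>c. (\<forall>i. 0 \<le> c i) \<and> d = (\<Sum>i\<in>-I. c i *\<^sub>R (- axis i 1))}"

definition plus_D :: "'n::finite apt_point set \<Rightarrow> 'n set \<Rightarrow> 'n apt_point set" where
  "plus_D U I = {apt UNIV (x + d) | x d. apt UNIV x \<in> U \<and> d \<in> D_cone I}"

definition C_set :: "'n::finite apt_point set \<Rightarrow> 'n set \<Rightarrow> 'n apt_point set" where
  "C_set U I = plus_D U I \<union> (\<Union>J\<in>{J. I \<subseteq> J \<and> J \<subset> UNIV}. r_proj J ` plus_D U I)"

definition Lam_bar_topology :: "'n::finite apt_point topology" where
  "Lam_bar_topology = topology_generated_by
     ({U. openin Lam_topology U} \<union>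
      {C_set U I | U I. I \<noteq> {} \<and> I \<noteq> UNIV \<and> openin Lam_topology U \<and> Lam_bounded U})"

text \<open>The actions on \<open>\<Lambda>\<close>-bar of a permutation \<open>w\<close>, and of translation by \<open>\<Sum>\<^sub>i a\<^sub>i \<eta>\<^sub>i\<^sup>I\<close> on each \<open>\<Lambda>\<^sub>I\<close>.\<close>

definition perm_point :: "('n \<Rightarrow> 'n) \<Rightarrow> 'n::finite apt_point \<Rightarrow> 'n apt_point" where
  "perm_point w p = (w ` fst p, (\<lambda>x. \<chi> k. x $ inv_into UNIV w k) ` snd p)"

definition translate_point :: "real^'n \<Rightarrow> 'n::finite apt_point \<Rightarrow> 'n apt_point" where
  "translate_point a p = (fst p, (\<lambda>x. x + a) ` snd p)"

text \<open>The number \<open>f\<^sub>x(a\<^sub>i\<^sub>j)\<close>, where \<open>a\<^sub>i\<^sub>j\<close> is the root \<open>x\<^sub>i - x\<^sub>j\<close>.\<close>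

definition f_root :: "'n::finite apt_point \<Rightarrow> 'n \<Rightarrow> 'n \<Rightarrow> ereal" where
  "f_root x i j = Inf {ereal t | t::real.
     x \<in> Abstract_Topology.closure_of Lam_bar_topology (apt UNIV ` {z. z $ i - z $ j \<ge> - t})}"


section \<open>The group and the compactified building\<close>

locale pgl_building = vector_space scale
  for scale :: "'k::field_char_0 \<Rightarrow> 'v::ab_group_add \<Rightarrow> 'v" +
  fixes p :: nat
    and val :: "'k \<Rightarrow> ereal"
    and bas :: "'n::finite \<Rightarrow> 'v"
  assumes padic: "finite_extension_of_padic p val"
    and basis_inj: "inj bas"
    and basis_independent: "independent (range bas)"
    and basis_span: "span (range bas) = UNIV"
begin

definition K_topology :: "'k topology" where
  "K_topology = topology_generated_by {{y. val (y - x) > ereal r} | x r. True}"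

definition GL :: "('v \<Rightarrow> 'v) monoid" where
  "GL = \<lparr>carrier = {g. Vector_Spaces.linear scale scale g \<and> bij g}, mult = (\<circ>), one = id\<rparr>"

definition entry :: "('v \<Rightarrow> 'v) \<Rightarrow> 'n \<times> 'n \<Rightarrow> 'k" where
  "entry g = (\<lambda>(i, j). representation (range bas) (g (bas j)) (bas i))"

definition GL_topology :: "('v \<Rightarrow> 'v) topology" where
  "GL_topology = pullback_topology (carrier GL) entry (product_topology (\<lambda>_. K_topology) UNIV)"

definition scalars :: "('v \<Rightarrow> 'v) set" where
  "scalars = {scale c | c. c \<noteq> 0}"

definition PGL :: "('v \<Rightarrow> 'v) set monoid" where
  "PGL = GL Mod scalars"

definition proj_class :: "('v \<Rightarrow> 'v) \<Rightarrow> ('v \<Rightarrow> 'v) set" where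
  "proj_class g = scalars #>\<^bsub>GL\<^esub> g"

definition PGL_topology :: "('v \<Rightarrow> 'v) set topology" where
  "PGL_topology = quotient_topology GL_topology proj_class"

definition T :: "('v \<Rightarrow> 'v) set set" where
  "T = proj_class ` {g \<in> carrier GL. \<exists>t. \<forall>i. g (bas i) = scale (t i) (bas i)}"

definition N :: "('v \<Rightarrow> 'v) set set" where
  "N = normalizer PGL T"

text \<open>\<open>monomial_rep n t w\<close>: \<open>n\<close> is the class of the product of the diagonal matrix with entries
  \<open>t\<close> and the permutation matrix of \<open>w\<close>. Here \<open>n\<close> determines \<open>w\<close>, and \<open>t\<close> up to a common
  factor, so that \<open>nu\<close> does not depend on the choice.\<close>

definition monomial_rep :: "('v \<Rightarrow> 'v) set \<Rightarrow> ('n \<Rightarrow> 'k) \<Rightarrow> ('n \<Rightarrow> 'n) \<Rightarrow> bool" where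
  "monomial_rep n t w \<longleftrightarrow> bij w \<and> (\<forall>i. t i \<noteq> 0) \<and>
     (\<exists>g \<in> carrier GL. n = proj_class g \<and> (\<forall>i. g (bas i) = scale (t (w i)) (bas (w i))))"

definition nu :: "('v \<Rightarrow> 'v) set \<Rightarrow> 'n apt_point \<Rightarrow> 'n apt_point" where
  "nu n x = (let (t, w) = (SOME (t, w). monomial_rep n t w)
             in translate_point (\<chi> i. - real_of_ereal (val (t i))) (perm_point w x))"

text \<open>\<open>U_root x i j\<close> is \<open>U\<^bsub>a,x\<^esub>\<close> for \<open>a = a\<^sub>i\<^sub>j\<close>; the parameter \<open>\<omega>\<close> is determined by the element of
  \<open>U\<^sub>a\<close>, whose \<open>\<psi>\<^sub>a\<close>-value is \<open>val \<omega>\<close>.\<close>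

definition U_root :: "'n apt_point \<Rightarrow> 'n \<Rightarrow> 'n \<Rightarrow> ('v \<Rightarrow> 'v) set set" where
  "U_root x i j = proj_class ` {u \<in> carrier GL. \<exists>\<omega>. val \<omega> \<ge> f_root x i j \<and>
     u (bas j) = bas j + scale \<omega> (bas i) \<and> (\<forall>l. l \<noteq> j \<longrightarrow> u (bas l) = bas l)}"

definition U_grp :: "'n apt_point \<Rightarrow> ('v \<Rightarrow> 'v) set set" where
  "U_grp x = generate PGL (\<Union>(i, j)\<in>{(i, j). i \<noteq> j}. U_root x i j)"

definition N_stab :: "'n apt_point \<Rightarrow> ('v \<Rightarrow> 'v) set set" where
  "N_stab x = {n \<in> N. nu n x = x}"

definition P_grp :: "'n apt_point \<Rightarrow> ('v \<Rightarrow> 'v) set set" where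
  "P_grp x = U_grp x <#>\<^bsub>PGL\<^esub> N_stab x"

definition Z :: "('v \<Rightarrow> 'v) set set" where
  "Z = {t \<in> T. \<forall>x \<in> Lam UNIV. nu t x = x}"

definition U0_hat :: "('v \<Rightarrow> 'v) set set" where
  "U0_hat = U_grp (apt UNIV 0) <#>\<^bsub>PGL\<^esub> Z"

definition building_rel ::
  "((('v \<Rightarrow> 'v) set \<times> 'n apt_point) \<times> (('v \<Rightarrow> 'v) set \<times> 'n apt_point)) set" where
  "building_rel = {((g, x), (h, y)) | g x h y.
     g \<in> U0_hat \<and> x \<in> Lam_bar \<and> h \<in> U0_hat \<and> y \<in> Lam_bar \<and>
     (\<exists>n\<in>N. nu n x = y \<and> inv\<^bsub>PGL\<^esub> g \<otimes>\<^bsub>PGL\<^esub> h \<otimes>\<^bsub>PGL\<^esub> n \<in> P_grp x)}"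

definition X_bar :: "(('v \<Rightarrow> 'v) set \<times> 'n apt_point) set topology" where
  "X_bar = quotient_topology
     (prod_topology (subtopology PGL_topology U0_hat) Lam_bar_topology)
     (\<lambda>q. building_rel `` {q})"

end

end

theory Submission
  imports Defs "HOL-Number_Theory.Cong"
begin

text \<open>A point of the compactified apartment is a vector \<open>y\<close> of nonnegative weights up to scaling,
  with \<open>y\<^sub>i = exp x\<^sub>i\<close> for \<open>i \<in> I\<close> and \<open>y\<^sub>i = 0\<close> otherwise; normalized by \<open>max y\<^sub>i = 1\<close>, these form a
  compact space homeomorphic to the apartment. The pair \<open>(g, y)\<close> defines the seminorm
  \<open>f \<mapsto> max\<^sub>i y\<^sub>i |(f g)\<^sub>i|\<close> on the dual of \<open>V\<close>, where \<open>g\<close> is represented by an integral matrix with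
  integral inverse. Gauss-Jordan elimination with pivots chosen so that all row operations are
  isometries of \<open>y\<close> shows that two pairs are identified in the building exactly when their
  seminorms agree. The seminorm depends continuously on the pair, so the building embeds
  continuously into a product of real lines and is Hausdorff; it is compact as a quotient of
  the product of the two compact spaces \<open>U\<^sub>0\<^sup>\<and>\<close> and \<open>\<Lambda>\<close>-bar.\<close>

section \<open>Absolute values and local compactness\<close>

text \<open>A class in PGL determines a seminorm only up to a positive factor, and so does a point
  of the apartment. The factor is pinned down by representatives that are isometries of the max norm
  and by weights with maximum 1: each seminorm then has supremum exactly 1 on the unit ball of the
  max norm, so proportional seminorms are equal. Boundary points have zero weights. The root group
  conditions are therefore kept in the form |c| y_j <= y_i, which treats interior and boundary
  alike. The absolute value has base e because apartment coordinates are logarithms of weights: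
  translation by -v(t_i) becomes multiplication of the weight y_i by |t_i|. Compactness of
  \<open>U0_hat\<close> rests on local compactness of K, which is derived from density of the
  rationals and completeness, through approximation by residues modulo p^m. Continuity needs care
  because \<open>U0_hat\<close> carries the topology induced from PGL, a quotient of GL: the
  seminorm has to be expressed by functions on all of PGL, hence invariant under scalars.\<close>

definition av :: "('k::field \<Rightarrow> ereal) \<Rightarrow> 'k \<Rightarrow> real" where
  "av val x = (if x = 0 then 0 else exp (- real_of_ereal (val x)))"

locale valued_field =
  fixes val :: "'k::field \<Rightarrow> ereal"
  assumes valuation: "valuation_on UNIV val"
begin

abbreviation abs_val :: "'k \<Rightarrow> real" where "abs_val \<equiv> av val"

lemma val_not_MInf: "val x \<noteq> - \<infinity>"
  and val_eq_PInf [simp]: "val x = \<infinity> \<longleftrightarrow> x = 0"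
  and val_mult: "val (x * y) = val x + val y"
  and val_add: "min (val x) (val y) \<le> val (x + y)"
  using valuation unfolding valuation_on_def by auto

lemma val_0 [simp]: "val 0 = \<infinity>" by simp

lemma val_cases:
  obtains "x = 0" "val x = \<infinity>" | r where "x \<noteq> 0" "val x = ereal r"
  using val_not_MInf[of x] val_eq_PInf[of x] by (cases "val x") auto

lemma av_0 [simp]: "abs_val 0 = 0"
  and av_nonneg [simp]: "abs_val x \<ge> 0"
  and av_eq_0 [simp]: "abs_val x = 0 \<longleftrightarrow> x = 0"
  and av_pos [simp]: "abs_val x > 0 \<longleftrightarrow> x \<noteq> 0"
  by (auto simp: av_def)

lemma av_mult: "abs_val (x * y) = abs_val x * abs_val y"
  using val_mult[of x y]
  by (cases x rule: val_cases; cases y rule: val_cases) (auto simp: av_def exp_diff exp_minus field_simps)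

lemma av_le_exp: "abs_val x \<le> exp (- r) \<longleftrightarrow> ereal r \<le> val x"
  by (cases x rule: val_cases) (auto simp: av_def)

lemma av_less_exp: "abs_val x < exp (- r) \<longleftrightarrow> ereal r < val x"
  by (cases x rule: val_cases) (auto simp: av_def)

lemma av_le_iff: "abs_val x \<le> abs_val y \<longleftrightarrow> val y \<le> val x"
  by (cases x rule: val_cases; cases y rule: val_cases) (auto simp: av_def not_le)

lemma av_add: "abs_val (x + y) \<le> max (abs_val x) (abs_val y)"
  using val_add[of x y] unfolding av_le_iff max_def min_def by (auto simp: av_le_iff split: if_splits)

lemma av_1 [simp]: "abs_val 1 = 1"
  using av_mult[of 1 1] av_eq_0[of 1] by (simp del: av_eq_0)

lemma av_minus [simp]: "abs_val (- x) = abs_val x"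
proof -
  have "abs_val (-1) * abs_val (-1) = 1" using av_mult[of "-1" "-1"] by simp
  then have "abs_val (-1) = 1"
    using av_nonneg[of "-1"] by (metis abs_of_nonneg real_sqrt_abs2 real_sqrt_one)
  then show ?thesis using av_mult[of "-1" x] by simp
qed

lemma av_diff: "abs_val (x - y) \<le> max (abs_val x) (abs_val y)"
  using av_add[of x "- y"] by simp

lemma av_diff_commute: "abs_val (x - y) = abs_val (y - x)"
  using av_minus[of "x - y"] by simp

lemma av_diff_trans: "abs_val (x - z) \<le> max (abs_val (x - y)) (abs_val (y - z))"
  using av_add[of "x - y" "y - z"] by simp

lemma av_abs_diff: "\<bar>abs_val x - abs_val y\<bar> \<le> abs_val (x - y)"
proof -
  have "abs_val x \<le> max (abs_val (x - y)) (abs_val y)" using av_add[of "x - y" y] by simp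
  moreover have "abs_val y \<le> max (abs_val x) (abs_val (x - y))" using av_diff[of x "x - y"] by simp
  ultimately show ?thesis using av_nonneg[of "x - y"] av_nonneg[of x] av_nonneg[of y] by (simp only: max_def split: if_splits)
qed

lemma av_inverse: "abs_val (inverse x) = inverse (abs_val x)"
proof (cases "x = 0")
  case False
  then have "abs_val (inverse x) * abs_val x = 1" by (simp flip: av_mult)
  then show ?thesis by (metis inverse_unique mult.commute)
qed simp

lemma av_divide: "abs_val (x / y) = abs_val x / abs_val y"
  by (simp add: divide_inverse av_mult av_inverse)

lemma av_sum_le:
  assumes "\<And>i. i \<in> A \<Longrightarrow> abs_val (f i) \<le> b" "b \<ge> 0"
  shows "abs_val (sum f A) \<le> b"
  using assms
proof (induction A rule: infinite_finite_induct)
  case (insert x F)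
  have "abs_val (f x + sum f F) \<le> max (abs_val (f x)) (abs_val (sum f F))" by (rule av_add)
  also have "\<dots> \<le> b" using insert by auto
  finally show ?case using insert by simp
qed auto

sublocale K: Metric_space UNIV "\<lambda>x y. abs_val (x - y)"
proof
  fix x y z :: 'k
  show "abs_val (x - y) = abs_val (y - x)" by (rule av_diff_commute)
  show "abs_val (x - z) \<le> abs_val (x - y) + abs_val (y - z)"
    using av_diff_trans[of x z y] av_nonneg[of "x - y"] av_nonneg[of "y - z"] by linarith
qed auto

text \<open>The valuation balls are the metric balls of radius exp (- r). This makes sequential
  compactness available for \<open>K_topology\<close>.\<close>

lemma mtopology_eq_valuation_topology:
  "K.mtopology = topology_generated_by {{y. val (y - x) > ereal r} | x r. True}"
proof -
  have ball: "{y. val (y - x) > ereal r} = K.mball x (exp (- r))" for x r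
    by (auto simp: K.mball_def av_less_exp av_diff_commute)
  have "openin (topology_generated_by {{y. val (y - x) > ereal r} | x r. True}) U" if U: "openin K.mtopology U" for U
  proof (subst openin_subopen, intro ballI)
    fix x assume "x \<in> U"
    then obtain r where r: "r > 0" "K.mball x r \<subseteq> U" using U K.openin_mtopology by blast
    have "K.mball x r = {y. val (y - x) > ereal (- ln r)}"
      using ball[of "- ln r" x] r by simp
    then show "\<exists>T. openin (topology_generated_by {{y. val (y - x) > ereal r} | x r. True}) T \<and> x \<in> T \<and> T \<subseteq> U"
      using r by (intro exI[of _ "K.mball x r"] conjI topology_generated_by_Basis) auto
  qed
  moreover have "openin K.mtopology U"
    if "generate_topology_on {{y. val (y - x) > ereal r} | x r. True} U" for U
    using that by induction (auto simp: ball)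
  ultimately show ?thesis
    by (auto simp: topology_eq openin_topology_generated_by_iff)
qed

section \<open>Sequential compactness of bounded sets in finitely generated subspaces\<close>

definition bolzano_weierstrass :: "'k set \<Rightarrow> bool" where
  "bolzano_weierstrass S \<longleftrightarrow> (\<forall>X R. range X \<subseteq> S \<and> (\<forall>n::nat. abs_val (X n) \<le> R) \<longrightarrow>
     (\<exists>l\<in>S. \<exists>s::nat\<Rightarrow>nat. strict_mono s \<and> (\<lambda>n. abs_val (X (s n) - l)) \<longlonglongrightarrow> 0))"

lemma bolzano_weierstrassE:
  assumes "bolzano_weierstrass S" "\<And>n. X n \<in> S" "\<And>n::nat. abs_val (X n) \<le> R"
  obtains l s where "l \<in> S" "strict_mono (s::nat\<Rightarrow>nat)" "(\<lambda>n. abs_val (X (s n) - l)) \<longlonglongrightarrow> 0"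
  using assms unfolding bolzano_weierstrass_def by blast

lemma av_tendsto_le:
  assumes "f \<longlonglongrightarrow> 0" "g \<longlonglongrightarrow> 0" "\<And>n. abs_val (h n) \<le> max (f n) (g n)"
  shows "(\<lambda>n. abs_val (h n)) \<longlonglongrightarrow> 0"
proof (rule tendsto_sandwich[OF _ _ tendsto_const])
  show "(\<lambda>n. max (f n) (g n)) \<longlonglongrightarrow> 0"
    using tendsto_max[OF assms(1,2)] by simp
qed (use assms(3) in auto)

text \<open>\<open>bolzano_weierstrass W\<close> puts limits inside W, so W is closed and b has a
  positive distance delta from it. Homogeneity gives |w + c b| >= |c| delta, so a bounded sequence
  has bounded coefficients c, hence bounded parts w; two successive subsequences then
  converge.\<close>

lemma bolzano_weierstrass_add_line:
  assumes F: "bolzano_weierstrass F" "\<And>x. x \<in> F \<Longrightarrow> inverse x \<in> F"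
    and W: "bolzano_weierstrass W" "0 \<in> W" "\<And>x c. x \<in> W \<Longrightarrow> c \<in> F \<Longrightarrow> c * x \<in> W" "\<And>x. x \<in> W \<Longrightarrow> - x \<in> W"
    and b: "b \<notin> W"
  shows "bolzano_weierstrass {w + c * b | w c. w \<in> W \<and> c \<in> F}"
proof -
  have "\<exists>\<delta>>0. \<forall>w\<in>W. \<delta> \<le> abs_val (b - w)"
  proof (rule ccontr)
    assume "\<not> ?thesis"
    then have "\<exists>w\<in>W. abs_val (b - w) < \<delta>" if "\<delta> > 0" for \<delta>
      using that by (auto simp: not_le)
    then have "\<forall>n. \<exists>w\<in>W. abs_val (b - w) < inverse (real (Suc n))" by simp
    then obtain w where w: "\<And>n. w n \<in> W" "\<And>n. abs_val (b - w n) < inverse (real (Suc n))"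
      by metis
    have "abs_val (w n) \<le> max (abs_val b) 1" for n
    proof -
      have "inverse (real (Suc n)) \<le> 1" by (simp add: field_simps)
      then show ?thesis using av_diff[of b "b - w n"] w(2)[of n] by auto
    qed
    then obtain l s where l: "l \<in> W" "strict_mono s" "(\<lambda>n. abs_val (w (s n) - l)) \<longlonglongrightarrow> 0"
      by (rule bolzano_weierstrassE[OF W(1) w(1)])
    have "(\<lambda>n. inverse (real (Suc (s n)))) \<longlonglongrightarrow> 0"
      using LIMSEQ_subseq_LIMSEQ[OF LIMSEQ_inverse_real_of_nat l(2)] by (simp add: o_def)
    then have "(\<lambda>n. abs_val (b - l)) \<longlonglongrightarrow> 0"
    proof (rule av_tendsto_le[OF _ l(3)])
      show "abs_val (b - l) \<le> max (inverse (real (Suc (s n)))) (abs_val (w (s n) - l))" for n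
        using av_diff_trans[of b l "w (s n)"] w(2)[of "s n"] by auto
    qed
    then have "b = l" by (simp add: LIMSEQ_const_iff)
    with l b show False by simp
  qed
  then obtain \<delta> where \<delta>: "\<delta> > 0" "\<And>w. w \<in> W \<Longrightarrow> \<delta> \<le> abs_val (b - w)" by blast
  show ?thesis unfolding bolzano_weierstrass_def
  proof (intro allI impI, elim conjE)
    fix X and R assume X: "range X \<subseteq> {w + c * b |w c. w \<in> W \<and> c \<in> F}" "\<forall>n::nat. abs_val (X n) \<le> R"
    then have "\<forall>n. \<exists>w c. w \<in> W \<and> c \<in> F \<and> X n = w + c * b" by blast
    then obtain w c where wc: "\<And>n. w n \<in> W" "\<And>n. c n \<in> F" "\<And>n. X n = w n + c n * b" by metis
    have cb: "abs_val (c n) \<le> R / \<delta>" for n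
    proof (cases "c n = 0")
      case True
      have "0 \<le> R" using X(2) av_nonneg[of "X n"] order_trans by blast
      with True \<delta> show ?thesis by simp
    next
      case False
      have "\<delta> \<le> abs_val (b - (- (inverse (c n) * w n)))" by (rule \<delta>(2)) (use W F wc in auto)
      then have "abs_val (c n) * \<delta> \<le> abs_val (c n) * abs_val (b + inverse (c n) * w n)"
        by (intro mult_left_mono) auto
      also have "\<dots> = abs_val (c n * (b + inverse (c n) * w n))" by (simp add: av_mult)
      also have "c n * (b + inverse (c n) * w n) = X n" using False by (simp add: wc field_simps)
      also have "abs_val (X n) \<le> R" using X by auto
      finally show ?thesis using \<delta> by (simp add: field_simps)
    qed
    then obtain l s where l: "l \<in> F" "strict_mono s" "(\<lambda>n. abs_val (c (s n) - l)) \<longlonglongrightarrow> 0"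
      by (rule bolzano_weierstrassE[OF F(1) wc(2)])
    have "abs_val (w (s n)) \<le> max R (R / \<delta> * abs_val b)" for n
    proof -
      have "abs_val (w (s n)) \<le> max (abs_val (X (s n))) (abs_val (c (s n) * b))"
        using av_diff[of "X (s n)" "c (s n) * b"] by (simp add: wc)
      moreover have "abs_val (c (s n) * b) \<le> R / \<delta> * abs_val b"
        unfolding av_mult by (intro mult_right_mono cb av_nonneg)
      moreover have "abs_val (X (s n)) \<le> R" using X(2) by blast
      ultimately show ?thesis by linarith
    qed
    then obtain l' s' where l': "l' \<in> W" "strict_mono s'" "(\<lambda>n. abs_val (w (s (s' n)) - l')) \<longlonglongrightarrow> 0"
      by (rule bolzano_weierstrassE[OF W(1) wc(1)])
    have "(\<lambda>n. abs_val (c (s (s' n)) - l) * abs_val b) \<longlonglongrightarrow> 0"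
      using LIMSEQ_subseq_LIMSEQ[OF l(3) l'(2)] by (intro tendsto_mult_left_zero) (simp add: o_def)
    then have "(\<lambda>n. abs_val (X (s (s' n)) - (l' + l * b))) \<longlonglongrightarrow> 0"
    proof (rule av_tendsto_le[OF l'(3)])
      fix n
      have eq: "X (s (s' n)) - (l' + l * b) = (w (s (s' n)) - l') + (c (s (s' n)) - l) * b"
        by (simp add: wc algebra_simps)
      show "abs_val (X (s (s' n)) - (l' + l * b)) \<le>
          max (abs_val (w (s (s' n)) - l')) (abs_val (c (s (s' n)) - l) * abs_val b)"
        unfolding eq av_mult[symmetric] by (rule av_add)
    qed
    then show "\<exists>l\<in>{w + c * b |w c. w \<in> W \<and> c \<in> F}. \<exists>s::nat\<Rightarrow>nat. strict_mono s \<and> (\<lambda>n. abs_val (X (s n) - l)) \<longlonglongrightarrow> 0"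
      using l(1) l'(1) strict_mono_o[OF l(2) l'(2)]
      by (intro bexI[of _ "l' + l * b"] exI[of _ "s \<circ> s'"] conjI) (auto simp: o_def)
  qed
qed

text \<open>\<open>finite_extension\<close> provides generators that may be dependent. A generator
  already in the span of the others changes nothing; any other one adds a line.\<close>

lemma bolzano_weierstrass_span:
  assumes F: "bolzano_weierstrass F" "subfield_set F" and "finite B"
  shows "bolzano_weierstrass {\<Sum>b\<in>B. c b * b | c. \<forall>b\<in>B. c b \<in> F}" (is "bolzano_weierstrass (?W B)")
  using \<open>finite B\<close>
proof induction
  case empty
  show ?case unfolding bolzano_weierstrass_def
  proof (intro allI impI, elim conjE)
    fix X :: "nat \<Rightarrow> 'k" assume "range X \<subseteq> {\<Sum>b\<in>{}. c b * b | c. \<forall>b\<in>{}. c b \<in> F}"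
    then have "X = (\<lambda>_. 0)" by auto
    then show "\<exists>l\<in>{\<Sum>b\<in>{}. c b * b | c. \<forall>b\<in>{}. c b \<in> F}. \<exists>s::nat\<Rightarrow>nat. strict_mono s \<and> (\<lambda>n. abs_val (X (s n) - l)) \<longlonglongrightarrow> 0"
      by (auto intro: strict_mono_id)
  qed
next
  case (insert a B)
  have f: "0 \<in> F" "\<And>x y. x \<in> F \<Longrightarrow> y \<in> F \<Longrightarrow> x - y \<in> F" "\<And>x y. x \<in> F \<Longrightarrow> y \<in> F \<Longrightarrow> x * y \<in> F"
    "\<And>x. x \<in> F \<Longrightarrow> inverse x \<in> F"
    using F by (auto simp: subfield_set_def)
  have neg: "- x \<in> F" if "x \<in> F" for x using f(2)[OF f(1) that] by simp
  have add: "x + y \<in> F" if "x \<in> F" "y \<in> F" for x y using f(2)[OF that(1) neg[OF that(2)]] by simp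
  have eq: "?W (insert a B) = {w + c * a | w c. w \<in> ?W B \<and> c \<in> F}"
  proof (intro equalityI subsetI)
    fix x assume "x \<in> ?W (insert a B)"
    then obtain c where "\<forall>b\<in>insert a B. c b \<in> F" "x = (\<Sum>b\<in>insert a B. c b * b)" by blast
    then show "x \<in> {w + c * a | w c. w \<in> ?W B \<and> c \<in> F}"
      using insert.hyps
      by (intro CollectI exI[of _ "\<Sum>b\<in>B. c b * b"] exI[of _ "c a"]) (auto simp: add.commute)
  next
    fix x assume "x \<in> {w + c * a | w c. w \<in> ?W B \<and> c \<in> F}"
    then obtain c d where c: "\<forall>b\<in>B. c b \<in> F" "d \<in> F" "x = (\<Sum>b\<in>B. c b * b) + d * a" by blast
    then have "x = (\<Sum>b\<in>insert a B. (c(a := d)) b * b)"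
      using insert.hyps by (auto simp: add.commute intro!: sum.cong)
    then show "x \<in> ?W (insert a B)"
      using c(1,2) by (intro CollectI exI[of _ "c(a := d)"] conjI) simp_all
  qed
  have scal: "d * x \<in> ?W B" if x: "x \<in> ?W B" and d: "d \<in> F" for x d
  proof -
    from x obtain c where c: "\<forall>b\<in>B. c b \<in> F" "x = (\<Sum>b\<in>B. c b * b)" by blast
    then have "d * x = (\<Sum>b\<in>B. (d * c b) * b)" by (simp add: sum_distrib_left mult.assoc)
    then show ?thesis using f(3) d c(1) by (intro CollectI exI[of _ "\<lambda>b. d * c b"]) simp
  qed
  have one: "1 \<in> F" using F by (auto simp: subfield_set_def)
  have negW: "- x \<in> ?W B" if "x \<in> ?W B" for x using scal[OF that neg[OF one]] by simp
  have zero: "0 \<in> ?W B" using f(1) by (intro CollectI exI[of _ "\<lambda>_. 0"]) simp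
  show ?case
  proof (cases "a \<in> ?W B")
    case True
    have "?W (insert a B) = ?W B"
    proof (intro equalityI subsetI)
      fix x assume "x \<in> ?W B"
      then show "x \<in> ?W (insert a B)" unfolding eq
        using f(1) by (intro CollectI exI[of _ x] exI[of _ 0] conjI) simp_all
    next
      fix x assume "x \<in> ?W (insert a B)"
      then obtain w d where w: "w \<in> ?W B" "d \<in> F" "x = w + d * a" unfolding eq by blast
      have "d * a \<in> ?W B" using scal True w by blast
      then obtain c' where c': "\<forall>b\<in>B. c' b \<in> F" "d * a = (\<Sum>b\<in>B. c' b * b)" by blast
      obtain c where c: "\<forall>b\<in>B. c b \<in> F" "w = (\<Sum>b\<in>B. c b * b)" using w(1) by blast
      have "x = (\<Sum>b\<in>B. (c b + c' b) * b)" by (simp add: w(3) c(2) c'(2) sum.distrib distrib_right)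
      then show "x \<in> ?W B"
        using add c(1) c'(1) by (intro CollectI exI[of _ "\<lambda>b. c b + c' b"]) simp
    qed
    then show ?thesis using insert by simp
  next
    case False
    show ?thesis unfolding eq
      by (rule bolzano_weierstrass_add_line[OF F(1) f(4) insert.IH zero scal negW False])
  qed
qed

end


section \<open>Local compactness of a finite extension of the p-adic numbers\<close>

locale padic_field = valued_field val for val :: "'k::field_char_0 \<Rightarrow> ereal" +
  fixes p :: nat
  assumes padic: "finite_extension_of_padic p val"
begin

text \<open>The unit ball of F is totally bounded because the integers below p^m form a net of mesh
  |p|^m. Multiplying by a power of p moves a bounded sequence of F into this ball, where total
  boundedness gives a Cauchy subsequence and completeness of F a limit. The finite extension
  inherits the property through \<open>bolzano_weierstrass_span\<close>.\<close>

lemma bolzano_weierstrass_UNIV: "bolzano_weierstrass UNIV"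
proof -
  have p: "prime p" and "\<exists>F w. padic_numbers p F w \<and> finite_extension F \<and>
      (\<exists>e::nat. 0 < e \<and> (\<forall>x\<in>F. val x = ereal (real e) * w x))"
    using padic unfolding finite_extension_of_padic_def by (rule conjunct1, rule conjunct1[OF conjunct2])
  then obtain F w e where Fw: "padic_numbers p F w" "finite_extension F" "0 < (e::nat)"
    "\<And>x. x \<in> F \<Longrightarrow> val x = ereal (real e) * w x"
    by metis
  have sub: "subfield_set F" and vw: "valuation_on F w"
    and ord: "\<And>q. w (of_rat q) = padic_ord p q"
    and dense: "\<And>x r. x \<in> F \<Longrightarrow> \<exists>q. w (x - of_rat q) > ereal r"
    and complete: "\<And>X::nat \<Rightarrow> 'k. range X \<subseteq> F \<Longrightarrow> (\<forall>r::real. \<exists>N. \<forall>m\<ge>N. \<forall>n\<ge>N. w (X m - X n) > ereal r) \<Longrightarrow>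
        \<exists>l\<in>F. \<forall>r::real. \<exists>N. \<forall>n\<ge>N. w (X n - l) > ereal r"
    using Fw(1) unfolding padic_numbers_def by auto
  have f: "0 \<in> F" "1 \<in> F" "\<And>x y. x \<in> F \<Longrightarrow> y \<in> F \<Longrightarrow> x - y \<in> F" "\<And>x y. x \<in> F \<Longrightarrow> y \<in> F \<Longrightarrow> x * y \<in> F"
    "\<And>x. x \<in> F \<Longrightarrow> inverse x \<in> F"
    using sub by (auto simp: subfield_set_def)
  have neg: "- x \<in> F" if "x \<in> F" for x using f(3)[OF f(1) that] by simp
  have add: "x + y \<in> F" if "x \<in> F" "y \<in> F" for x y using f(3)[OF that(1) neg[OF that(2)]] by simp
  have nat: "of_nat n \<in> F" for n by (induction n) (auto intro: f add)
  have int: "of_int z \<in> F" for z by (cases z) (auto intro: nat neg f simp del: of_nat_Suc)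
  have rat: "of_rat q \<in> F" for q
  proof -
    obtain a b where "q = of_int a / of_int b" by (metis quotient_of_div surj_pair)
    then have "of_rat q = (of_int a * inverse (of_int b) :: 'k)"
      by (simp add: of_rat_divide flip: divide_inverse)
    then show ?thesis by (metis f int)
  qed
  \<comment> \<open>On F, \<open>val\<close> is e times w, so a bound r on w becomes e r in the
    exponent.\<close>
  have less_w: "abs_val x < exp (- (real e * r)) \<longleftrightarrow> ereal r < w x" if "x \<in> F" for x r
    using Fw(3) Fw(4)[OF that] by (cases "w x") (auto simp: av_less_exp)
  \<comment> \<open>This is |p|, because w p = 1 and hence val p = e.\<close>
  define c where "c = exp (- real e)"
  have c: "0 < c" "c < 1" using Fw(3) by (auto simp: c_def)
  have av_int: "abs_val (of_int z) = c ^ multiplicity (int p) z" if "z \<noteq> 0" for z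
  proof -
    have "w (of_int z) = ereal (real (multiplicity (int p) z))"
      using ord[of "of_int z"] that by (simp add: padic_ord_def)
    then show ?thesis
      using that Fw(4)[OF int[of z]] by (simp add: av_def c_def mult.commute flip: exp_of_nat_mult)
  qed
  have int_le: "abs_val (of_int z) \<le> 1" for z
    using av_int[of z] c by (cases "z = 0") (auto intro: power_le_one)
  have int_eq: "abs_val (of_int z) = 1" if "\<not> int p dvd z" for z
    using av_int[of z] that by (cases "z = 0") (auto simp: not_dvd_imp_multiplicity_0)
  have p0: "p > 0" using p prime_gt_0_nat by blast
  have "multiplicity (int p) (int p) = 1"
    using p by (intro multiplicity_self) (auto simp: prime_nat_iff')
  then have av_p: "abs_val (of_nat p) = c" using av_int[of "int p"] p0 by simp
  have av_pp: "abs_val (of_nat p ^ m) = c ^ m" for m by (induction m) (auto simp: av_mult av_p)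
  \<comment> \<open>Approximate x by a rational a/b, show that b is prime to p, and replace a/b by
    the residue of a b^(-1) modulo p^m.\<close>
  have net: "\<exists>k<p^m. abs_val (x - of_nat k) \<le> c ^ m" if x: "x \<in> F" "abs_val x \<le> 1" for x m
  proof -
    obtain q where "w (x - of_rat q) > ereal (real m)" using dense x by blast
    then have xq: "abs_val (x - of_rat q) < c ^ m"
      using less_w[of "x - of_rat q" "real m"] x rat f
      by (simp add: c_def mult.commute flip: exp_of_nat_mult)
    obtain a b where ab: "quotient_of q = (a, b)" by fastforce
    have q: "of_rat q = (of_int a / of_int b :: 'k)"
      using quotient_of_div[OF ab] by (simp add: of_rat_divide)
    have b: "b > 0" using quotient_of_denom_pos[OF ab] .
    have cop: "coprime a b" using quotient_of_coprime[OF ab] .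
    have "c ^ m \<le> 1" using c by (auto intro: power_le_one)
    then have q1: "abs_val (of_rat q) \<le> 1" using av_diff[of x "x - of_rat q"] x xq by auto
    \<comment> \<open>The fraction is in lowest terms. If p divided b, then |a| = 1, and |a/b| <= 1
      would force |b| >= 1, against |b| <= |p| < 1.\<close>
    have pb: "\<not> int p dvd b"
    proof
      assume pb: "int p dvd b"
      then have "\<not> int p dvd a"
        using cop p by (metis coprime_common_divisor not_prime_unit prime_nat_int_transfer)
      then have "abs_val (of_int b) \<ge> 1" using q1 int_eq[of a] b by (auto simp: q av_divide field_simps)
      moreover obtain k where "b = int p * k" using pb by auto
      ultimately show False
        using c int_le[of k] by (simp add: av_mult av_p) (smt (verit) av_nonneg mult_left_le)
    qed
    have "coprime b (int p ^ m)"
      using p pb by (metis coprime_commute coprime_power_right_iff prime_imp_coprime prime_nat_int_transfer)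
    then obtain y where y: "[b * y = 1] (mod int p ^ m)" using cong_solve_coprime_int by blast
    define k where "k = nat ((y * a) mod (int p ^ m))"
    have k: "k < p ^ m" "int k = (y * a) mod (int p ^ m)"
      using p0 by (auto simp: k_def nat_less_iff)
    have "[b * int k = b * (y * a)] (mod int p ^ m)" by (simp add: k(2) cong_def mod_mult_right_eq)
    also have "b * (y * a) = (b * y) * a" by simp
    also have "[\<dots> = 1 * a] (mod int p ^ m)" by (intro cong_mult y cong_refl)
    finally have "int p ^ m dvd a - b * int k" by (metis cong_iff_dvd_diff cong_sym mult_1)
    then obtain d where d: "a - b * int k = int p ^ m * d" by blast
    have "of_rat q - of_nat k = (of_int (a - b * int k) / of_int b :: 'k)"
      using b by (simp add: q field_simps)
    then have "abs_val (of_rat q - of_nat k) = c ^ m * abs_val (of_int d)"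
      unfolding d by (simp add: av_divide av_mult av_pp int_eq[OF pb])
    also have "\<dots> \<le> c ^ m" using int_le[of d] c by (simp add: mult_left_le)
    finally have "abs_val (of_rat q - of_nat k) \<le> c ^ m" .
    then have "abs_val (x - of_nat k) \<le> c ^ m"
      using av_diff_trans[of x "of_nat k" "of_rat q"] xq by auto
    with k show ?thesis by blast
  qed
  define S where "S = {x \<in> F. abs_val x \<le> 1}"
  have "K.mtotally_bounded S"
    unfolding K.mtotally_bounded_def
  proof (intro allI impI)
    fix \<epsilon> :: real assume "\<epsilon> > 0"
    then obtain m where m: "c ^ m < \<epsilon>" using real_arch_pow_inv[of \<epsilon> c] c by blast
    have "of_nat k \<in> S" for k using nat int_le[of "int k"] by (auto simp: S_def)
    moreover have "S \<subseteq> (\<Union>x\<in>of_nat ` {..<p ^ m}. K.mball x \<epsilon>)"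
    proof
      fix x assume "x \<in> S"
      then obtain k where "k < p ^ m" "abs_val (x - of_nat k) \<le> c ^ m" using net S_def by blast
      with m show "x \<in> (\<Union>x\<in>of_nat ` {..<p ^ m}. K.mball x \<epsilon>)"
        by (auto simp: K.mball_def av_diff_commute intro!: bexI[of _ k])
    qed
    ultimately show "\<exists>K. finite K \<and> K \<subseteq> S \<and> S \<subseteq> (\<Union>x\<in>K. K.mball x \<epsilon>)"
      by (intro exI[of _ "of_nat ` {..<p ^ m}"]) auto
  qed
  have "bolzano_weierstrass F" unfolding bolzano_weierstrass_def
  proof (intro allI impI, elim conjE)
    fix X R assume X: "range X \<subseteq> F" "\<forall>n::nat. abs_val (X n) \<le> R"
    \<comment> \<open>The exponent m is chosen with |p^m| (|R| + 1) < 1, so that multiplication by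
      p^m maps the sequence into S.\<close>
    have "1 / (\<bar>R\<bar> + 1) > 0" by simp
    then obtain m where m: "c ^ m < 1 / (\<bar>R\<bar> + 1)" using real_arch_pow_inv c(2) by blast
    define Y where "Y n = of_nat p ^ m * X n" for n
    have avY: "abs_val (Y n - Y n') = c ^ m * abs_val (X n - X n')" for n n'
      unfolding Y_def right_diff_distrib[symmetric] by (simp add: av_mult av_pp)
    have "abs_val (Y n) \<le> 1" for n
    proof -
      have "abs_val (Y n) \<le> c ^ m * (\<bar>R\<bar> + 1)"
        using X(2)[rule_format, of n] c unfolding Y_def av_mult av_pp by (intro mult_left_mono) auto
      also have "\<dots> \<le> 1" using m by (simp add: field_simps)
      finally show ?thesis .
    qed
    moreover have "Y n \<in> F" for n
    proof -
      have "of_nat p ^ m \<in> F" by (induction m) (auto intro: f nat)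
      then show ?thesis using f(4) X(1) by (simp add: Y_def range_subsetD)
    qed
    ultimately have "range Y \<subseteq> S" by (auto simp: S_def)
    with \<open>K.mtotally_bounded S\<close> obtain s :: "nat \<Rightarrow> nat" where s: "strict_mono s" "K.MCauchy (Y \<circ> s)"
      unfolding K.mtotally_bounded_sequentially by blast
    have "\<exists>l\<in>F. \<forall>r::real. \<exists>N. \<forall>n\<ge>N. w ((X \<circ> s) n - l) > ereal r"
    proof (rule complete)
      show "range (X \<circ> s) \<subseteq> F" using X by auto
      show "\<forall>r. \<exists>N. \<forall>m\<ge>N. \<forall>n\<ge>N. ereal r < w ((X \<circ> s) m - (X \<circ> s) n)"
      proof
        fix r
        have "c ^ m * exp (- (real e * r)) > 0" using c by simp
        then obtain N where N: "\<And>n n'. n \<ge> N \<Longrightarrow> n' \<ge> N \<Longrightarrow>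
            abs_val ((Y \<circ> s) n - (Y \<circ> s) n') < c ^ m * exp (- (real e * r))"
          using s(2) unfolding K.MCauchy_def by blast
        show "\<exists>N. \<forall>m\<ge>N. \<forall>n\<ge>N. ereal r < w ((X \<circ> s) m - (X \<circ> s) n)"
        proof (intro exI[of _ N] allI impI)
          fix n n' assume "n \<ge> N" "n' \<ge> N"
          then have "abs_val (X (s n) - X (s n')) < exp (- (real e * r))"
            using N[of n n'] c by (simp add: avY)
          moreover have "X (s n) - X (s n') \<in> F" using f(3) X(1) by (simp add: range_subsetD)
          ultimately show "ereal r < w ((X \<circ> s) n - (X \<circ> s) n')" using less_w by simp
        qed
      qed
    qed
    then obtain l where l: "l \<in> F" "\<And>r::real. \<exists>N. \<forall>n\<ge>N. w (X (s n) - l) > ereal r" by auto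
    have "(\<lambda>n. abs_val (X (s n) - l)) \<longlonglongrightarrow> 0"
    proof (rule LIMSEQ_I)
      fix \<epsilon> :: real assume "\<epsilon> > 0"
      obtain N where N: "\<forall>n\<ge>N. w (X (s n) - l) > ereal (- ln \<epsilon> / real e)" using l(2) by blast
      have "abs_val (X (s n) - l) < \<epsilon>" if "n \<ge> N" for n
        using less_w[OF f(3)[OF range_subsetD[OF X(1)] l(1)], of "s n" "- ln \<epsilon> / real e"] N that Fw(3) \<open>\<epsilon> > 0\<close>
        by simp
      then show "\<exists>no. \<forall>n\<ge>no. norm (abs_val (X (s n) - l) - 0) < \<epsilon>" by auto
    qed
    with l s show "\<exists>l\<in>F. \<exists>s::nat\<Rightarrow>nat. strict_mono s \<and> (\<lambda>n. abs_val (X (s n) - l)) \<longlonglongrightarrow> 0" by blast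
  qed
  moreover obtain B where B: "finite B" "\<forall>x. \<exists>c. (\<forall>b\<in>B. c b \<in> F) \<and> x = (\<Sum>b\<in>B. c b * b)"
    using Fw(2) unfolding finite_extension_def by blast
  ultimately have "bolzano_weierstrass {\<Sum>b\<in>B. c b * b | c. \<forall>b\<in>B. c b \<in> F}" using bolzano_weierstrass_span sub by blast
  moreover have "{\<Sum>b\<in>B. c b * b | c. \<forall>b\<in>B. c b \<in> F} = UNIV" using B(2) by blast
  ultimately show ?thesis by simp
qed

lemma compactin_unit_ball: "compactin K.mtopology {x. abs_val x \<le> 1}"
  unfolding K.compactin_sequentially
proof (intro conjI allI impI)
  fix X :: "nat \<Rightarrow> 'k" assume X: "range X \<subseteq> {x. abs_val x \<le> 1}"
  then have "abs_val (X n) \<le> 1" for n by auto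
  then obtain l s where l: "strict_mono (s::nat\<Rightarrow>nat)" "(\<lambda>n. abs_val (X (s n) - l)) \<longlonglongrightarrow> 0"
    by (rule bolzano_weierstrassE[OF bolzano_weierstrass_UNIV UNIV_I])
  \<comment> \<open>By the ultrametric inequality, a single term at distance below 1 from the limit
    already forces |l| <= 1.\<close>
  then have "eventually (\<lambda>n. abs_val (X (s n) - l) < 1) sequentially"
    by (intro order_tendstoD(2)) auto
  then obtain n where "abs_val (X (s n) - l) < 1" by (auto simp: eventually_sequentially)
  moreover have "abs_val (X (s n)) \<le> 1" using X by auto
  ultimately have "abs_val l \<le> 1" using av_diff[of "X (s n)" "X (s n) - l"] by auto
  with l show "\<exists>l s. l \<in> {x. abs_val x \<le> 1} \<and> strict_mono s \<and> limitin K.mtopology (X \<circ> s) l sequentially"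
    by (intro exI[of _ l] exI[of _ s]) (auto simp: K.limitin_metric_dist_null)
qed auto

end


section \<open>Weighted norms and Gauss-Jordan elimination\<close>

definition transvection :: "'n \<Rightarrow> 'n \<Rightarrow> 'k::ring_1 \<Rightarrow> 'k^'n^'n::finite" where
  "transvection i j c = (\<chi> k l. (if k = l then 1 else 0) + (if k = i \<and> l = j then c else 0))"

text \<open>The product of the transvections with parameters \<open>k\<close>, \<open>i\<close>,
  \<open>c k\<close> over all k other than i: one round of Gauss-Jordan elimination.\<close>

definition column_transvection :: "'n \<Rightarrow> ('n \<Rightarrow> 'k::ring_1) \<Rightarrow> 'k^'n^'n::finite" where
  "column_transvection i c = (\<chi> k l. if k = l then 1 else if l = i then c k else 0)"

text \<open>The factor t is indexed by the row, so this is diag(t) times the permutation matrix of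
  w, the form used in \<open>monomial_rep\<close>.\<close>

definition monomial_matrix :: "('n \<Rightarrow> 'n) \<Rightarrow> ('n \<Rightarrow> 'k::zero) \<Rightarrow> 'k^'n^'n::finite" where
  "monomial_matrix w t = (\<chi> k l. if k = w l then t k else 0)"

lemma transvection_mult:
  "(transvection i j c ** M) $ k $ l = M $ k $ l + (if k = i then c * M $ j $ l else 0)"
  by (simp add: transvection_def matrix_matrix_mult_def distrib_right sum.distrib if_distrib[of "\<lambda>x. x * _"]
      if_conn(1) cong: if_cong)

lemma vmult_transvection:
  fixes c :: "'k::field"
  shows "(f v* transvection i j c) $ l = f $ l + (if l = j then c * f $ i else 0)"
  by (simp add: transvection_def vector_matrix_mult_def distrib_left sum.distrib mult_delta_right if_conn(1)
      mult.commute cong: if_cong)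

lemma column_transvection_mult:
  "(column_transvection i c ** M) $ k $ l = M $ k $ l + (if k = i then 0 else c k * M $ i $ l)"
proof -
  have "(column_transvection i c ** M) $ k $ l = 
      (\<Sum>m\<in>UNIV. (if k = m then M $ m $ l else 0) + (if m = i then (if k = i then 0 else c k * M $ m $ l) else 0))"
    unfolding column_transvection_def matrix_matrix_mult_def by (auto intro!: sum.cong)
  then show ?thesis by (simp add: sum.distrib)
qed

lemma column_transvection_inverse:
  "column_transvection i (\<lambda>k. - c k) ** column_transvection i c = mat 1"
  by (simp add: vec_eq_iff column_transvection_mult) (simp add: column_transvection_def mat_def)

lemma vmult_monomial_matrix:
  fixes f :: "'k::field^'n::finite"
  shows "(f v* monomial_matrix w t) $ l = t (w l) * f $ (w l)"
  by (simp add: monomial_matrix_def vector_matrix_mult_def mult_delta_right mult.commute)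

lemma monomial_matrix_mult:
  fixes t :: "'n::finite \<Rightarrow> 'k::field"
  assumes "bij w"
  shows "monomial_matrix w t ** monomial_matrix w' t' = monomial_matrix (w \<circ> w') (\<lambda>k. t k * t' (inv_into UNIV w k))"
proof -
  have "(\<Sum>m\<in>UNIV. (if k = w m then t k else 0) * (if m = w' l then t' m else 0)) =
      (if k = w (w' l) then t k * t' (inv_into UNIV w k) else 0)" for k l
  proof -
    have "(\<Sum>m\<in>UNIV. (if k = w m then t k else 0) * (if m = w' l then t' m else 0)) =
      (\<Sum>m\<in>UNIV. if m = w' l then (if k = w m then t k * t' m else 0) else 0)"
      by (intro sum.cong) auto
    then show ?thesis using assms by (simp add: inv_f_f bij_is_inj)
  qed
  then show ?thesis by (simp add: monomial_matrix_def matrix_matrix_mult_def)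
qed

lemma axis_vmult:
  fixes M :: "'k::field^'n::finite^'m::finite"
  shows "axis i 1 v* M = M $ i"
  by (simp add: vec_eq_iff vector_matrix_mult_def axis_def mult_delta_left)

lemma vmult_assoc:
  fixes f :: "'k::field^'n::finite" and A B :: "'k^'n^'n"
  shows "f v* (A ** B) = (f v* A) v* B"
  by (simp add: vector_matrix_mul_assoc)

lemma vmult_mat_1:
  fixes f :: "'k::field^'n::finite"
  shows "f v* mat 1 = f"
  by (rule vector_matrix_mul_rid)

section \<open>Seminorms that are diagonal in the coordinates, and their elementary
  isometries\<close>

context valued_field
begin

definition weighted_norm :: "real^'n::finite \<Rightarrow> 'k^'n \<Rightarrow> real" where
  "weighted_norm y f = Max (range (\<lambda>i. y $ i * abs_val (f $ i)))"

lemma weighted_norm_le_iff: "weighted_norm y f \<le> b \<longleftrightarrow> (\<forall>i. y $ i * abs_val (f $ i) \<le> b)"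
  unfolding weighted_norm_def by (subst Max_le_iff) auto

lemma weighted_norm_ge: "y $ i * abs_val (f $ i) \<le> weighted_norm y f"
  unfolding weighted_norm_def by (intro Max_ge) auto

lemma weighted_norm_attained: "\<exists>i. weighted_norm y f = y $ i * abs_val (f $ i)"
proof -
  have "weighted_norm y f \<in> range (\<lambda>i. y $ i * abs_val (f $ i))" unfolding weighted_norm_def by (intro Max_in) auto
  then show ?thesis by auto
qed

text \<open>Evaluation on the coordinate forms recovers the weights, so the norm determines
  y.\<close>

lemma weighted_norm_axis:
  assumes "\<And>i. y $ i \<ge> 0"
  shows "weighted_norm y (axis i 1) = y $ i"
proof (rule antisym)
  show "weighted_norm y (axis i 1) \<le> y $ i" using assms by (auto simp: weighted_norm_le_iff axis_def)
  show "y $ i \<le> weighted_norm y (axis i 1)" using weighted_norm_ge[of y i "axis i 1"] by (simp add: axis_def)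
qed

lemma weighted_norm_scale_weight: "c \<ge> 0 \<Longrightarrow> weighted_norm (c *\<^sub>R y) f = c * weighted_norm y f"
  unfolding weighted_norm_def by (subst mono_Max_commute[of "\<lambda>x. c * x"]) (auto simp: mono_def mult_left_mono image_image mult.assoc)

lemma weighted_norm_scale: "weighted_norm y (c *s f) = abs_val c * weighted_norm y f"
  unfolding weighted_norm_def 
  by (subst mono_Max_commute[of "\<lambda>x. abs_val c * x"]) (auto simp: mono_def mult_left_mono image_image av_mult mult.left_commute)

text \<open>The classes of these matrices will make up part of U_x for the point x with weights y:
  the inequality is the exponential form of psi_a(u) >= f_x(a) for a = a_ij. It also covers zero
  weights, since it allows every c if y_j = 0 and only c = 0 if y_j > 0 = y_i.\<close>

inductive_set elementary :: "real^'n \<Rightarrow> ('k^'n^'n::finite) set" for y where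
  one: "mat 1 \<in> elementary y"
| step: "M \<in> elementary y \<Longrightarrow> i \<noteq> j \<Longrightarrow> abs_val c * y $ j \<le> y $ i \<Longrightarrow> M ** transvection i j c \<in> elementary y"

lemma elementary_mult: "B \<in> elementary y \<Longrightarrow> A \<in> elementary y \<Longrightarrow> A ** B \<in> elementary y"
  by (induction rule: elementary.induct) (auto simp: matrix_mul_assoc intro: elementary.intros)

lemma elementary_transvection:
  "i \<noteq> j \<Longrightarrow> abs_val c * y $ j \<le> y $ i \<Longrightarrow> transvection i j c \<in> elementary y"
  using elementary.step[OF elementary.one] by (metis matrix_mul_lid)

lemma elementary_inverse:
  assumes "M \<in> elementary y"
  obtains M' where "M' \<in> elementary y" "M ** M' = mat 1" "M' ** M = mat 1"
proof -
  from assms have "\<exists>M'\<in>elementary y. M' ** M = mat 1"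
  proof induction
    case one
    then show ?case using elementary.one by (metis matrix_mul_lid)
  next
    case (step M i j c)
    then obtain M' where M': "M' \<in> elementary y" "M' ** M = mat 1" by blast
    let ?T = "transvection i j (- c)"
    have "?T ** transvection i j c = mat 1"
      using step(2) by (auto simp: vec_eq_iff transvection_mult) (auto simp: transvection_def mat_def)
    moreover have "(?T ** M') ** (M ** transvection i j c) = ?T ** ((M' ** M) ** transvection i j c)"
      by (simp only: matrix_mul_assoc)
    ultimately have "(?T ** M') ** (M ** transvection i j c) = mat 1" by (simp add: M')
    moreover have "?T ** M' \<in> elementary y"
      using elementary_mult[OF M'(1) elementary_transvection] step by simp
    ultimately show ?case by blast
  qed
  then show thesis using that matrix_left_right_inverse by blast
qed

text \<open>Only coordinate j changes, and its new term satisfies y_j |c f_i| <= y_i |f_i|. Applied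
  to the inverse transvection as well, the bound becomes an equality.\<close>

lemma weighted_norm_transvection_le:
  assumes "\<And>i. y $ i \<ge> 0" "abs_val c * y $ j \<le> y $ i"
  shows "weighted_norm y (f v* transvection i j c) \<le> weighted_norm y f"
  unfolding weighted_norm_le_iff
proof
  fix l
  show "y $ l * abs_val ((f v* transvection i j c) $ l) \<le> weighted_norm y f"
  proof (cases "l = j")
    case True
    have "y $ j * abs_val (f $ j + c * f $ i) \<le> y $ j * max (abs_val (f $ j)) (abs_val (c * f $ i))"
      by (intro mult_left_mono av_add assms)
    also have "\<dots> = max (y $ j * abs_val (f $ j)) (abs_val c * y $ j * abs_val (f $ i))"
      using assms(1)[of j] by (simp add: max_mult_distrib_left av_mult ac_simps)
    also have "\<dots> \<le> weighted_norm y f"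
      using mult_right_mono[OF assms(2), of "abs_val (f $ i)"] weighted_norm_ge[of y i f] weighted_norm_ge[of y j f] by simp
    finally show ?thesis using True by (simp add: vmult_transvection)
  qed (simp add: vmult_transvection weighted_norm_ge)
qed

lemma weighted_norm_transvection:
  assumes "\<And>i. y $ i \<ge> 0" "i \<noteq> j" "abs_val c * y $ j \<le> y $ i"
  shows "weighted_norm y (f v* transvection i j c) = weighted_norm y f"
proof (rule antisym)
  show "weighted_norm y (f v* transvection i j c) \<le> weighted_norm y f" using weighted_norm_transvection_le assms by blast
  have "(f v* transvection i j c) v* transvection i j (- c) = f"
    using assms(2) by (simp add: vec_eq_iff vmult_transvection)
  then show "weighted_norm y f \<le> weighted_norm y (f v* transvection i j c)"
    using weighted_norm_transvection_le[of y "-c" j i "f v* transvection i j c"] assms by simp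
qed

lemma weighted_norm_elementary:
  assumes "M \<in> elementary y" "\<And>i. y $ i \<ge> 0"
  shows "weighted_norm y (f v* M) = weighted_norm y f"
  using assms(1) by induction (simp_all add: vmult_assoc vmult_mat_1 weighted_norm_transvection assms(2))

text \<open>The entries c k are inserted one at a time; each insertion is multiplication on the
  right by one admissible transvection.\<close>

lemma column_transvection_elementary:
  assumes "\<And>k. k \<noteq> i \<Longrightarrow> abs_val (c k) * y $ i \<le> y $ k"
  shows "column_transvection i c \<in> elementary y"
proof -
  have "finite R \<Longrightarrow> (column_transvection i (\<lambda>k. if k \<in> R then c k else 0)) \<in> elementary y" for R
  proof (induction rule: finite_induct)
    case empty
    have "column_transvection i (\<lambda>k. 0 :: 'k) = mat 1" by (simp add: column_transvection_def mat_def vec_eq_iff)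
    then show ?case using elementary.one[of y] by (simp only: empty_iff if_False)
  next
    case (insert k R)
    show ?case
    proof (cases "k = i")
      case True
      then have "column_transvection i (\<lambda>m. if m \<in> insert k R then c m else 0) =
        column_transvection i (\<lambda>k. if k \<in> R then c k else 0)"
        by (auto simp: column_transvection_def vec_eq_iff)
      then show ?thesis using insert by simp
    next
      case False
      have "column_transvection i (\<lambda>k. if k \<in> R then c k else 0) ** transvection k i (c k) =
          column_transvection i (\<lambda>m. if m \<in> insert k R then c m else 0)"
        using insert.hyps False
        by (auto simp: vec_eq_iff column_transvection_mult) (auto simp: column_transvection_def transvection_def)
      then show ?thesis using elementary.step[OF insert.IH False assms[OF False]] by simp
    qed
  qed
  from this[of UNIV] show ?thesis by simp
qed

text \<open>The pivot of row \<open>i\<close> is an entry where the norm of the row is attained, so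
  that the row operations clearing its column are isometries of \<open>weighted_norm y\<close>.\<close>

lemma elimination:
  fixes k :: "'k^'n::finite^'n"
  assumes nondeg: "\<And>f. f v* k = 0 \<Longrightarrow> f = 0"
    and y: "\<And>i. y $ i \<ge> 0" and y': "\<And>i. y' $ i \<ge> 0"
    and isom: "\<And>f. weighted_norm y' (f v* k) = weighted_norm y f"
  obtains u w t where "u \<in> elementary y" "bij w" "\<And>i. t i \<noteq> 0" "k = u ** monomial_matrix w t"
proof -
  \<comment> \<open>Invariant: each row i in S has a column \<open>\<sigma> i\<close> where only its
    own entry is nonzero. Since u is an isometry of y, the remaining factor m still relates the two
    norms, so row l of m has norm y_l under y'.\<close>
  have "finite S \<Longrightarrow> \<exists>u m \<sigma>. u \<in> elementary y \<and> k = u ** m \<and> (\<forall>f. f v* m = 0 \<longrightarrow> f = 0) \<and>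
      (\<forall>f. weighted_norm y' (f v* m) = weighted_norm y f) \<and> (\<forall>i\<in>S. m $ i $ \<sigma> i \<noteq> 0 \<and> (\<forall>l. l \<noteq> i \<longrightarrow> m $ l $ \<sigma> i = 0))" for S
  proof (induction rule: finite_induct)
    case empty
    then show ?case using nondeg isom by (intro exI[of _ "mat 1"] exI[of _ k]) (auto intro: elementary.one)
  next
    case (insert i S)
    then obtain u m \<sigma> where IH: "u \<in> elementary y" "k = u ** m" "\<And>f. f v* m = 0 \<Longrightarrow> f = 0"
      "\<And>f. weighted_norm y' (f v* m) = weighted_norm y f"
      "\<And>i. i \<in> S \<Longrightarrow> m $ i $ \<sigma> i \<noteq> 0" "\<And>i l. i \<in> S \<Longrightarrow> l \<noteq> i \<Longrightarrow> m $ l $ \<sigma> i = 0"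
      by metis
    have row: "weighted_norm y' (m $ l) = y $ l" for l
      using IH(4)[of "axis l 1"] by (simp add: axis_vmult weighted_norm_axis y)
    have "m $ i \<noteq> 0"
      using IH(3)[of "axis i 1"] by (auto simp: axis_vmult)
    \<comment> \<open>If y_i = 0, the row has norm 0 and every nonzero entry attains it; otherwise
      an entry attaining the norm cannot vanish.\<close>
    have "\<exists>j. m $ i $ j \<noteq> 0 \<and> y' $ j * abs_val (m $ i $ j) = y $ i"
    proof (cases "y $ i = 0")
      case True
      obtain j where "m $ i $ j \<noteq> 0" using \<open>m $ i \<noteq> 0\<close> by (auto simp: vec_eq_iff)
      moreover have "y' $ j * abs_val (m $ i $ j) = 0"
        using weighted_norm_ge[of y' j "m $ i"] row[of i] True y'[of j] by (intro antisym) auto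
      ultimately show ?thesis using True by auto
    next
      case False
      obtain j where "weighted_norm y' (m $ i) = y' $ j * abs_val (m $ i $ j)" using weighted_norm_attained by blast
      then show ?thesis using row[of i] False by (intro exI[of _ j]) auto
    qed
    then obtain j where j: "m $ i $ j \<noteq> 0" "y' $ j * abs_val (m $ i $ j) = y $ i" by blast
    define c where "c l = - (m $ l $ j / m $ i $ j)" for l
    define e where "e = column_transvection i c"
    define e' where "e' = column_transvection i (\<lambda>l. - c l)"
    \<comment> \<open>The choice of the pivot gives |m_lj / m_ij| y_i = y'_j |m_lj|, which is at
      most the norm y_l of row l.\<close>
    have c: "abs_val (c l) * y $ i \<le> y $ l" for l
    proof -
      have "abs_val (c l) * y $ i = y' $ j * abs_val (m $ l $ j)"
        using j(1) by (simp add: c_def av_divide flip: j(2))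
      also have "\<dots> \<le> y $ l" using weighted_norm_ge[of y' j "m $ l"] row[of l] by simp
      finally show ?thesis .
    qed
    have e: "e \<in> elementary y" "e' \<in> elementary y"
      unfolding e_def e'_def by (rule column_transvection_elementary, use c in simp)+
    have e'e: "e' ** e = mat 1" unfolding e_def e'_def by (rule column_transvection_inverse)
    then have ee': "e ** e' = mat 1" using matrix_left_right_inverse by blast
    have em: "(e ** m) $ l $ r = m $ l $ r + (if l = i then 0 else c l * m $ i $ r)" for l r
      unfolding e_def by (rule column_transvection_mult)
    have "u ** e' \<in> elementary y" using elementary_mult IH(1) e by blast
    moreover have "k = (u ** e') ** (e ** m)"
      by (metis IH(2) e'e matrix_mul_assoc matrix_mul_rid)
    moreover have "\<forall>f. f v* (e ** m) = 0 \<longrightarrow> f = 0"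
    proof (intro allI impI)
      fix f assume "f v* (e ** m) = 0"
      then have "f v* e = 0" using IH(3) by (simp add: vmult_assoc)
      then have "f v* (e ** e') = 0" by (simp add: vmult_assoc)
      then show "f = 0" by (simp add: ee' vmult_mat_1)
    qed
    moreover have "\<forall>f. weighted_norm y' (f v* (e ** m)) = weighted_norm y f"
      by (simp add: vmult_assoc IH(4) weighted_norm_elementary e y)
    moreover have "\<forall>i'\<in>insert i S. (e ** m) $ i' $ (\<sigma>(i := j)) i' \<noteq> 0 \<and>
        (\<forall>l. l \<noteq> i' \<longrightarrow> (e ** m) $ l $ (\<sigma>(i := j)) i' = 0)"
    proof
      fix i' assume i': "i' \<in> insert i S"
      show "(e ** m) $ i' $ (\<sigma>(i := j)) i' \<noteq> 0 \<and> (\<forall>l. l \<noteq> i' \<longrightarrow> (e ** m) $ l $ (\<sigma>(i := j)) i' = 0)"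
      proof (cases "i' = i")
        case True
        then show ?thesis using j by (simp add: em c_def)
      next
        case False
        then have "i' \<in> S" using i' by simp
        \<comment> \<open>Row i is zero in the columns cleared earlier, so adding multiples of it
          leaves those columns intact.\<close>
        then have "m $ i $ \<sigma> i' = 0" using IH(6)[of i' i] False by simp
        then show ?thesis using False IH(5,6)[OF \<open>i' \<in> S\<close>] by (simp add: em)
      qed
    qed
    ultimately show ?case by (intro exI conjI)
  qed
  from this[of UNIV] obtain u m \<sigma> where m: "u \<in> elementary y" "k = u ** m" "\<And>i. m $ i $ \<sigma> i \<noteq> 0"
    "\<And>i l. l \<noteq> i \<Longrightarrow> m $ l $ \<sigma> i = 0" by (metis finite UNIV_I)
  have "inj \<sigma>"
  proof (rule injI)
    fix i i' assume "\<sigma> i = \<sigma> i'"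
    then show "i = i'" using m(3)[of i'] m(4)[of i' i] by metis
  qed
  then have bij: "bij \<sigma>" by (simp add: finite_UNIV_inj_surj bij_def)
  define w where "w = inv_into UNIV \<sigma>"
  define t where "t i = m $ i $ \<sigma> i" for i
  have "bij w" using bij by (simp add: w_def bij_imp_bij_inv)
  moreover have "m = monomial_matrix w t"
  proof -
    have "m $ i $ l = (if i = w l then t i else 0)" for i l
    proof -
      have "l = \<sigma> (w l)" using bij by (simp add: w_def bij_is_surj surj_f_inv_f)
      then show ?thesis using m(4)[of i "w l"] by (auto simp: t_def)
    qed
    then show ?thesis by (simp add: monomial_matrix_def vec_eq_iff)
  qed
  ultimately show thesis using that[of u w t] m(1,2,3) by (simp add: t_def)
qed

text \<open>For equal weights every transvection with |c| <= 1 is elementary, and three of them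
  multiply to a transposition up to one sign. At the origin this absorbs the permutation left over
  by \<open>elimination\<close>.\<close>

lemma permutation_elementary:
  fixes w :: "'n::finite \<Rightarrow> 'n"
  assumes "bij w"
  obtains u t where "u \<in> elementary (1 :: real^'n)" "\<And>i. abs_val (t i) = 1" "u = monomial_matrix w t"
proof -
  have "w permutes UNIV" "finite (UNIV :: 'n set)" using assms by (auto intro: bij_imp_permutes)
  then have "\<exists>u\<in>elementary (1 :: real^'n). \<exists>t. (\<forall>i. abs_val (t i) = 1) \<and> u = monomial_matrix w t"
  proof (induction rule: permutes_induct)
    case id
    have "mat 1 = monomial_matrix id (\<lambda>_. 1 :: 'k)" by (simp add: mat_def monomial_matrix_def vec_eq_iff)
    then show ?case using elementary.one av_1 by metis
  next
    case (swap a b p)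
    then obtain u t where u: "u \<in> elementary (1 :: real^'n)" "\<And>i. abs_val (t i) = 1" "u = monomial_matrix p t"
      by blast
    \<comment> \<open>The usual Weyl element of SL_2 in the coordinates a and b; the sign lands in
      row b.\<close>
    let ?s = "transvection a b 1 ** (transvection b a (-1) ** transvection a b (1::'k))"
    let ?t = "\<lambda>k. if k = b then - 1 else (1::'k)"
    have s: "?s \<in> elementary (1 :: real^'n)"
      using \<open>a \<noteq> b\<close> by (intro elementary_mult elementary_transvection) auto
    have "?s = monomial_matrix (Transposition.transpose a b) ?t"
      using \<open>a \<noteq> b\<close>
      by (auto simp: vec_eq_iff transvection_mult)
        (auto simp: transvection_def monomial_matrix_def Transposition.transpose_def)
    then have "?s ** u = monomial_matrix (Transposition.transpose a b \<circ> p)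
        (\<lambda>k. ?t k * t (inv_into UNIV (Transposition.transpose a b) k))"
      by (simp add: u(3) monomial_matrix_mult)
    moreover have "?s ** u \<in> elementary (1 :: real^'n)" using elementary_mult u(1) s by blast
    moreover have "\<forall>k. abs_val (?t k * t (inv_into UNIV (Transposition.transpose a b) k)) = 1"
      by (simp add: av_mult u(2))
    ultimately show ?case by (intro bexI[of _ "?s ** u"] exI conjI)
  qed
  then show thesis using that by blast
qed

text \<open>The monomial factor left by \<open>elimination\<close> is an isometry of the max norm,
  so its rows have norm 1 and its nonzero entries are units; its permutation moves into u. This is
  the source of the factorization U_0 Z.\<close>

lemma elimination_diagonal:
  fixes k :: "'k^'n::finite^'n"
  assumes nondeg: "\<And>f. f v* k = 0 \<Longrightarrow> f = 0"
    and isom: "\<And>f. weighted_norm 1 (f v* k) = weighted_norm 1 f"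
  obtains u t where "u \<in> elementary 1" "\<And>i. abs_val (t i) = 1" "k = u ** monomial_matrix id t"
proof -
  obtain u w t where u: "u \<in> elementary 1" "bij w" "\<And>i. t i \<noteq> 0" "k = u ** monomial_matrix w t"
    using elimination[OF nondeg _ _ isom] by auto
  obtain s d where s: "s \<in> elementary 1" "\<And>i. abs_val (d i) = 1" "s = monomial_matrix w d"
    using permutation_elementary[OF u(2)] by metis
  obtain u' where u': "u' \<in> elementary 1" "u' ** u = mat 1" using elementary_inverse u(1) by metis
  have t: "abs_val (t i) = 1" for i
  proof -
    have "monomial_matrix w t = u' ** k" by (simp add: u(4) matrix_mul_assoc u'(2))
    then have "weighted_norm 1 (monomial_matrix w t $ i) = weighted_norm 1 (axis i 1)"
      by (simp add: vmult_assoc isom weighted_norm_elementary[OF u'(1)] flip: axis_vmult)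
    also have "\<dots> = 1" by (simp add: weighted_norm_axis)
    finally obtain l where "abs_val (monomial_matrix w t $ i $ l) = 1"
      using weighted_norm_attained[of 1 "monomial_matrix w t $ i"] by auto
    then show ?thesis by (simp add: monomial_matrix_def split: if_splits)
  qed
  \<comment> \<open>Moving the diagonal factor to the right of the permutation reindexes it by
    w.\<close>
  define t' where "t' i = t (w i) / d (w i)" for i
  have "d i \<noteq> 0" for i using s(2)[of i] by auto
  then have "monomial_matrix w t = s ** monomial_matrix id t'"
    using u(2) by (simp add: s(3) monomial_matrix_mult t'_def surj_f_inv_f bij_is_surj)
  then have "k = (u ** s) ** monomial_matrix id t'" by (simp add: u(4) matrix_mul_assoc)
  moreover have "u ** s \<in> elementary 1" using elementary_mult u s by blast
  moreover have "abs_val (t' i) = 1" for i by (simp add: t'_def av_divide t s)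
  ultimately show thesis using that by blast
qed

end


section \<open>Exponential coordinates on the compactified apartment\<close>

definition weights :: "(real^'n::finite) set" where
  "weights = {y. (\<forall>i. 0 \<le> y $ i) \<and> y \<noteq> 0}"

text \<open>\<open>point_of y\<close> is the point with exponential coordinates \<open>y\<close>, where 0 stands for \<open>exp (- \<infinity>)\<close>.\<close>

definition point_of :: "real^'n::finite \<Rightarrow> 'n apt_point" where
  "point_of y = apt {i. 0 < y $ i} (\<chi> i. ln (y $ i))"

lemma apt_eq_iff: "apt I x = apt J z \<longleftrightarrow> I = J \<and> (\<exists>c. \<forall>i\<in>I. z $ i = x $ i + c)"
proof
  assume eq: "apt I x = apt J z"
  have "\<exists>c. \<forall>i\<in>J. z $ i = z $ i + c" by (intro exI[of _ 0]) simp
  then show "I = J \<and> (\<exists>c. \<forall>i\<in>I. z $ i = x $ i + c)" using eq unfolding apt_def by blast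
next
  assume "I = J \<and> (\<exists>c. \<forall>i\<in>I. z $ i = x $ i + c)"
  then obtain c where c: "I = J" "\<And>i. i \<in> I \<Longrightarrow> z $ i = x $ i + c" by blast
  have "(\<exists>a. \<forall>i\<in>I. y $ i = x $ i + a) \<longleftrightarrow> (\<exists>a. \<forall>i\<in>I. y $ i = z $ i + a)" for y
  proof
    assume "\<exists>a. \<forall>i\<in>I. y $ i = x $ i + a"
    then obtain a where "\<forall>i\<in>I. y $ i = x $ i + a" ..
    then show "\<exists>a. \<forall>i\<in>I. y $ i = z $ i + a" using c by (intro exI[of _ "a - c"]) simp
  next
    assume "\<exists>a. \<forall>i\<in>I. y $ i = z $ i + a"
    then obtain a where "\<forall>i\<in>I. y $ i = z $ i + a" ..
    then show "\<exists>a. \<forall>i\<in>I. y $ i = x $ i + a" using c by (intro exI[of _ "a + c"]) simp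
  qed
  then show "apt I x = apt J z" unfolding apt_def c(1)[symmetric] by (intro arg_cong2[of _ _ _ _ Pair] Collect_cong refl)
qed

lemma weightsD: "y \<in> weights \<Longrightarrow> 0 \<le> y $ i" by (simp add: weights_def)

lemma weights_scale: "y \<in> weights \<Longrightarrow> c > 0 \<Longrightarrow> c *\<^sub>R y \<in> weights" by (simp add: weights_def)

lemma weights_zero_iff: "y \<in> weights \<Longrightarrow> \<not> 0 < y $ i \<longleftrightarrow> y $ i = 0" by (drule weightsD[of y i]) linarith

lemma weights_pos: "y \<in> weights \<Longrightarrow> \<exists>i. 0 < y $ i"
  by (rule ccontr) (auto simp: weights_zero_iff weights_def vec_eq_iff antisym not_less)

text \<open>The additive constant that is divided out in Lambda_I becomes a positive factor on the
  weights, while the index set fixes which weights vanish.\<close>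

lemma point_of_eq_iff:
  assumes "y \<in> weights" "z \<in> weights"
  shows "point_of y = point_of z \<longleftrightarrow> (\<exists>c>0. z = c *\<^sub>R y)"
proof
  assume "point_of y = point_of z"
  then obtain c where c: "{i. 0 < y $ i} = {i. 0 < z $ i}"
    "\<And>i. 0 < y $ i \<Longrightarrow> ln (z $ i) = ln (y $ i) + c"
    unfolding point_of_def apt_eq_iff by auto
  have "z $ i = exp c * y $ i" for i
  proof (cases "0 < y $ i")
    case True
    then have z: "0 < z $ i" using c(1) by blast
    have "z $ i = exp (ln (z $ i))" using z by simp
    also have "\<dots> = exp c * y $ i" using True unfolding c(2)[OF True] by (simp add: exp_add)
    finally show ?thesis .
  next
    case False
    then have "\<not> 0 < z $ i" using c(1) by blast
    then show ?thesis using False weightsD[OF assms(1), of i] weightsD[OF assms(2), of i] by simp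
  qed
  then show "\<exists>c>0. z = c *\<^sub>R y" by (intro exI[of _ "exp c"]) (simp add: vec_eq_iff)
next
  assume "\<exists>c>0. z = c *\<^sub>R y"
  then obtain c where c: "c > 0" "z = c *\<^sub>R y" by blast
  then show "point_of y = point_of z"
    unfolding point_of_def apt_eq_iff
    by (auto simp: zero_less_mult_iff ln_mult intro!: exI[of _ "ln c"])
qed

lemma apt_eq_point_of:
  assumes "I \<noteq> {}"
  shows "(\<chi> i. if i \<in> I then exp (x $ i) else 0) \<in> weights"
    "apt I x = point_of (\<chi> i. if i \<in> I then exp (x $ i) else 0)"
  using assms by (auto simp: weights_def vec_eq_iff point_of_def apt_eq_iff intro!: exI[of _ 0] split: if_splits)

lemma apt_UNIV_eq_point_of: "apt UNIV x = point_of (\<chi> i. exp (x $ i))" "(\<chi> i. exp (x $ i)) \<in> weights"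
  using apt_eq_point_of[of UNIV x] by simp_all

lemma apt_in_Lam_bar: "I \<noteq> {} \<Longrightarrow> apt I x \<in> Lam_bar"
  unfolding Lam_bar_def Lam_def by (rule UN_I[of I]) simp_all

lemma Lam_bar_eq_point_of: "Lam_bar = point_of ` (weights :: (real^'n::finite) set)"
proof (intro equalityI subsetI)
  fix p :: "'n apt_point" assume "p \<in> Lam_bar"
  then obtain I x where Ix: "I \<noteq> {}" "p = apt I x" by (auto simp: Lam_bar_def Lam_def)
  show "p \<in> point_of ` weights" unfolding Ix(2) apt_eq_point_of(2)[OF Ix(1)] by (rule imageI[OF apt_eq_point_of(1)[OF Ix(1)]])
next
  fix p :: "'n apt_point" assume "p \<in> point_of ` weights"
  then obtain y where y: "y \<in> weights" "p = point_of y" by blast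
  have "{i. 0 < y $ i} \<noteq> {}" using weights_pos[OF y(1)] by simp
  then show "p \<in> Lam_bar" unfolding y(2) point_of_def by (rule apt_in_Lam_bar)
qed

lemma infnorm_weights:
  assumes "y \<in> weights"
  shows "infnorm y > 0" "y $ i \<le> infnorm y" "\<exists>i. y $ i = infnorm y"
proof -
  show "infnorm y > 0" using assms by (simp add: weights_def infnorm_pos_lt)
  show "y $ i \<le> infnorm y" using component_le_infnorm_cart[of y i] by simp
  have "infnorm y = Max ((\<lambda>i. \<bar>y \<bullet> i\<bar>) ` Basis)" by (rule infnorm_Max)
  also have "\<dots> \<in> (\<lambda>i. \<bar>y \<bullet> i\<bar>) ` Basis" by (intro Max_in) auto
  finally obtain i where "infnorm y = \<bar>y $ i\<bar>" by (auto simp: Basis_vec_def inner_axis)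
  then show "\<exists>i. y $ i = infnorm y" using weightsD[OF assms, of i] by auto
qed

definition weight_of :: "'n::finite apt_point \<Rightarrow> real^'n" where
  "weight_of p = (SOME y. y \<in> weights \<and> infnorm y = 1 \<and> point_of y = p)"

lemma normalize_weights:
  assumes "y \<in> weights"
  shows "y /\<^sub>R infnorm y \<in> weights" "infnorm (y /\<^sub>R infnorm y) = 1" "point_of (y /\<^sub>R infnorm y) = point_of y"
proof -
  have pos: "infnorm y > 0" by (rule infnorm_weights[OF assms])
  show w: "y /\<^sub>R infnorm y \<in> weights" using weights_scale[OF assms] pos by simp
  show "infnorm (y /\<^sub>R infnorm y) = 1" using pos by (simp add: infnorm_mul)
  show "point_of (y /\<^sub>R infnorm y) = point_of y"
    unfolding point_of_eq_iff[OF w assms] using pos by (intro exI[of _ "infnorm y"]) simp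
qed

lemma weight_of_point_of:
  assumes "y \<in> weights"
  shows "weight_of (point_of y) = y /\<^sub>R infnorm y"
proof -
  let ?z = "y /\<^sub>R infnorm y"
  note z = normalize_weights[OF assms]
  have w: "weight_of (point_of y) \<in> weights \<and> infnorm (weight_of (point_of y)) = 1 \<and> point_of (weight_of (point_of y)) = point_of y"
    unfolding weight_of_def by (rule someI[of _ ?z]) (simp only: z simp_thms)
  then have "point_of ?z = point_of (weight_of (point_of y))" using z(3) by simp
  then obtain c where c: "c > 0" "weight_of (point_of y) = c *\<^sub>R ?z"
    using point_of_eq_iff[OF z(1)] w by blast
  have "infnorm (weight_of (point_of y)) = \<bar>c\<bar> * infnorm ?z" unfolding c(2) by (rule infnorm_mul)
  then have "infnorm (weight_of (point_of y)) = c" unfolding z(2) using c(1) by simp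
  then show ?thesis using w c by simp
qed

lemma weight_of_Lam_bar:
  assumes "p \<in> Lam_bar"
  shows "weight_of p \<in> weights" "infnorm (weight_of p) = 1" "point_of (weight_of p) = p"
proof -
  obtain y where y: "y \<in> weights" "p = point_of y" using assms unfolding Lam_bar_eq_point_of by (rule imageE)
  show "weight_of p \<in> weights" "infnorm (weight_of p) = 1" "point_of (weight_of p) = p"
    unfolding y(2) weight_of_point_of[OF y(1)] by (fact normalize_weights[OF y(1)])+
qed

section \<open>The topology of the compactified apartment in exponential coordinates\<close>

lemma openin_Lam_topology: "openin Lam_topology U \<longleftrightarrow> U \<subseteq> range (apt UNIV) \<and> open {x. apt UNIV x \<in> U}"
  by (simp add: Lam_topology_def openin_quotient_topology)

text \<open>Vectors represent the same point iff they differ by a constant vector, so the saturation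
  of B is a union of translates of B along the diagonal.\<close>

lemma openin_Lam_image:
  assumes "open B"
  shows "openin Lam_topology (apt UNIV ` B)"
proof -
  have "{x. apt UNIV x \<in> apt UNIV ` B} = (\<Union>c. (+) (\<chi> i. c) ` B)"
  proof (intro equalityI subsetI)
    fix x assume "x \<in> {x. apt UNIV x \<in> apt UNIV ` B}"
    then obtain b where b: "b \<in> B" "apt UNIV b = apt UNIV x" by force
    then obtain c where "\<forall>i. x $ i = b $ i + c" by (auto simp: apt_eq_iff)
    then have "x = (\<chi> i. c) + b" by (simp add: vec_eq_iff)
    with b show "x \<in> (\<Union>c. (+) (\<chi> i. c) ` B)" by blast
  next
    fix x assume "x \<in> (\<Union>c. (+) (\<chi> i. c) ` B)"
    then obtain c b where b: "b \<in> B" "x = (\<chi> i. c) + b" by blast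
    then have "apt UNIV b = apt UNIV x" by (auto simp: apt_eq_iff)
    with b show "x \<in> {x. apt UNIV x \<in> apt UNIV ` B}" by (metis image_eqI mem_Collect_eq)
  qed
  then show ?thesis using assms by (simp add: openin_Lam_topology open_translation open_UN image_mono)
qed

lemma D_cone_iff: "d \<in> D_cone I \<longleftrightarrow> (\<forall>i\<in>I. d $ i = 0) \<and> (\<forall>i. d $ i \<le> 0)"
proof -
  have comp: "(\<Sum>i\<in>-I. c i *\<^sub>R (- axis i 1)) $ k = (if k \<in> I then 0 else - c k)" for c :: "'a \<Rightarrow> real" and k
    by (simp add: axis_def sum_negf if_distrib[of "\<lambda>x. _ * x"] cong: if_cong)
  show ?thesis
  proof
    assume "d \<in> D_cone I"
    then obtain c where c: "\<And>i. 0 \<le> c i" "d = (\<Sum>i\<in>-I. c i *\<^sub>R (- axis i 1))" by (auto simp: D_cone_def)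
    have "d $ k = (if k \<in> I then 0 else - c k)" for k unfolding c(2) by (rule comp)
    then show "(\<forall>i\<in>I. d $ i = 0) \<and> (\<forall>i. d $ i \<le> 0)" using c(1) by simp
  next
    assume d: "(\<forall>i\<in>I. d $ i = 0) \<and> (\<forall>i. d $ i \<le> 0)"
    have "d = (\<Sum>i\<in>-I. (- d $ i) *\<^sub>R (- axis i 1))"
      unfolding vec_eq_iff comp using d by simp
    then show "d \<in> D_cone I"
      unfolding D_cone_def using d by (intro CollectI exI[of _ "\<lambda>i. - d $ i"] conjI) simp_all
  qed
qed

text \<open>The part U + D_I is the case J = UNIV, where r_J is the identity; one formula then
  covers all strata.\<close>

lemma C_set_alt:
  assumes "I \<noteq> UNIV"
  shows "C_set U I = {apt J (u + d) | J u d. I \<subseteq> J \<and> apt UNIV u \<in> U \<and> d \<in> D_cone I}" (is "_ = ?R")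
proof (intro equalityI subsetI)
  fix p assume "p \<in> C_set U I"
  then show "p \<in> ?R" unfolding C_set_def plus_D_def by (force simp: r_proj_apt)
next
  fix p assume "p \<in> ?R"
  then obtain J u d where p: "p = apt J (u + d)" "I \<subseteq> J" "apt UNIV u \<in> U" "d \<in> D_cone I" by blast
  then have pD: "apt UNIV (u + d) \<in> plus_D U I" by (auto simp: plus_D_def)
  show "p \<in> C_set U I"
  proof (cases "J = UNIV")
    case True
    then show ?thesis using pD p by (simp add: C_set_def)
  next
    case False
    have "p \<in> r_proj J ` plus_D U I" using pD by (metis image_eqI p(1) r_proj_apt)
    then show ?thesis using False p(2) by (auto simp: C_set_def)
  qed
qed

text \<open>Adding an element of D_I lowers coordinates outside I, and passing to a stratum sends
  some of them to minus infinity. On weights both together mean: equal to exp u on I and at most exp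
  u elsewhere.\<close>

lemma point_of_in_C_set_iff:
  assumes "y \<in> weights" "I \<noteq> UNIV"
  shows "point_of y \<in> C_set U I \<longleftrightarrow>
    (\<exists>u. apt UNIV u \<in> U \<and> (\<forall>i\<in>I. y $ i = exp (u $ i)) \<and> (\<forall>i. y $ i \<le> exp (u $ i)))"
proof
  assume "point_of y \<in> C_set U I"
  then obtain J u d where J: "point_of y = apt J (u + d)" "I \<subseteq> J" "apt UNIV u \<in> U" "d \<in> D_cone I"
    unfolding C_set_alt[OF assms(2)] by blast
  then obtain c where c: "J = {i. 0 < y $ i}" "\<And>i. 0 < y $ i \<Longrightarrow> u $ i + d $ i = ln (y $ i) + c"
    unfolding point_of_def apt_eq_iff by auto
  \<comment> \<open>Equality of points holds up to a common constant c; subtracting it from u keeps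
    the point and makes the equations exact.\<close>
  define u' where "u' = u - (\<chi> i. c)"
  have u': "apt UNIV u' = apt UNIV u" by (auto simp: u'_def apt_eq_iff)
  have y: "y $ i = exp (u' $ i + d $ i)" if "0 < y $ i" for i
  proof -
    have "u' $ i + d $ i = ln (y $ i)" using c(2)[OF that] by (simp add: u'_def)
    then show ?thesis using that by simp
  qed
  have "y $ i = exp (u' $ i)" if "i \<in> I" for i
    using y[of i] that J(2,4) c(1) by (auto simp: D_cone_iff)
  moreover have "y $ i \<le> exp (u' $ i)" for i
  proof (cases "0 < y $ i")
    case True
    then show ?thesis using y[OF True] J(4) by (simp add: D_cone_iff)
  next
    case False
    then show ?thesis using exp_gt_zero[of "u' $ i"] by linarith
  qed
  ultimately show "\<exists>u. apt UNIV u \<in> U \<and> (\<forall>i\<in>I. y $ i = exp (u $ i)) \<and> (\<forall>i. y $ i \<le> exp (u $ i))"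
    using u' J(3) by (intro exI[of _ u']) auto
next
  assume "\<exists>u. apt UNIV u \<in> U \<and> (\<forall>i\<in>I. y $ i = exp (u $ i)) \<and> (\<forall>i. y $ i \<le> exp (u $ i))"
  then obtain u where u: "apt UNIV u \<in> U" "\<And>i. i \<in> I \<Longrightarrow> y $ i = exp (u $ i)" "\<And>i. y $ i \<le> exp (u $ i)"
    by blast
  \<comment> \<open>Where y_i = 0, the index lies outside the support and \<open>apt\<close> does
    not see this coordinate; the default 0 keeps d in the cone.\<close>
  define d :: "real^'a" where "d = (\<chi> i. if 0 < y $ i then ln (y $ i) - u $ i else 0)"
  have "ln (y $ i) \<le> u $ i" if "0 < y $ i" for i
    using that u(3)[of i] by (metis exp_gt_zero ln_exp ln_le_cancel_iff)
  then have "d \<in> D_cone I" using u(2) by (auto simp: D_cone_iff d_def)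
  moreover have "I \<subseteq> {i. 0 < y $ i}" using u(2) by auto
  moreover have "point_of y = apt {i. 0 < y $ i} (u + d)"
    unfolding point_of_def by (auto simp: apt_eq_iff d_def intro!: exI[of _ 0])
  ultimately show "point_of y \<in> C_set U I"
    unfolding C_set_alt[OF assms(2)] using u(1) by blast
qed

lemma C_set_subset:
  assumes "I \<noteq> {}" "I \<noteq> UNIV"
  shows "C_set U I \<subseteq> Lam_bar"
proof
  fix p assume "p \<in> C_set U I"
  then obtain J u d where p: "p = apt J (u + d)" "I \<subseteq> J"
    unfolding C_set_alt[OF assms(2)] by blast
  then have "J \<noteq> {}" using assms(1) by blast
  then show "p \<in> Lam_bar" unfolding p(1) by (rule apt_in_Lam_bar)
qed

text \<open>The base of the topology is fine enough to control weights: a small box in Lambda lets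
  the weights on the support I vary by less than e, and the cone D_I together with the strata lets
  the others range below e. This yields the continuity of \<open>weight_of\<close>.\<close>

lemma Lam_bar_basic_neighbourhood:
  fixes y :: "real^'n::finite"
  assumes y: "y \<in> weights" and e: "e > 0"
  obtains W where "openin Lam_bar_topology W" "point_of y \<in> W"
    "\<And>p. p \<in> W \<Longrightarrow> \<exists>z\<in>weights. p = point_of z \<and> (\<forall>i. \<bar>z $ i - y $ i\<bar> < e)"
proof -
  define I where "I = {i. 0 < y $ i}"
  \<comment> \<open>The maximum with y_i / 2 keeps the argument of the logarithm positive. Outside I
    the lower bound makes the box bounded, as the sets C_U^I require.\<close>
  define lo :: "real^'n" where "lo = (\<chi> i. if i \<in> I then ln (max (y $ i - e) (y $ i / 2)) else ln e - 1)"
  define hi :: "real^'n" where "hi = (\<chi> i. if i \<in> I then ln (y $ i + e) else ln e)"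
  define B where "B = box lo hi"
  define U where "U = apt UNIV ` B"
  have U: "openin Lam_topology U" unfolding U_def B_def by (intro openin_Lam_image open_box)
  have U': "Lam_bounded U" unfolding Lam_bounded_def U_def B_def by (intro exI[of _ "box lo hi"]) auto
  have "I \<noteq> {}" using weights_pos[OF y] by (auto simp: I_def)
  have B: "\<bar>exp (b $ i) - y $ i\<bar> < e" if "b \<in> B" "i \<in> I" for b i
  proof -
    have "ln (max (y $ i - e) (y $ i / 2)) < b $ i" "b $ i < ln (y $ i + e)"
      using that(1)[unfolded B_def mem_box_cart, rule_format, of i] that(2) by (simp_all add: lo_def hi_def)
    moreover have "y $ i > 0" using that by (simp add: I_def)
    ultimately have "max (y $ i - e) (y $ i / 2) < exp (b $ i)" "exp (b $ i) < y $ i + e"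
      using e by (metis exp_less_cancel_iff exp_ln less_max_iff_disj half_gt_zero, 
        metis exp_less_cancel_iff exp_ln add_pos_pos)
    then show ?thesis by auto
  qed
  have B': "exp (b $ i) < e" if "b \<in> B" "i \<notin> I" for b i
  proof -
    have "b $ i < ln e"
      using that(1)[unfolded B_def mem_box_cart, rule_format, of i] that(2) by (simp add: hi_def)
    then show ?thesis using e by (metis exp_less_cancel_iff exp_ln)
  qed
  \<comment> \<open>A point of the box that witnesses membership of y: exact on the support, and
    above the zero weights elsewhere.\<close>
  define b0 :: "real^'n" where "b0 = (\<chi> i. if i \<in> I then ln (y $ i) else ln e - 1/2)"
  have b0: "b0 \<in> B"
    using e by (auto simp: B_def mem_box_cart lo_def hi_def b0_def I_def ln_less_cancel_iff max_def)
  have b0': "\<forall>i\<in>I. y $ i = exp (b0 $ i)" "\<forall>i. y $ i \<le> exp (b0 $ i)"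
    using weights_zero_iff[OF y] by (auto simp: b0_def I_def)
  define W where "W = (if I = UNIV then U else C_set U I)"
  have "openin Lam_bar_topology W"
    unfolding W_def Lam_bar_topology_def using U U' \<open>I \<noteq> {}\<close>
    by (intro topology_generated_by_Basis) auto
  moreover have "point_of y \<in> W"
  proof (cases "I = UNIV")
    case True
    then have "y = (\<chi> i. exp (b0 $ i))" using b0' by (simp add: vec_eq_iff)
    then have "point_of y = apt UNIV b0" by (simp add: apt_UNIV_eq_point_of)
    then show ?thesis using True b0 by (simp add: W_def U_def)
  next
    case False
    then show ?thesis
      using b0' b0 point_of_in_C_set_iff[OF y False, of U] by (auto simp: W_def U_def)
  qed
  moreover have "\<exists>z\<in>weights. p = point_of z \<and> (\<forall>i. \<bar>z $ i - y $ i\<bar> < e)" if "p \<in> W" for p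
  proof -
    have "\<exists>z\<in>weights. p = point_of z \<and> (\<exists>u. apt UNIV u \<in> U \<and> (\<forall>i\<in>I. z $ i = exp (u $ i)) \<and> (\<forall>i. z $ i \<le> exp (u $ i)))"
    proof (cases "I = UNIV")
      case True
      then have "p \<in> U" using that by (simp add: W_def)
      then obtain b where b: "p = apt UNIV b" unfolding U_def by (rule imageE)
      show ?thesis
        using \<open>p \<in> U\<close> unfolding b
        by (intro bexI[OF _ apt_UNIV_eq_point_of(2)[of b]] conjI exI[of _ b] apt_UNIV_eq_point_of(1)) simp_all
    next
      case False
      then have C: "p \<in> C_set U I" using that by (simp add: W_def)
      then obtain z where z: "z \<in> weights" "p = point_of z"
        using C_set_subset[OF \<open>I \<noteq> {}\<close> False] Lam_bar_eq_point_of by blast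
      then show ?thesis using C point_of_in_C_set_iff[OF z(1) False] by blast
    qed
    then obtain z u where z: "z \<in> weights" "p = point_of z" "apt UNIV u \<in> U" "\<And>i. i\<in>I \<Longrightarrow> z $ i = exp (u $ i)"
      "\<And>i. z $ i \<le> exp (u $ i)" by blast
    then obtain b where b: "b \<in> B" "apt UNIV b = apt UNIV u" by (force simp: U_def)
    then obtain c where c: "\<And>i. u $ i = b $ i + c" by (auto simp: apt_eq_iff)
    \<comment> \<open>The vector u lies in the box only after subtracting a constant c; the factor
      exp (- c) makes the same change on z.\<close>
    define z' where "z' = exp (- c) *\<^sub>R z"
    have "z' \<in> weights" "point_of z = point_of z'"
      using z(1) by (auto simp: z'_def weights_scale point_of_eq_iff intro!: exI[of _ "exp (- c)"])
    moreover have "\<bar>z' $ i - y $ i\<bar> < e" for i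
    proof (cases "i \<in> I")
      case True
      then have "z' $ i = exp (b $ i)" by (simp add: z'_def z(4) c flip: exp_add)
      then show ?thesis using B[OF b(1) True] by simp
    next
      case False
      have "z' $ i \<le> exp (- c) * exp (u $ i)" by (simp add: z'_def z(5))
      also have "\<dots> = exp (b $ i)" by (simp add: c flip: exp_add)
      also have "\<dots> < e" using B'[OF b(1) False] .
      finally have "z' $ i < e" .
      moreover have "y $ i = 0" using False weights_zero_iff[OF y] by (simp add: I_def)
      ultimately show ?thesis using weightsD[OF \<open>z' \<in> weights\<close>, of i] by simp
    qed
    ultimately show ?thesis using z(2) by blast
  qed
  ultimately show thesis using that by blast
qed

lemma topspace_Lam_bar: "topspace Lam_bar_topology = (Lam_bar :: 'n::finite apt_point set)"
proof
  have "U \<subseteq> Lam_bar" if "openin Lam_topology U" for U :: "'n apt_point set"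
    using that by (force simp: openin_Lam_topology Lam_bar_def Lam_def)
  then show "topspace Lam_bar_topology \<subseteq> (Lam_bar :: 'n apt_point set)"
    unfolding Lam_bar_topology_def topology_generated_by_topspace using C_set_subset by blast
  show "(Lam_bar :: 'n apt_point set) \<subseteq> topspace Lam_bar_topology"
  proof
    fix p :: "'n apt_point" assume "p \<in> Lam_bar"
    then obtain y where "y \<in> weights" "p = point_of y" using Lam_bar_eq_point_of by blast
    then show "p \<in> topspace Lam_bar_topology"
      using Lam_bar_basic_neighbourhood[of y 1] by (metis openin_subset subsetD zero_less_one)
  qed
qed

lemma continuous_map_weight_of: "continuous_map Lam_bar_topology euclidean (weight_of :: _ \<Rightarrow> real^'n::finite)"
  unfolding continuous_map_def
proof (intro conjI allI impI)
  fix V :: "(real^'n) set" assume "openin euclidean V"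
  then have V: "open V" by simp
  show "openin Lam_bar_topology {p \<in> topspace Lam_bar_topology. weight_of p \<in> V}"
  proof (subst openin_subopen, intro ballI)
    fix p assume "p \<in> {p \<in> topspace Lam_bar_topology. weight_of p \<in> V}"
    then have p: "p \<in> Lam_bar" "weight_of p \<in> V" by (auto simp: topspace_Lam_bar)
    define y where "y = weight_of p"
    have y: "y \<in> weights" "infnorm y = 1" "point_of y = p" using weight_of_Lam_bar[OF p(1)] by (auto simp: y_def)
    define f where "f = (\<lambda>z :: real^'n. z /\<^sub>R infnorm z)"
    have "isCont f y" unfolding f_def
      by (intro continuous_intros continuous_infnorm) (simp add: y(2))
    then have "(f \<longlongrightarrow> f y) (nhds y)" unfolding isCont_def tendsto_at_iff_tendsto_nhds .
    moreover have "f y \<in> V" using y(2) p(2) by (simp add: f_def y_def)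
    ultimately have "eventually (\<lambda>z. f z \<in> V) (nhds y)" using V by (intro topological_tendstoD)
    then obtain e where e: "e > 0" "\<And>z. dist z y < e \<Longrightarrow> z /\<^sub>R infnorm z \<in> V"
      unfolding f_def eventually_nhds_metric by blast
    \<comment> \<open>The Euclidean distance is at most the sum of the n coordinate differences, so
      a bound of e / n on each suffices.\<close>
    have "e / real CARD('n) > 0" using e by simp
    then obtain W where W: "openin Lam_bar_topology W" "point_of y \<in> W"
      "\<And>p. p \<in> W \<Longrightarrow> \<exists>z\<in>weights. p = point_of z \<and> (\<forall>i. \<bar>z $ i - y $ i\<bar> < e / real CARD('n))"
      using Lam_bar_basic_neighbourhood[OF y(1)] by metis
    have "weight_of q \<in> V" if "q \<in> W" for q
    proof -
      obtain z where z: "z \<in> weights" "q = point_of z" "\<And>i. \<bar>z $ i - y $ i\<bar> < e / real CARD('n)"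
        using W(3)[OF \<open>q \<in> W\<close>] by blast
      have "dist z y \<le> (\<Sum>i\<in>UNIV. \<bar>(z - y) $ i\<bar>)" unfolding dist_norm by (rule norm_le_l1_cart)
      also have "\<dots> < (\<Sum>i\<in>(UNIV::'n set). e / real CARD('n))" by (intro sum_strict_mono) (auto simp: z)
      also have "\<dots> = e" by simp
      finally show ?thesis using e(2) z by (simp add: weight_of_point_of)
    qed
    then show "\<exists>T. openin Lam_bar_topology T \<and> p \<in> T \<and> T \<subseteq> {p \<in> topspace Lam_bar_topology. weight_of p \<in> V}"
      using W(1,2) y(3) openin_subset[OF W(1)] by (intro exI[of _ W]) auto
  qed
qed auto

lemma open_positive: "open {z :: real^'n::finite. \<forall>i\<in>I. 0 < z $ i}"
proof -
  have "{z :: real^'n. \<forall>i\<in>I. 0 < z $ i} = (\<Inter>i\<in>I. {z. 0 < z $ i})" by auto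
  also have "open \<dots>" by (intro open_INT ballI open_Collect_less continuous_intros) auto
  finally show ?thesis .
qed

text \<open>It suffices to treat the generating sets. Open sets of Lambda are handled by continuity
  of the logarithm; for the sets C_U^I, a witness u from \<open>point_of_in_C_set_iff\<close> is
  moved continuously along with the weights.\<close>

lemma continuous_map_point_of: "continuous_map (top_of_set weights) Lam_bar_topology (point_of :: real^'n::finite \<Rightarrow> _)"
  unfolding Lam_bar_topology_def
proof (rule continuous_on_generated_topo)
  show "point_of ` topspace (top_of_set weights) \<subseteq> \<Union>({U. openin Lam_topology U} \<union>
      {C_set U I | U I. I \<noteq> {} \<and> I \<noteq> UNIV \<and> openin Lam_topology U \<and> Lam_bounded U})"
    unfolding topology_generated_by_topspace[symmetric] Lam_bar_topology_def[symmetric]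
    by (simp add: topspace_Lam_bar Lam_bar_eq_point_of)
next
  fix O' :: "'n apt_point set"
  assume "O' \<in> {U. openin Lam_topology U} \<union>
      {C_set U I | U I. I \<noteq> {} \<and> I \<noteq> UNIV \<and> openin Lam_topology U \<and> Lam_bounded U}"
  then consider "openin Lam_topology O'" | U I where "I \<noteq> UNIV" "openin Lam_topology U" "O' = C_set U I" by blast
  then have "\<exists>S. open S \<and> y \<in> S \<and> (\<forall>z\<in>S \<inter> weights. point_of z \<in> O')" if y: "y \<in> weights" "point_of y \<in> O'" for y
  proof cases
    case 1
    define L where "L = (\<lambda>z :: real^'n. \<chi> i. ln (z $ i))"
    define P where "P = {z :: real^'n. \<forall>i. 0 < z $ i}"
    have P: "point_of z = apt UNIV (L z)" if "z \<in> P" for z using that by (simp add: point_of_def P_def L_def)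
    have "open P" using open_positive[of UNIV] by (simp add: P_def)
    have nz: "z $ i \<noteq> 0" if "z \<in> P" for z i
    proof -
      have "0 < z $ i" using that by (simp add: P_def)
      then show ?thesis by simp
    qed
    have "continuous_on P L" unfolding L_def by (intro continuous_intros ballI nz)
    then have "open (P \<inter> L -` {x. apt UNIV x \<in> O'})"
      using 1 \<open>open P\<close> by (intro continuous_open_preimage) (auto simp: openin_Lam_topology)
    moreover have "y \<in> P"
    proof -
      obtain x where "point_of y = apt UNIV x" using 1 y by (auto simp: openin_Lam_topology)
      then show ?thesis by (auto simp: point_of_def apt_eq_iff P_def)
    qed
    ultimately show ?thesis using y(2) P by (intro exI[of _ "P \<inter> L -` {x. apt UNIV x \<in> O'}"]) auto
  next
    case 2
    obtain u where u: "apt UNIV u \<in> U" "\<And>i. i \<in> I \<Longrightarrow> y $ i = exp (u $ i)" "\<And>i. y $ i \<le> exp (u $ i)"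
      using y 2 point_of_in_C_set_iff[OF y(1) 2(1)] by auto
    \<comment> \<open>exp (L z) agrees with z on I and dominates it elsewhere, so L z witnesses
      membership in \<open>C_set U I\<close> as soon as its class lies in U. The maximum with exp
      (u_i) keeps L continuous at zero weights and gives L y = u.\<close>
    define L where "L = (\<lambda>z :: real^'n. \<chi> i. ln (if i \<in> I then z $ i else max (exp (u $ i)) (z $ i)))"
    define P where "P = {z :: real^'n. \<forall>i\<in>I. 0 < z $ i}"
    have "open P" unfolding P_def by (rule open_positive)
    have "continuous_on P L" unfolding L_def
    proof (intro continuous_intros)
      fix i
      show "continuous_on P (\<lambda>z. if i \<in> I then z $ i else max (exp (u $ i)) (z $ i))"
        by (cases "i \<in> I") (auto intro!: continuous_intros)
      have "0 < (if i \<in> I then z $ i else max (exp (u $ i)) (z $ i))" if "z \<in> P" for z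
        using that exp_gt_zero[of "u $ i"] by (simp add: P_def less_max_iff_disj)
      then show "\<forall>z\<in>P. (if i \<in> I then z $ i else max (exp (u $ i)) (z $ i)) \<noteq> 0" by (metis less_irrefl)
    qed
    then have "open (P \<inter> L -` {x. apt UNIV x \<in> U})"
      using 2 \<open>open P\<close> by (intro continuous_open_preimage) (auto simp: openin_Lam_topology)
    moreover have "y \<in> P" using u by (auto simp: P_def)
    moreover have "L y = u" using u by (auto simp: L_def vec_eq_iff max_absorb1)
    moreover have "point_of z \<in> O'" if z: "z \<in> P" "apt UNIV (L z) \<in> U" "z \<in> weights" for z
    proof -
      have "z $ i = exp (L z $ i)" if "i \<in> I" for i using that z(1) by (simp add: L_def P_def)
      moreover have "z $ i \<le> exp (L z $ i)" for i
      proof (cases "i \<in> I")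
        case False
        have "max (exp (u $ i)) (z $ i) > 0" using exp_gt_zero[of "u $ i"] by (simp add: less_max_iff_disj)
        then show ?thesis using False by (simp add: L_def)
      qed (use calculation in auto)
      ultimately show ?thesis using z point_of_in_C_set_iff[OF z(3) 2(1)] 2(3) by blast
    qed
    ultimately show ?thesis using u(1) by (intro exI[of _ "P \<inter> L -` {x. apt UNIV x \<in> U}"]) auto
  qed
  then have *: "\<And>y. y \<in> weights \<Longrightarrow> point_of y \<in> O' \<Longrightarrow> \<exists>S. open S \<and> y \<in> S \<and> (\<forall>z\<in>S \<inter> weights. point_of z \<in> O')" by blast
  show "openin (top_of_set weights) (point_of -` O' \<inter> topspace (top_of_set weights))"
  proof (subst openin_subopen, intro ballI)
    fix y assume "y \<in> point_of -` O' \<inter> topspace (top_of_set weights)"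
    then obtain S where "open S" "y \<in> S" "\<forall>z\<in>S \<inter> weights. point_of z \<in> O'" "y \<in> weights" using * by auto
    then show "\<exists>T. openin (top_of_set weights) T \<and> y \<in> T \<and> T \<subseteq> point_of -` O' \<inter> topspace (top_of_set weights)"
      by (intro exI[of _ "weights \<inter> S"]) (auto intro: openin_open_Int)
  qed
qed

lemma compact_space_Lam_bar: "compact_space (Lam_bar_topology :: 'n::finite apt_point topology)"
proof -
  define Y where "Y = cbox 0 (1::real^'n) \<inter> (\<Union>i. {y. y $ i = 1})"
  have "closed (\<Union>i. {y::real^'n. y $ i = 1})"
    by (intro closed_UN ballI closed_Collect_eq continuous_intros) auto
  then have "compact Y" unfolding Y_def by (intro compact_Int_closed compact_cbox)
  have Ycone: "Y \<subseteq> weights" by (auto simp: Y_def weights_def mem_box_cart)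
  then have "compactin (top_of_set weights) Y"
    using \<open>compact Y\<close> by (simp add: compactin_subtopology)
  then have "compactin Lam_bar_topology (point_of ` Y)" using continuous_map_point_of image_compactin by blast
  moreover have "point_of ` Y = Lam_bar"
  proof
    show "point_of ` Y \<subseteq> Lam_bar" using Ycone Lam_bar_eq_point_of by blast
    show "Lam_bar \<subseteq> point_of ` Y"
    proof
      fix p :: "'n apt_point" assume "p \<in> Lam_bar"
      note w = weight_of_Lam_bar[OF this]
      have "weight_of p \<in> Y"
        using infnorm_weights[OF w(1)] weightsD[OF w(1)] w(2) by (auto simp: Y_def mem_box_cart)
      then show "p \<in> point_of ` Y" using w(3) by (metis image_eqI)
    qed
  qed
  ultimately show ?thesis by (simp add: compact_space_def topspace_Lam_bar)
qed

text \<open>The inequality between the weights is homogeneous, hence a property of the point, and it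
  is closed because \<open>weight_of\<close> is continuous. Conversely, weights satisfying it are
  limits of positive weights satisfying it.\<close>

lemma point_of_in_closure_iff:
  fixes y :: "real^'n::finite"
  assumes y: "y \<in> weights" and ij: "i \<noteq> j"
  shows "point_of y \<in> Abstract_Topology.closure_of Lam_bar_topology (apt UNIV ` {z. z $ i - z $ j \<ge> - t}) \<longleftrightarrow>
    exp (- t) * y $ j \<le> y $ i" (is "_ \<in> Abstract_Topology.closure_of _ ?S \<longleftrightarrow> _")
proof
  assume point_of: "point_of y \<in> Abstract_Topology.closure_of Lam_bar_topology ?S"
  have "closed {z :: real^'n. exp (- t) * z $ j \<le> z $ i}"
    by (intro closed_Collect_le continuous_intros)
  then have "closedin Lam_bar_topology {p \<in> topspace Lam_bar_topology. weight_of p \<in> {z. exp (- t) * z $ j \<le> z $ i}}"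
    using continuous_map_weight_of by (intro closedin_continuous_map_preimage) auto
  moreover have "?S \<subseteq> {p \<in> topspace Lam_bar_topology. weight_of p \<in> {z. exp (- t) * z $ j \<le> z $ i}}"
  proof
    fix p assume "p \<in> ?S"
    then obtain z :: "real^'n" where z: "z $ i - z $ j \<ge> - t" "p = apt UNIV z" by blast
    define x :: "real^'n" where "x = (\<chi> i. exp (z $ i))"
    have x: "p = point_of x" "x \<in> weights" using apt_UNIV_eq_point_of[of z] z by (auto simp: x_def)
    have "exp (- t) * x $ j \<le> x $ i" using z(1) by (simp add: x_def flip: exp_add)
    then have "exp (- t) * weight_of p $ j \<le> weight_of p $ i"
      using infnorm_weights(1)[OF x(2)] by (simp add: x(1) weight_of_point_of[OF x(2)] divide_right_mono mult.left_commute mult_left_mono)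
    then show "p \<in> {p \<in> topspace Lam_bar_topology. weight_of p \<in> {z. exp (- t) * z $ j \<le> z $ i}}"
      using x Lam_bar_eq_point_of topspace_Lam_bar by auto
  qed
  ultimately have "point_of y \<in> {p \<in> topspace Lam_bar_topology. weight_of p \<in> {z. exp (- t) * z $ j \<le> z $ i}}"
    using closure_of_minimal point_of by blast
  then show "exp (- t) * y $ j \<le> y $ i"
    using infnorm_weights(1)[OF y] by (simp add: weight_of_point_of[OF y] field_simps)
next
  assume le: "exp (- t) * y $ j \<le> y $ i"
  define A where "A = {z :: real^'n. (\<forall>k. 0 < z $ k) \<and> exp (- t) * z $ j \<le> z $ i}"
  \<comment> \<open>A positive vector with exp (- t) s_j = s_i: adding small multiples of it makes
    all weights positive and preserves the inequality.\<close>
  define s :: "real^'n" where "s = (\<chi> k. if k = j then exp t else 1)"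
  have s: "s $ k > 0" for k by (simp add: s_def)
  have "s \<noteq> 0" using s[of i] by auto
  have "y \<in> closure A"
    unfolding closure_approachable
  proof (intro allI impI)
    fix e :: real assume "e > 0"
    define c where "c = e / (2 * norm s)"
    have c: "c > 0" using \<open>e > 0\<close> \<open>s \<noteq> 0\<close> by (simp add: c_def)
    have "y + c *\<^sub>R s \<in> A"
    proof -
      have "exp (- t) * s $ j \<le> s $ i" using ij by (simp add: s_def flip: exp_add)
      then have "c * (exp (- t) * s $ j) \<le> c * s $ i" using c by (intro mult_left_mono) auto
      then have "exp (- t) * (y + c *\<^sub>R s) $ j \<le> (y + c *\<^sub>R s) $ i"
        using le by (simp add: distrib_left mult.left_commute)
      moreover have "0 < (y + c *\<^sub>R s) $ k" for k
        using weightsD[OF y, of k] s[of k] c by (simp add: add_nonneg_pos)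
      ultimately show ?thesis by (simp add: A_def)
    qed
    moreover have "dist (y + c *\<^sub>R s) y < e"
      using \<open>e > 0\<close> \<open>s \<noteq> 0\<close> by (simp add: dist_norm c_def)
    ultimately show "\<exists>z\<in>A. dist z y < e" by blast
  qed
  moreover have "A \<subseteq> weights"
  proof
    fix z assume "z \<in> A"
    then have pos: "0 < z $ k" for k by (simp add: A_def)
    have "z \<noteq> 0" using pos[of i] by auto
    then show "z \<in> weights" using pos by (simp add: weights_def less_imp_le)
  qed
  ultimately have "y \<in> Abstract_Topology.closure_of (top_of_set weights) A"
    using y by (auto simp: closure_of_subtopology Int_absorb1)
  then have "point_of y \<in> Abstract_Topology.closure_of Lam_bar_topology (point_of ` A)"
    using continuous_map_image_closure_subset[OF continuous_map_point_of] by blast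
  moreover have "point_of ` A \<subseteq> ?S"
  proof
    fix p assume "p \<in> point_of ` A"
    then obtain z where z: "z \<in> A" "p = point_of z" by blast
    define x :: "real^'n" where "x = (\<chi> i. ln (z $ i))"
    have pos: "0 < z $ k" for k using z by (simp add: A_def)
    then have "p = apt UNIV x" using z by (simp add: point_of_def x_def)
    moreover have "ln (exp (- t) * z $ j) \<le> ln (z $ i)"
      using z(1) pos[of i] pos[of j] by (subst ln_le_cancel_iff) (auto simp: A_def)
    then have "x $ i - x $ j \<ge> - t" using pos[of j] by (simp add: x_def ln_mult)
    ultimately show "p \<in> ?S" by blast
  qed
  ultimately show "point_of y \<in> Abstract_Topology.closure_of Lam_bar_topology ?S"
    using closure_of_mono by blast
qed

lemma perm_point_apt:
  assumes "bij w"
  shows "perm_point w (apt I x) = apt (w ` I) (\<chi> k. x $ inv_into UNIV w k)"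
proof -
  have inv: "inv_into UNIV w (w i) = i" "w (inv_into UNIV w i) = i" for i
    using assms by (simp_all add: bij_is_inj bij_is_surj surj_f_inv_f)
  have "(\<lambda>x. \<chi> k. x $ inv_into UNIV w k) ` {y. \<exists>c. \<forall>i\<in>I. y $ i = x $ i + c} =
    {y. \<exists>c. \<forall>i\<in>w ` I. y $ i = (\<chi> k. x $ inv_into UNIV w k) $ i + c}" (is "?l = ?r")
  proof (intro equalityI subsetI)
    fix y assume "y \<in> ?r"
    then obtain c where "\<forall>i\<in>w ` I. y $ i = (\<chi> k. x $ inv_into UNIV w k) $ i + c" by blast
    then show "y \<in> ?l"
      by (intro image_eqI[of _ _ "\<chi> k. y $ w k"] CollectI exI[of _ c]) (auto simp: inv vec_eq_iff)
  qed (auto simp: inv)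
  then show ?thesis by (simp add: perm_point_def apt_def)
qed

lemma translate_point_apt: "translate_point a (apt I x) = apt I (x + a)"
proof -
  have "(\<lambda>x. x + a) ` {y. \<exists>c. \<forall>i\<in>I. y $ i = x $ i + c} = {y. \<exists>c. \<forall>i\<in>I. y $ i = (x + a) $ i + c}" (is "?l = ?r")
  proof (intro equalityI subsetI)
    fix y assume "y \<in> ?r"
    then obtain c where "\<forall>i\<in>I. y $ i = (x + a) $ i + c" by blast
    then show "y \<in> ?l"
      by (intro image_eqI[of _ _ "y - a"] CollectI exI[of _ c]) auto
  qed auto
  then show ?thesis by (simp add: translate_point_def apt_def)
qed


section \<open>The projective linear group in terms of matrices\<close>

lemma invertible_iff_vmult:
  fixes M :: "'k::field^'n::finite^'n"
  shows "invertible M \<longleftrightarrow> (\<forall>f. f v* M = 0 \<longrightarrow> f = 0)"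
proof
  assume "invertible M"
  then obtain M' where M': "M ** M' = mat 1" unfolding invertible_def by blast
  show "\<forall>f. f v* M = 0 \<longrightarrow> f = 0"
  proof (intro allI impI)
    fix f assume f: "f v* M = 0"
    have "f = f v* (M ** M')" unfolding M' by (rule vmult_mat_1[symmetric])
    also have "\<dots> = 0 v* M'" unfolding vmult_assoc f ..
    also have "\<dots> = 0" by (simp add: vector_matrix_mult_def vec_eq_iff)
    finally show "f = 0" .
  qed
next
  assume "\<forall>f. f v* M = 0 \<longrightarrow> f = 0"
  then have "\<forall>x. Finite_Cartesian_Product.transpose M *v x = 0 \<longrightarrow> x = 0"
    unfolding transpose_matrix_vector .
  then have "\<exists>B. B ** Finite_Cartesian_Product.transpose M = mat 1" by (rule matrix_left_invertible_ker[THEN iffD2])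
  then obtain B where B: "B ** Finite_Cartesian_Product.transpose M = mat 1" ..
  have "Finite_Cartesian_Product.transpose (B ** Finite_Cartesian_Product.transpose M) = mat 1"
    unfolding B by (rule transpose_mat)
  then have "M ** Finite_Cartesian_Product.transpose B = mat 1"
    unfolding matrix_transpose_mul transpose_transpose .
  then show "invertible M" unfolding invertible_right_inverse by (rule exI)
qed

lemma vmult_mat: "f v* mat c = c *s (f :: 'k::field^'n::finite)"
  by (simp add: vec_eq_iff vector_matrix_mult_def mat_def mult_delta_right mult.commute)

lemma mat_mult: "(mat c ** M) $ i $ j = c * M $ i $ j" for M :: "'k::field^'n::finite^'n"
  by (simp add: matrix_matrix_mult_def mat_def mult_delta_left)

lemma invertible_mat: "c \<noteq> 0 \<Longrightarrow> invertible (mat c :: 'k::field^'n::finite^'n)"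
  unfolding invertible_def by (intro exI[of _ "mat (inverse c)"]) (simp add: vec_eq_iff mat_mult, simp add: mat_def)

lemma invertible_monomial_matrix:
  fixes t :: "'n::finite \<Rightarrow> 'k::field"
  assumes "bij w" "\<And>i. t i \<noteq> 0"
  shows "invertible (monomial_matrix w t)"
  unfolding invertible_iff_vmult
proof (intro allI impI)
  fix f assume "f v* monomial_matrix w t = 0"
  then have "t (w l) * f $ w l = 0" for l unfolding vmult_monomial_matrix[symmetric] by simp
  then have "f $ w l = 0" for l by (metis assms(2) mult_eq_0_iff)
  then have "f $ w (inv_into UNIV w k) = 0" for k .
  then have "f $ k = 0" for k using assms(1) by (simp add: bij_is_surj surj_f_inv_f)
  then show "f = 0" by (simp add: vec_eq_iff)
qed

lemma invertible_transvection:
  fixes c :: "'k::field"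
  assumes "i \<noteq> j"
  shows "invertible (transvection i j c)"
  unfolding invertible_iff_vmult
proof (intro allI impI)
  fix f assume f: "f v* transvection i j c = 0"
  have *: "f $ l + (if l = j then c * f $ i else 0) = 0" for l
    unfolding vmult_transvection[symmetric] f by simp
  have i: "f $ i = 0" using *[of i] assms by simp
  have "f $ l = 0" for l using *[of l] unfolding i by (simp split: if_splits)
  then show "f = 0" by (simp add: vec_eq_iff)
qed

context pgl_building
begin

sublocale F: padic_field val p
  using padic by unfold_locales (auto simp: finite_extension_of_padic_def)

definition coords :: "'v \<Rightarrow> 'k^'n" where
  "coords v = (\<chi> i. representation (range bas) v (bas i))"

definition vec_of :: "'k^'n \<Rightarrow> 'v" where
  "vec_of x = (\<Sum>i\<in>UNIV. scale (x $ i) (bas i))"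

definition matrix_of :: "('v \<Rightarrow> 'v) \<Rightarrow> 'k^'n^'n" where
  "matrix_of g = (\<chi> i j. entry g (i, j))"

definition linear_of :: "'k^'n^'n \<Rightarrow> 'v \<Rightarrow> 'v" where
  "linear_of M v = vec_of (M *v coords v)"

definition pgl_class :: "'k^'n^'n \<Rightarrow> ('v \<Rightarrow> 'v) set" where
  "pgl_class M = proj_class (linear_of M)"

lemma coords_add: "coords (v + w) = coords v + coords w"
  and coords_scale: "coords (scale c v) = c *s coords v"
  using representation_add[OF basis_independent] representation_scale[OF basis_independent]
  by (simp_all add: coords_def vec_eq_iff basis_span)

lemma coords_bas: "coords (bas i) = axis i 1"
  using basis_inj by (simp add: coords_def vec_eq_iff axis_def representation_basis[OF basis_independent] inj_eq eq_commute)

lemma vec_of_coords: "vec_of (coords v) = v"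
proof -
  have "(\<Sum>b\<in>range bas. scale (representation (range bas) v b) b) = v"
    by (rule sum_representation_eq[OF basis_independent]) (auto simp: basis_span)
  then show ?thesis using basis_inj by (simp add: vec_of_def coords_def sum.reindex)
qed

lemma coords_vec_of: "coords (vec_of x) = x"
proof -
  have "coords (\<Sum>i\<in>A. scale (x $ i) (bas i)) = (\<Sum>i\<in>A. x $ i *s axis i 1)" for A
    by (induction A rule: infinite_finite_induct)
      (simp_all add: coords_add coords_scale coords_bas, simp_all add: coords_def vec_eq_iff representation_zero)
  then show ?thesis by (simp add: vec_of_def basis_expansion)
qed

lemma coords_inj: "coords v = coords w \<longleftrightarrow> v = w" by (metis vec_of_coords)

lemma vec_of_add: "vec_of (x + y) = vec_of x + vec_of y"
  and vec_of_scale: "vec_of (c *s x) = scale c (vec_of x)"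
  using coords_inj by (simp_all add: coords_add coords_scale coords_vec_of flip: coords_inj)

lemma linear_iff':
  "Vector_Spaces.linear scale scale g \<longleftrightarrow> (\<forall>x y. g (x + y) = g x + g y) \<and> (\<forall>c x. g (scale c x) = scale c (g x))"
  by (simp add: Vector_Spaces.linear_iff vector_space_axioms)

lemma linear_linear_of: "Vector_Spaces.linear scale scale (linear_of M)"
  by (simp add: linear_iff' linear_of_def coords_add coords_scale matrix_vector_right_distrib vec_of_add
      vec_of_scale[symmetric] vector_scalar_commute)

lemma matrix_of_linear_of: "matrix_of (linear_of M) = M"
proof -
  have "coords (linear_of M (bas j)) $ i = M $ i $ j" for i j
    by (simp add: linear_of_def coords_vec_of coords_bas matrix_vector_mul_component axis_def inner_vec_def matrix_vector_mult_def
      mult_delta_right)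
  then show ?thesis by (simp add: matrix_of_def entry_def coords_def vec_eq_iff)
qed

lemma linear_of_matrix_of:
  assumes "Vector_Spaces.linear scale scale g"
  shows "linear_of (matrix_of g) = g"
proof
  fix v
  have g: "g (x + y) = g x + g y" "g (scale c x) = scale c (g x)" for x y c
    using assms unfolding linear_iff' by auto
  have g0: "g 0 = 0" using g(2)[of 0 0] by simp
  have "g (\<Sum>i\<in>A. scale (coords v $ i) (bas i)) = (\<Sum>i\<in>A. scale (coords v $ i) (g (bas i)))" for A
    by (induction A rule: infinite_finite_induct) (simp_all add: g g0)
  then have "g v = (\<Sum>i\<in>UNIV. scale (coords v $ i) (g (bas i)))" by (metis vec_of_coords vec_of_def)
  moreover have "coords (\<Sum>i\<in>A. scale (coords v $ i) (g (bas i))) = (\<Sum>i\<in>A. coords v $ i *s coords (g (bas i)))" for A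
    by (induction A rule: infinite_finite_induct)
      (simp_all add: coords_add coords_scale, simp_all add: coords_def vec_eq_iff representation_zero)
  ultimately have "coords (g v) = (\<Sum>i\<in>UNIV. coords v $ i *s coords (g (bas i)))" by simp
  also have "\<dots> = matrix_of g *v coords v"
    by (simp add: vec_eq_iff matrix_of_def entry_def matrix_vector_mult_def coords_def sum_component mult.commute)
  also have "\<dots> = coords (linear_of (matrix_of g) v)" by (simp add: linear_of_def coords_vec_of)
  finally show "linear_of (matrix_of g) v = g v" by (simp add: coords_inj)
qed

lemma linear_of_mult: "linear_of (A ** B) = linear_of A \<circ> linear_of B"
  by (simp add: fun_eq_iff linear_of_def coords_vec_of matrix_vector_mul_assoc)

lemma linear_of_mat: "linear_of (mat c) = scale c"
proof
  fix v
  have "mat c *v coords v = c *s coords v"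
    by (simp add: vec_eq_iff matrix_vector_mult_def mat_def mult_delta_left)
  then show "linear_of (mat c) v = scale c v" by (simp add: linear_of_def vec_of_scale vec_of_coords)
qed

lemma linear_of_one: "linear_of (mat 1) = id" by (simp add: linear_of_mat fun_eq_iff)

lemma linear_of_eq_iff: "linear_of A = linear_of B \<longleftrightarrow> A = B" by (metis matrix_of_linear_of)

lemma bij_linear_of_iff: "bij (linear_of M) \<longleftrightarrow> invertible M"
proof
  assume "invertible M"
  then obtain M' where "M ** M' = mat 1" "M' ** M = mat 1" by (auto simp: invertible_def)
  then have "linear_of M' \<circ> linear_of M = id" "linear_of M \<circ> linear_of M' = id" by (simp_all add: linear_of_one flip: linear_of_mult)
  then show "bij (linear_of M)" by (rule o_bij)
next
  assume bij: "bij (linear_of M)"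
  have "M *v x = 0 \<Longrightarrow> x = 0" for x
  proof -
    assume "M *v x = 0"
    then have "linear_of M (vec_of x) = linear_of M (vec_of 0)" by (simp add: linear_of_def coords_vec_of)
    then show "x = 0" using bij by (metis bij_is_inj coords_vec_of injD)
  qed
  then have "\<exists>B. B ** M = mat 1" unfolding matrix_left_invertible_ker by blast
  then show "invertible M" unfolding invertible_left_inverse .
qed

section \<open>The groups GL and PGL as invertible matrices and their classes modulo scalars\<close>

lemma carrier_GL: "carrier GL = linear_of ` {M. invertible M}"
proof (intro equalityI subsetI)
  fix g assume "g \<in> carrier GL"
  then have "linear_of (matrix_of g) = g" "bij g" by (auto simp: GL_def linear_of_matrix_of)
  then show "g \<in> linear_of ` {M. invertible M}" using bij_linear_of_iff by (metis image_eqI mem_Collect_eq)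
qed (auto simp: GL_def linear_linear_of bij_linear_of_iff)

lemma GL_mult: "linear_of A \<otimes>\<^bsub>GL\<^esub> linear_of B = linear_of (A ** B)" by (simp add: GL_def linear_of_mult)

lemma GL_one: "\<one>\<^bsub>GL\<^esub> = linear_of (mat 1)" by (simp add: GL_def linear_of_one)

lemma group_GL: "group GL"
proof (rule groupI)
  fix g assume "g \<in> carrier GL"
  then obtain M where M: "invertible M" "g = linear_of M" by (auto simp: carrier_GL)
  then obtain M' where M': "M ** M' = mat 1" "M' ** M = mat 1" by (auto simp: invertible_def)
  then have "invertible M'" by (auto simp: invertible_def)
  then show "\<exists>h\<in>carrier GL. h \<otimes>\<^bsub>GL\<^esub> g = \<one>\<^bsub>GL\<^esub>"
    using M M' by (intro bexI[of _ "linear_of M'"]) (auto simp: GL_mult GL_one carrier_GL)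
qed (auto simp: carrier_GL GL_mult GL_one invertible_mult matrix_mul_assoc invertible_mat)

lemma scalars_eq: "scalars = linear_of ` {mat c | c. c \<noteq> 0}"
  by (auto simp: scalars_def image_iff linear_of_mat) (metis linear_of_mat)

lemma mat_comm: "mat c ** A = A ** mat c" for A :: "'k^'n^'n"
  by (simp add: vec_eq_iff mat_mult) (simp add: matrix_matrix_mult_def mat_def mult_delta_right mult.commute)

lemma normal_scalars: "scalars \<lhd> GL"
proof -
  interpret GL: group GL by (rule group_GL)
  have inv: "invertible (mat c :: 'k^'n^'n)" if "c \<noteq> 0" for c using invertible_mat that .
  have mm: "mat c ** mat d = (mat (c * d) :: 'k^'n^'n)" for c d
    by (simp add: vec_eq_iff mat_mult) (simp add: mat_def)
  have inv': "inv\<^bsub>GL\<^esub> (linear_of (mat c)) = linear_of (mat (inverse c))" if "c \<noteq> 0" for c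
    by (rule GL.inv_equality) (use that inv in \<open>auto simp: GL_mult GL_one mm carrier_GL\<close>)
  have "subgroup scalars GL"
  proof (rule GL.subgroupI)
    show "scalars \<subseteq> carrier GL" using inv by (auto simp: scalars_eq carrier_GL)
    show "scalars \<noteq> {}" by (auto simp: scalars_eq intro!: exI[of _ 1])
    show "inv\<^bsub>GL\<^esub> a \<in> scalars" if "a \<in> scalars" for a
    proof -
      obtain c where c: "a = linear_of (mat c)" "c \<noteq> 0" using \<open>a \<in> scalars\<close> unfolding scalars_eq by blast
      have "inv\<^bsub>GL\<^esub> a = linear_of (mat (inverse c))" unfolding c(1) by (rule inv'[OF c(2)])
      moreover have "inverse c \<noteq> 0" using c(2) by simp
      ultimately show ?thesis unfolding scalars_eq by blast
    qed
    show "a \<otimes>\<^bsub>GL\<^esub> b \<in> scalars" if "a \<in> scalars" "b \<in> scalars" for a b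
      using that by (force simp: scalars_eq GL_mult mm)
  qed
  then show ?thesis
  proof (rule GL.normalI)
    have "linear_of A \<otimes>\<^bsub>GL\<^esub> s = s \<otimes>\<^bsub>GL\<^esub> linear_of A" if "s \<in> scalars" for A s
      using that by (auto simp: scalars_eq GL_mult mat_comm)
    then show "\<forall>x\<in>carrier GL. scalars #>\<^bsub>GL\<^esub> x = x <#\<^bsub>GL\<^esub> scalars"
      by (auto simp: carrier_GL r_coset_def l_coset_def)
  qed
qed

sublocale PGL: group PGL
  unfolding PGL_def by (rule normal.factorgroup_is_group[OF normal_scalars])

lemma carrier_PGL: "carrier PGL = pgl_class ` {M. invertible M}"
  by (auto simp: PGL_def FactGroup_def RCOSETS_def carrier_GL pgl_class_def proj_class_def)

lemma pgl_class_in_carrier: "invertible M \<Longrightarrow> pgl_class M \<in> carrier PGL" by (auto simp: carrier_PGL)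

lemma PGL_mult: "invertible A \<Longrightarrow> invertible B \<Longrightarrow> pgl_class A \<otimes>\<^bsub>PGL\<^esub> pgl_class B = pgl_class (A ** B)"
  using normal.rcos_sum[OF normal_scalars, of "linear_of A" "linear_of B"]
  by (simp add: PGL_def FactGroup_def pgl_class_def proj_class_def carrier_GL GL_mult)

lemma pgl_class_alt: "pgl_class M = {linear_of (mat c ** M) | c. c \<noteq> 0}"
  by (auto simp: pgl_class_def proj_class_def r_coset_def scalars_eq GL_mult)

lemma pgl_class_eq_iff: "pgl_class A = pgl_class B \<longleftrightarrow> (\<exists>c\<noteq>0. B = mat c ** A)"
proof
  assume "pgl_class A = pgl_class B"
  moreover have "linear_of B \<in> pgl_class B" unfolding pgl_class_alt by (intro CollectI exI[of _ 1]) simp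
  ultimately have "linear_of B \<in> pgl_class A" by simp
  then show "\<exists>c\<noteq>0. B = mat c ** A" unfolding pgl_class_alt mem_Collect_eq linear_of_eq_iff by blast
next
  have *: "pgl_class (mat c ** A) \<subseteq> pgl_class A" if "c \<noteq> 0" for c and A :: "'k^'n^'n"
  proof
    fix g assume "g \<in> pgl_class (mat c ** A)"
    then obtain d where d: "d \<noteq> 0" "g = linear_of (mat d ** (mat c ** A))" by (auto simp: pgl_class_alt)
    have "mat d ** (mat c ** A) = mat (d * c) ** A" by (simp add: vec_eq_iff mat_mult)
    then show "g \<in> pgl_class A" using d that by (auto simp: pgl_class_alt)
  qed
  assume "\<exists>c\<noteq>0. B = mat c ** A"
  then obtain c where c: "c \<noteq> 0" "B = mat c ** A" by blast
  then have "A = mat (inverse c) ** B" by (simp add: vec_eq_iff mat_mult)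
  then show "pgl_class A = pgl_class B" using * c by (metis equalityI inverse_nonzero_iff_nonzero)
qed

lemma pgl_class_mat_mult: "c \<noteq> 0 \<Longrightarrow> pgl_class (mat c ** A) = pgl_class A"
  using pgl_class_eq_iff by blast

lemma PGL_one: "\<one>\<^bsub>PGL\<^esub> = pgl_class (mat 1)"
proof -
  have "pgl_class (mat 1) \<otimes>\<^bsub>PGL\<^esub> pgl_class (mat 1) = pgl_class (mat 1)" by (simp add: PGL_mult invertible_mat)
  then show ?thesis by (metis PGL.r_cancel_one pgl_class_in_carrier invertible_mat zero_neq_one)
qed

lemma PGL_inv:
  assumes "A ** B = mat 1"
  shows "inv\<^bsub>PGL\<^esub> (pgl_class A) = pgl_class B"
proof (rule PGL.inv_equality)
  have BA: "B ** A = mat 1" using assms matrix_left_right_inverse by blast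
  then have inv: "invertible A" "invertible B" using assms by (auto simp: invertible_def)
  then show "pgl_class B \<otimes>\<^bsub>PGL\<^esub> pgl_class A = \<one>\<^bsub>PGL\<^esub>" "pgl_class A \<in> carrier PGL" "pgl_class B \<in> carrier PGL"
    using BA by (simp_all add: PGL_mult PGL_one pgl_class_in_carrier)
qed

section \<open>The torus, the monomial elements and the root groups as matrix classes\<close>

lemma coords_linear_of_bas: "coords (linear_of M (bas j)) = (\<chi> i. M $ i $ j)"
proof -
  have "matrix_of (linear_of M) $ i $ j = M $ i $ j" for i j by (simp add: matrix_of_linear_of)
  then show ?thesis by (simp add: matrix_of_def entry_def coords_def vec_eq_iff)
qed

lemma linear_of_monomial_iff:
  "(\<forall>i. linear_of M (bas i) = scale (t (w i)) (bas (w i))) \<longleftrightarrow> M = monomial_matrix w t"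
  by (auto simp: coords_linear_of_bas coords_scale coords_bas vec_eq_iff monomial_matrix_def axis_def simp flip: coords_inj)

lemma invertible_monomial_iff:
  "invertible (monomial_matrix id (t :: 'n \<Rightarrow> 'k)) \<longleftrightarrow> (\<forall>i. t i \<noteq> 0)"
proof
  assume inv: "invertible (monomial_matrix id t)"
  show "\<forall>i. t i \<noteq> 0"
  proof (intro allI notI)
    fix i assume "t i = 0"
    then have "axis i 1 v* monomial_matrix id t = 0" by (simp add: axis_vmult vec_eq_iff monomial_matrix_def)
    then have "axis i (1::'k) = 0" using inv unfolding invertible_iff_vmult by blast
    then show False by (simp add: axis_eq_0_iff)
  qed
qed (simp add: invertible_monomial_matrix)

lemma T_eq: "T = pgl_class ` {monomial_matrix id t | t. \<forall>i. t i \<noteq> 0}"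
proof (intro equalityI subsetI)
  fix A assume "A \<in> T"
  then obtain M t where M: "A = pgl_class M" "invertible M" "\<forall>i. linear_of M (bas i) = scale (t i) (bas i)"
    unfolding T_def carrier_GL pgl_class_def by blast
  then have "M = monomial_matrix id t" using linear_of_monomial_iff[of M t id] by simp
  with M show "A \<in> pgl_class ` {monomial_matrix id t | t. \<forall>i. t i \<noteq> 0}" using invertible_monomial_iff by blast
next
  fix A assume "A \<in> pgl_class ` {monomial_matrix id t | t. \<forall>i. t i \<noteq> 0}"
  then obtain t where t: "A = pgl_class (monomial_matrix id t)" "\<forall>i. t i \<noteq> 0" by blast
  then have "linear_of (monomial_matrix id t) \<in> carrier GL" unfolding carrier_GL using invertible_monomial_iff by blast
  moreover have "\<forall>i. linear_of (monomial_matrix id t) (bas i) = scale (t i) (bas i)"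
    using linear_of_monomial_iff[of "monomial_matrix id t" t id] by simp
  ultimately show "A \<in> T" unfolding T_def t(1) pgl_class_def by blast
qed

lemma monomial_rep_iff:
  "monomial_rep n t w \<longleftrightarrow> bij w \<and> (\<forall>i. t i \<noteq> 0) \<and> n = pgl_class (monomial_matrix w t)"
proof
  assume n: "monomial_rep n t w"
  then obtain M where "n = pgl_class M" "\<forall>i. linear_of M (bas i) = scale (t (w i)) (bas (w i))"
    unfolding monomial_rep_def carrier_GL pgl_class_def by blast
  then show "bij w \<and> (\<forall>i. t i \<noteq> 0) \<and> n = pgl_class (monomial_matrix w t)"
    using n unfolding linear_of_monomial_iff monomial_rep_def by simp
next
  assume n: "bij w \<and> (\<forall>i. t i \<noteq> 0) \<and> n = pgl_class (monomial_matrix w t)"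
  then have "linear_of (monomial_matrix w t) \<in> carrier GL"
    unfolding carrier_GL using invertible_monomial_matrix by blast
  moreover have "\<forall>i. linear_of (monomial_matrix w t) (bas i) = scale (t (w i)) (bas (w i))"
    by (simp add: linear_of_monomial_iff)
  ultimately show "monomial_rep n t w" using n unfolding monomial_rep_def pgl_class_def by blast
qed

lemma U_root_eq:
  assumes "i \<noteq> j"
  shows "U_root x i j = pgl_class ` {transvection i j \<omega> | \<omega>. val \<omega> \<ge> f_root x i j}"
proof -
  have *: "(linear_of M (bas j) = bas j + scale \<omega> (bas i) \<and> (\<forall>l. l \<noteq> j \<longrightarrow> linear_of M (bas l) = bas l)) \<longleftrightarrow>
      M = transvection i j \<omega>" for M \<omega>
  proof -
    have "M = transvection i j \<omega> \<longleftrightarrow> (\<forall>l. coords (linear_of M (bas l)) = axis l 1 + (if l = j then \<omega> *s axis i 1 else 0))"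
      using assms by (auto simp: coords_linear_of_bas vec_eq_iff transvection_def axis_def)
    then show ?thesis by (auto simp: coords_inj[symmetric] coords_scale coords_bas coords_add)
  qed
  show ?thesis
  proof (intro equalityI subsetI)
    fix A assume "A \<in> U_root x i j"
    then obtain M \<omega> where "A = pgl_class M" "val \<omega> \<ge> f_root x i j"
      "linear_of M (bas j) = bas j + scale \<omega> (bas i) \<and> (\<forall>l. l \<noteq> j \<longrightarrow> linear_of M (bas l) = bas l)"
      unfolding U_root_def carrier_GL pgl_class_def by blast
    then show "A \<in> pgl_class ` {transvection i j \<omega> | \<omega>. val \<omega> \<ge> f_root x i j}" unfolding * by blast
  next
    fix A assume "A \<in> pgl_class ` {transvection i j \<omega> | \<omega>. val \<omega> \<ge> f_root x i j}"
    then obtain \<omega> where w: "A = pgl_class (transvection i j \<omega>)" "val \<omega> \<ge> f_root x i j" by blast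
    have "linear_of (transvection i j \<omega>) \<in> carrier GL"
      unfolding carrier_GL using invertible_transvection[OF assms] by blast
    then show "A \<in> U_root x i j" using w *[of "transvection i j \<omega>" \<omega>] unfolding U_root_def pgl_class_def by blast
  qed
qed

end


section \<open>The action on weighted norms\<close>

context pgl_building
begin

text \<open>A takes the homothety class of the norm with weights y to the one with weights x.
  Allowing the factor c makes this a property of the class A; the order of the arguments matches
  \<open>nu\<close>, which will take the point of y to the point of x.\<close>

definition moves :: "('v \<Rightarrow> 'v) set \<Rightarrow> real^'n \<Rightarrow> real^'n \<Rightarrow> bool" where
  "moves A y x \<longleftrightarrow> (\<exists>M c. invertible M \<and> A = pgl_class M \<and> c > 0 \<and> (\<forall>f. F.weighted_norm y (f v* M) = c * F.weighted_norm x f))"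

definition isometries :: "real^'n \<Rightarrow> ('k^'n^'n) set" where
  "isometries y = {M. invertible M \<and> (\<forall>f. F.weighted_norm y (f v* M) = F.weighted_norm y f)}"

lemma movesI:
  "invertible M \<Longrightarrow> c > 0 \<Longrightarrow> (\<And>f. F.weighted_norm y (f v* M) = c * F.weighted_norm x f) \<Longrightarrow> moves (pgl_class M) y x"
  unfolding moves_def by blast

lemma moves_carrier: "moves A y x \<Longrightarrow> A \<in> carrier PGL"
  unfolding moves_def using pgl_class_in_carrier by blast

text \<open>Two representatives differ by a scalar d, which changes the factor only by a power of
  |d|.\<close>

lemma moves_pgl_class:
  assumes "moves (pgl_class M) y x"
  obtains c where "c > 0" "\<And>f. F.weighted_norm y (f v* M) = c * F.weighted_norm x f"
proof -
  obtain M' c where M': "pgl_class M = pgl_class M'" "c > 0" "\<And>f. F.weighted_norm y (f v* M') = c * F.weighted_norm x f"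
    using assms unfolding moves_def by blast
  then obtain d where d: "d \<noteq> 0" "M' = mat d ** M" using pgl_class_eq_iff by blast
  have "F.weighted_norm y (f v* M) = c * F.abs_val (inverse d) * F.weighted_norm x f" for f
  proof -
    have "(inverse d *s f) v* M' = f v* M"
      using d(1) by (simp add: d(2) vmult_assoc vmult_mat)
    then show ?thesis using M'(3)[of "inverse d *s f"] by (simp add: F.weighted_norm_scale)
  qed
  moreover have "c * F.abs_val (inverse d) > 0" using M'(2) d(1) by simp
  ultimately show thesis using that by blast
qed

lemma moves_mult:
  assumes "moves A y x" "moves B z y"
  shows "moves (A \<otimes>\<^bsub>PGL\<^esub> B) z x"
proof -
  obtain M c where M: "invertible M" "A = pgl_class M" "c > 0" "\<And>f. F.weighted_norm y (f v* M) = c * F.weighted_norm x f"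
    using assms(1) unfolding moves_def by blast
  obtain L d where L: "invertible L" "B = pgl_class L" "d > 0" "\<And>f. F.weighted_norm z (f v* L) = d * F.weighted_norm y f"
    using assms(2) unfolding moves_def by blast
  have "moves (pgl_class (M ** L)) z x"
    by (rule movesI[where c = "d * c"]) (simp_all add: invertible_mult M L vmult_assoc)
  then show ?thesis by (simp add: M L PGL_mult)
qed

lemma moves_inv:
  assumes "moves A y x"
  shows "moves (inv\<^bsub>PGL\<^esub> A) x y"
proof -
  obtain M c where M: "invertible M" "A = pgl_class M" "c > 0" "\<And>f. F.weighted_norm y (f v* M) = c * F.weighted_norm x f"
    using assms unfolding moves_def by blast
  obtain L where L: "M ** L = mat 1" "L ** M = mat 1" using M(1) unfolding invertible_def by blast
  have "F.weighted_norm x (f v* L) = inverse c * F.weighted_norm y f" for f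
  proof -
    have "(f v* L) v* M = f" by (simp only: vmult_assoc[symmetric] L vmult_mat_1)
    then show ?thesis using M(3) M(4)[of "f v* L"] by simp
  qed
  moreover have "invertible L" using L unfolding invertible_def by blast
  ultimately have "moves (pgl_class L) x y" using M(3) by (intro movesI[where c = "inverse c"]) simp_all
  then show ?thesis by (simp add: M PGL_inv[OF L(1)])
qed

lemma weighted_norm_proportional:
  assumes "x \<in> weights" "x' \<in> weights" "c > 0" "\<And>f. F.weighted_norm x f = c * F.weighted_norm x' f"
  shows "point_of x = point_of x'"
proof -
  have "x $ i = c * x' $ i" for i
    using assms(4)[of "axis i 1"] assms(1,2) by (simp add: F.weighted_norm_axis weightsD)
  then have "x = c *\<^sub>R x'" by (simp add: vec_eq_iff)
  then have "point_of x' = point_of x" unfolding point_of_eq_iff[OF assms(2,1)] using assms(3) by blast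
  then show ?thesis ..
qed

lemma moves_unique:
  assumes "moves A y x" "moves A y x'" "x \<in> weights" "x' \<in> weights"
  shows "point_of x = point_of x'"
proof -
  obtain M where M: "A = pgl_class M" using assms(1) unfolding moves_def by blast
  obtain c where c: "c > 0" "\<And>f. F.weighted_norm y (f v* M) = c * F.weighted_norm x f" using assms(1) M moves_pgl_class by blast
  obtain d where d: "d > 0" "\<And>f. F.weighted_norm y (f v* M) = d * F.weighted_norm x' f" using assms(2) M moves_pgl_class by blast
  have "F.weighted_norm x f = d / c * F.weighted_norm x' f" for f using c d(2)[of f] by (simp add: field_simps)
  then show ?thesis using weighted_norm_proportional[of x x' "d / c"] assms c(1) d(1) by simp
qed

lemma isometries_moves: "M \<in> isometries y \<Longrightarrow> moves (pgl_class M) y y"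
  unfolding isometries_def by (intro movesI[where c = 1]) auto

lemma isometries_mult: "A \<in> isometries y \<Longrightarrow> B \<in> isometries y \<Longrightarrow> A ** B \<in> isometries y"
  unfolding isometries_def by (simp add: invertible_mult vmult_assoc)

lemma isometries_inverse:
  assumes "A \<in> isometries y"
  obtains B where "B \<in> isometries y" "A ** B = mat 1" "B ** A = mat 1"
proof -
  obtain B where B: "A ** B = mat 1" "B ** A = mat 1"
    using assms unfolding isometries_def invertible_def by blast
  have "F.weighted_norm y (f v* B) = F.weighted_norm y f" for f
  proof -
    have "(f v* B) v* A = f" by (simp only: vmult_assoc[symmetric] B vmult_mat_1)
    then show ?thesis using assms unfolding isometries_def by (metis (mono_tags, lifting) mem_Collect_eq)
  qed
  moreover have "invertible B" using B unfolding invertible_def by blast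
  ultimately have "B \<in> isometries y" unfolding isometries_def by blast
  then show thesis using that B by blast
qed

lemma isometries_one: "mat 1 \<in> isometries y"
  unfolding isometries_def by (simp add: vmult_mat_1 invertible_mat)

text \<open>By \<open>point_of_in_closure_iff\<close> the infimum runs over the t with exp (- t) y_j
  <= y_i. It is -ln (y_i / y_j) for positive weights, minus infinity if y_j = 0, and infinity if y_j
  > 0 = y_i.\<close>

lemma f_root_le_iff:
  assumes y: "y \<in> weights" and ij: "i \<noteq> j"
  shows "f_root (point_of y) i j \<le> val \<omega> \<longleftrightarrow> F.abs_val \<omega> * y $ j \<le> y $ i"
proof -
  have f: "f_root (point_of y) i j = Inf {ereal t | t. exp (- t) * y $ j \<le> y $ i}"
    unfolding f_root_def point_of_in_closure_iff[OF y ij] ..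
  have yi: "0 \<le> y $ i" and yj: "0 \<le> y $ j" using weightsD[OF y] by auto
  consider "y $ j = 0" | "0 < y $ j" "y $ i = 0" | "0 < y $ j" "0 < y $ i" using yi yj by fastforce
  then show ?thesis
  proof cases
    case 1
    have "f_root (point_of y) i j = - \<infinity>"
      unfolding f
    proof (rule ereal_bot)
      fix B :: real
      show "Inf {ereal t | t. exp (- t) * y $ j \<le> y $ i} \<le> ereal B"
        using 1 yi by (intro Inf_lower) auto
    qed
    then show ?thesis using 1 yi by simp
  next
    case 2
    have "{ereal t | t. exp (- t) * y $ j \<le> y $ i} = {}" using 2 by (simp add: mult_le_0_iff not_le)
    then have "f_root (point_of y) i j = \<infinity>" unfolding f by (simp add: top_ereal_def)
    moreover have "F.abs_val \<omega> \<le> 0 \<longleftrightarrow> \<omega> = 0" using F.av_nonneg[of \<omega>] F.av_eq_0[of \<omega>] by linarith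
    ultimately show ?thesis using 2 by (simp add: mult_le_0_iff not_le)
  next
    case 3
    define c where "c = - ln (y $ i / y $ j)"
    have "exp (- t) * y $ j \<le> y $ i \<longleftrightarrow> c \<le> t" for t
    proof -
      have "exp (- t) * y $ j \<le> y $ i \<longleftrightarrow> exp (- t) \<le> y $ i / y $ j" using 3 by (simp add: field_simps)
      also have "\<dots> \<longleftrightarrow> exp (- t) \<le> exp (- c)" using 3 by (simp add: c_def)
      finally show ?thesis by simp
    qed
    then have "f_root (point_of y) i j = Inf {ereal t | t. c \<le> t}" unfolding f by simp
    also have "\<dots> = ereal c" by (intro antisym Inf_lower Inf_greatest) auto
    finally have "f_root (point_of y) i j = ereal c" .
    then have "f_root (point_of y) i j \<le> val \<omega> \<longleftrightarrow> F.abs_val \<omega> \<le> exp (- c)" by (simp only: F.av_le_exp)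
    also have "\<dots> \<longleftrightarrow> F.abs_val \<omega> * y $ j \<le> y $ i" using 3 by (simp add: c_def field_simps)
    finally show ?thesis .
  qed
qed

text \<open>By \<open>f_root_le_iff\<close> the generators are classes of transvections that
  preserve the norm, and isometries are closed under products and inverses.\<close>

lemma U_grp_isometries:
  assumes "y \<in> weights" "A \<in> U_grp (point_of y)"
  shows "A \<in> pgl_class ` isometries y"
proof -
  have root: "A \<in> pgl_class ` isometries y" if "A \<in> (\<Union>(i, j)\<in>{(i, j). i \<noteq> j}. U_root (point_of y) i j)" for A
  proof -
    obtain i j where ij: "i \<noteq> j" "A \<in> U_root (point_of y) i j" using \<open>A \<in> _\<close> by blast
    then obtain \<omega> where w: "A = pgl_class (transvection i j \<omega>)" "f_root (point_of y) i j \<le> val \<omega>"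
      unfolding U_root_eq[OF ij(1)] by blast
    then have "F.abs_val \<omega> * y $ j \<le> y $ i" using f_root_le_iff[OF assms(1) ij(1)] by blast
    then have "transvection i j \<omega> \<in> isometries y"
      unfolding isometries_def using invertible_transvection[OF ij(1)] F.weighted_norm_transvection[OF weightsD[OF assms(1)] ij(1)] by blast
    then show ?thesis unfolding w(1) by (rule imageI)
  qed
  from assms(2) show ?thesis
    unfolding U_grp_def
  proof induction
    case one
    then show ?case unfolding PGL_one by (intro imageI isometries_one)
  next
    case (incl h)
    then show ?case by (rule root)
  next
    case (inv h)
    then obtain M where "h = pgl_class M" "M \<in> isometries y" using root by blast
    then show ?case using isometries_inverse[of M y] PGL_inv by (metis imageI)
  next
    case (eng h1 h2)
    then obtain M1 M2 where M: "h1 = pgl_class M1" "M1 \<in> isometries y" "h2 = pgl_class M2" "M2 \<in> isometries y" by blast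
    then have "h1 \<otimes>\<^bsub>PGL\<^esub> h2 = pgl_class (M1 ** M2)" by (simp add: PGL_mult isometries_def)
    then show ?case using isometries_mult[OF M(2,4)] by blast
  qed
qed

lemma elementary_isometries:
  assumes "y \<in> weights" "M \<in> F.elementary y"
  shows "M \<in> isometries y"
proof -
  obtain M' where "M ** M' = mat 1" "M' ** M = mat 1" using F.elementary_inverse[OF assms(2)] by blast
  then have "invertible M" unfolding invertible_def by blast
  then show ?thesis unfolding isometries_def using F.weighted_norm_elementary[OF assms(2) weightsD[OF assms(1)]] by blast
qed

lemma elementary_U_grp:
  assumes y: "y \<in> weights" and "M \<in> F.elementary y"
  shows "pgl_class M \<in> U_grp (point_of y)"
  using assms(2)
proof induction
  case one
  then show ?case unfolding U_grp_def PGL_one[symmetric] by (rule generate.one)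
next
  case (step M i j c)
  have inv: "invertible M" using elementary_isometries[OF y step.hyps(1)] by (simp add: isometries_def)
  have "pgl_class (transvection i j c) \<in> U_root (point_of y) i j"
    unfolding U_root_eq[OF step.hyps(2)] using f_root_le_iff[OF y step.hyps(2)] step.hyps(3) by blast
  then have "pgl_class (transvection i j c) \<in> U_grp (point_of y)"
    unfolding U_grp_def using step.hyps(2) by (intro generate.incl) blast
  then have "pgl_class M \<otimes>\<^bsub>PGL\<^esub> pgl_class (transvection i j c) \<in> U_grp (point_of y)"
    using step.IH unfolding U_grp_def by (intro generate.eng)
  then show ?case by (simp add: PGL_mult inv invertible_transvection[OF step.hyps(2)])
qed

text \<open>y' is the action of \<open>nu\<close> in exponential coordinates: the permutation moves
  the weights, and translation by -val (t k) multiplies the weight at k by |t k|.\<close>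

lemma monomial_moves:
  assumes "bij w" "\<And>i. t i \<noteq> 0" and y: "y \<in> weights"
  defines "y' \<equiv> \<chi> k. F.abs_val (t k) * y $ inv_into UNIV w k"
  shows "y' \<in> weights" "moves (pgl_class (monomial_matrix w t)) y y'"
    "translate_point (\<chi> i. - real_of_ereal (val (t i))) (perm_point w (point_of y)) = point_of y'"
proof -
  have inv: "inv_into UNIV w (w i) = i" "w (inv_into UNIV w i) = i" for i
    using assms(1) by (simp_all add: bij_is_inj bij_is_surj surj_f_inv_f)
  obtain i where i: "0 < y $ i" using weights_pos[OF y] by blast
  have "y' $ w i \<noteq> 0" using i assms(2) by (simp add: y'_def inv)
  then have "y' \<noteq> 0" by auto
  then show "y' \<in> weights" using weightsD[OF y] by (simp add: weights_def y'_def)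
  have "F.weighted_norm y (f v* monomial_matrix w t) = F.weighted_norm y' f" for f
  proof (rule antisym)
    show "F.weighted_norm y (f v* monomial_matrix w t) \<le> F.weighted_norm y' f"
      unfolding F.weighted_norm_le_iff
    proof
      fix l
      show "y $ l * F.abs_val ((f v* monomial_matrix w t) $ l) \<le> F.weighted_norm y' f"
        using F.weighted_norm_ge[of y' "w l" f] by (simp add: vmult_monomial_matrix y'_def inv F.av_mult ac_simps)
    qed
    show "F.weighted_norm y' f \<le> F.weighted_norm y (f v* monomial_matrix w t)"
      unfolding F.weighted_norm_le_iff
    proof
      fix k
      show "y' $ k * F.abs_val (f $ k) \<le> F.weighted_norm y (f v* monomial_matrix w t)"
        using F.weighted_norm_ge[of y "inv_into UNIV w k" "f v* monomial_matrix w t"]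
        by (simp add: vmult_monomial_matrix y'_def inv F.av_mult ac_simps)
    qed
  qed
  then show "moves (pgl_class (monomial_matrix w t)) y y'"
    using invertible_monomial_matrix[OF assms(1,2)] by (intro movesI[where c = 1]) simp_all
  have "w ` {i. 0 < y $ i} = {i. 0 < y' $ i}"
  proof (intro equalityI subsetI)
    fix k assume "k \<in> {i. 0 < y' $ i}"
    then have "0 < y $ inv_into UNIV w k" using F.av_nonneg[of "t k"] by (simp add: y'_def zero_less_mult_iff)
    then show "k \<in> w ` {i. 0 < y $ i}" by (intro image_eqI[of _ _ "inv_into UNIV w k"]) (simp_all add: inv)
  qed (use assms(2) in \<open>auto simp: y'_def inv zero_less_mult_iff\<close>)
  moreover have "ln (y' $ k) = ln (y $ inv_into UNIV w k) + - real_of_ereal (val (t k))" if "0 < y' $ k" for k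
  proof -
    have "F.abs_val (t k) = exp (- real_of_ereal (val (t k)))" using assms(2) by (simp add: av_def)
    moreover have "0 < y $ inv_into UNIV w k"
      using that F.av_nonneg[of "t k"] by (simp add: y'_def zero_less_mult_iff)
    ultimately show ?thesis by (simp add: y'_def ln_mult)
  qed
  ultimately show "translate_point (\<chi> i. - real_of_ereal (val (t i))) (perm_point w (point_of y)) = point_of y'"
    unfolding point_of_def perm_point_apt[OF assms(1)] translate_point_apt apt_eq_iff
    by (intro conjI exI[of _ 0]) simp_all
qed

text \<open>The pair chosen by \<open>SOME\<close> inside \<open>nu\<close> may differ from t and w,
  but it represents the same class n, and \<open>moves\<close> depends only on the class.\<close>

lemma nu_moves:
  assumes "monomial_rep n t w" and y: "y \<in> weights"
  obtains y' where "y' \<in> weights" "nu n (point_of y) = point_of y'" "moves n y y'"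
proof -
  obtain t' w' where tw: "(SOME (t, w). monomial_rep n t w) = (t', w')" by (cases "SOME (t, w). monomial_rep n t w")
  have "monomial_rep n t' w'"
    using someI[of "\<lambda>(t, w). monomial_rep n t w" "(t, w)"] assms(1) tw by simp
  then have r: "bij w'" "\<And>i. t' i \<noteq> 0" "n = pgl_class (monomial_matrix w' t')" unfolding monomial_rep_iff by auto
  show thesis
    using that monomial_moves[where w = w' and t = t', OF r(1) r(2) y]
    unfolding r(3)[symmetric] nu_def tw by simp
qed

text \<open>A norm identity for n determines its action on the point, by
  \<open>moves_unique\<close>; no particular representation has to be computed.\<close>

lemma nu_eqI:
  assumes "monomial_rep n t w" "moves n y z" "y \<in> weights" "z \<in> weights"
  shows "nu n (point_of y) = point_of z"
  using nu_moves[OF assms(1,3)] moves_unique[OF _ assms(2) _ assms(4)] by metis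

lemma TE:
  assumes "A \<in> T"
  obtains t where "\<forall>i. t i \<noteq> 0" "A = pgl_class (monomial_matrix id t)"
  using assms unfolding T_eq by blast

lemma TI: "(\<And>i. t i \<noteq> 0) \<Longrightarrow> pgl_class (monomial_matrix id t) \<in> T"
  unfolding T_eq by blast

text \<open>A normalizing element conjugates one diagonal class with distinct entries d to a
  diagonal class with entries e. Comparing entries gives e_i m_ij = c m_ij d_j, where c comes from
  working modulo scalars. So each row of M has at most one nonzero entry, and M, being invertible,
  is monomial. Conversely, conjugation by a monomial matrix permutes diagonal entries.\<close>

lemma N_eq: "N = {n. \<exists>t w. monomial_rep n t w}"
proof -
  have TG: "T \<subseteq> carrier PGL"
    unfolding T_eq carrier_PGL using invertible_monomial_iff by blast
  have N: "n \<in> N \<longleftrightarrow> n \<in> carrier PGL \<and> n <#\<^bsub>PGL\<^esub> T #>\<^bsub>PGL\<^esub> inv\<^bsub>PGL\<^esub> n = T" for n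
    using TG by (simp add: N_def normalizer_def stabilizer_def)
  have "\<exists>t w. monomial_rep n t w" if "n \<in> N" for n
  proof -
    have n: "n \<in> carrier PGL" "n <#\<^bsub>PGL\<^esub> T #>\<^bsub>PGL\<^esub> inv\<^bsub>PGL\<^esub> n = T" using that N by auto
    then obtain M where M: "invertible M" "n = pgl_class M" unfolding carrier_PGL by blast
    \<comment> \<open>Distinct nonzero diagonal entries exist because K has characteristic
      0.\<close>
    obtain r :: "'n \<Rightarrow> nat" where r: "inj r" using finite_imp_inj_to_nat_seg[of "UNIV :: 'n set"] by auto
    define d :: "'n \<Rightarrow> 'k" where "d i = of_nat (Suc (r i))" for i
    have d: "inj d" "\<And>i. d i \<noteq> 0"
      using r by (auto simp: inj_def d_def simp del: of_nat_Suc)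
    define D where "D = pgl_class (monomial_matrix id d)"
    have D: "D \<in> T" unfolding D_def by (rule TI[OF d(2)])
    then have "n \<otimes>\<^bsub>PGL\<^esub> D \<otimes>\<^bsub>PGL\<^esub> inv\<^bsub>PGL\<^esub> n \<in> n <#\<^bsub>PGL\<^esub> T #>\<^bsub>PGL\<^esub> inv\<^bsub>PGL\<^esub> n"
      unfolding l_coset_def r_coset_def by blast
    then have "n \<otimes>\<^bsub>PGL\<^esub> D \<otimes>\<^bsub>PGL\<^esub> inv\<^bsub>PGL\<^esub> n \<in> T" unfolding n(2) .
    then obtain e where e: "\<forall>i. e i \<noteq> 0" "n \<otimes>\<^bsub>PGL\<^esub> D \<otimes>\<^bsub>PGL\<^esub> inv\<^bsub>PGL\<^esub> n = pgl_class (monomial_matrix id e)"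
      by (rule TE)
    have inv: "invertible (monomial_matrix id d)" "invertible (monomial_matrix id e)"
      using d(2) e(1) unfolding invertible_monomial_iff by auto
    have "n \<otimes>\<^bsub>PGL\<^esub> D = pgl_class (monomial_matrix id e) \<otimes>\<^bsub>PGL\<^esub> n"
    proof -
      have DG: "D \<in> carrier PGL" using D TG by blast
      show ?thesis
        using e(2) PGL.inv_solve_right'[OF pgl_class_in_carrier[OF inv(2)] PGL.m_closed[OF n(1) DG] n(1)] by blast
    qed
    then have "pgl_class (M ** monomial_matrix id d) = pgl_class (monomial_matrix id e ** M)"
      by (simp add: M D_def PGL_mult inv)
    then obtain c where c: "c \<noteq> 0" "monomial_matrix id e ** M = mat c ** (M ** monomial_matrix id d)"
      using pgl_class_eq_iff by blast
    have ent: "e i * M $ i $ j = c * (M $ i $ j * d j)" for i j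
    proof -
      have "(monomial_matrix id e ** M) $ i $ j = e i * M $ i $ j"
        by (simp add: monomial_matrix_def matrix_matrix_mult_def mult_delta_left)
      moreover have "(M ** monomial_matrix id d) $ i $ j = M $ i $ j * d j"
        by (simp add: monomial_matrix_def matrix_matrix_mult_def mult_delta_right)
      ultimately show ?thesis using c(2) by (metis mat_mult)
    qed
    have uniq: "j = j'" if "M $ i $ j \<noteq> 0" "M $ i $ j' \<noteq> 0" for i j j'
    proof -
      have "e i = c * d j" "e i = c * d j'" using ent[of i j] ent[of i j'] that by auto
      then have "d j = d j'" using c(1) by simp
      then show ?thesis using d(1) by (simp add: inj_eq)
    qed
    have "\<exists>i. M $ i $ j \<noteq> 0" for j
    proof (rule ccontr)
      assume "\<not> ?thesis"
      then have "(L ** M) $ j $ j = 0" for L :: "'k^'n^'n" by (simp add: matrix_matrix_mult_def)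
      moreover obtain L where "L ** M = mat 1" using M(1) unfolding invertible_def by blast
      ultimately have "(mat 1 :: 'k^'n^'n) $ j $ j = 0" by metis
      then show False by (simp add: mat_def)
    qed
    then obtain w where w: "\<And>j. M $ w j $ j \<noteq> 0" by metis
    have "inj w" using uniq w by (metis injI)
    then have bij: "bij w" by (simp add: finite_UNIV_inj_surj bij_def)
    define t where "t k = M $ k $ inv_into UNIV w k" for k
    have "M = monomial_matrix w t"
    proof -
      have "M $ k $ l = (if k = w l then t k else 0)" for k l
      proof (cases "k = w l")
        case True
        then show ?thesis using \<open>inj w\<close> by (simp add: t_def)
      next
        case False
        obtain l' where "k = w l'" using bij by (metis bij_is_surj surjD)
        then show ?thesis using False uniq[of k l l'] w[of l'] by auto
      qed
      then show ?thesis by (simp add: monomial_matrix_def vec_eq_iff)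
    qed
    moreover have "t k \<noteq> 0" for k
      using w[of "inv_into UNIV w k"] bij by (simp add: t_def bij_is_surj surj_f_inv_f)
    ultimately show ?thesis using bij M(2) unfolding monomial_rep_iff by blast
  qed
  moreover have "n \<in> N" if "monomial_rep n t w" for n t w
  proof -
    have n: "bij w" "\<forall>i. t i \<noteq> 0" "n = pgl_class (monomial_matrix w t)" using that unfolding monomial_rep_iff by auto
    have inv: "invertible (monomial_matrix w t)" using n invertible_monomial_matrix by blast
    have nG: "n \<in> carrier PGL" unfolding n(3) by (rule pgl_class_in_carrier[OF inv])
    have conj: "n \<otimes>\<^bsub>PGL\<^esub> pgl_class (monomial_matrix id s) = pgl_class (monomial_matrix id (\<lambda>k. s (inv_into UNIV w k))) \<otimes>\<^bsub>PGL\<^esub> n"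
      if s: "\<forall>i. s i \<noteq> 0" for s
    proof -
      have "monomial_matrix w t ** monomial_matrix id s =
          monomial_matrix id (\<lambda>k. s (inv_into UNIV w k)) ** monomial_matrix w t"
        by (simp add: monomial_matrix_mult n(1) mult.commute)
      moreover have "invertible (monomial_matrix id s)" "invertible (monomial_matrix id (\<lambda>k. s (inv_into UNIV w k)))"
        unfolding invertible_monomial_iff using s by auto
      ultimately show ?thesis unfolding n(3) by (simp add: PGL_mult inv)
    qed
    have swap: "n \<otimes>\<^bsub>PGL\<^esub> B \<otimes>\<^bsub>PGL\<^esub> inv\<^bsub>PGL\<^esub> n = A"
      if "A \<in> carrier PGL" "B \<in> carrier PGL" "n \<otimes>\<^bsub>PGL\<^esub> B = A \<otimes>\<^bsub>PGL\<^esub> n" for A B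
      unfolding that(3) using that(1) nG by (simp add: PGL.m_assoc)
    have "n <#\<^bsub>PGL\<^esub> T #>\<^bsub>PGL\<^esub> inv\<^bsub>PGL\<^esub> n = T"
    proof (intro equalityI subsetI)
      fix A assume "A \<in> n <#\<^bsub>PGL\<^esub> T #>\<^bsub>PGL\<^esub> inv\<^bsub>PGL\<^esub> n"
      then obtain B where B: "B \<in> T" "A = n \<otimes>\<^bsub>PGL\<^esub> B \<otimes>\<^bsub>PGL\<^esub> inv\<^bsub>PGL\<^esub> n"
        unfolding l_coset_def r_coset_def by blast
      then obtain s where s: "B = pgl_class (monomial_matrix id s)" "\<forall>i. s i \<noteq> 0" using TE by blast
      let ?A = "pgl_class (monomial_matrix id (\<lambda>k. s (inv_into UNIV w k)))"
      have A: "?A \<in> T" using s(2) by (intro TI) simp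
      then have "A = ?A" using swap[of ?A B] conj[OF s(2)] B TG unfolding s(1) by blast
      then show "A \<in> T" using A by simp
    next
      fix A assume A: "A \<in> T"
      then obtain s where s: "A = pgl_class (monomial_matrix id s)" "\<forall>i. s i \<noteq> 0" using TE by blast
      let ?B = "pgl_class (monomial_matrix id (\<lambda>k. s (w k)))"
      have B: "?B \<in> T" using s(2) by (intro TI) simp
      have "n \<otimes>\<^bsub>PGL\<^esub> ?B = A \<otimes>\<^bsub>PGL\<^esub> n"
        using conj[of "\<lambda>k. s (w k)"] s n(1) by (simp add: bij_is_surj surj_f_inv_f)
      then have "n \<otimes>\<^bsub>PGL\<^esub> ?B \<otimes>\<^bsub>PGL\<^esub> inv\<^bsub>PGL\<^esub> n = A" using swap A B TG by blast
      then show "A \<in> n <#\<^bsub>PGL\<^esub> T #>\<^bsub>PGL\<^esub> inv\<^bsub>PGL\<^esub> n"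
        using B unfolding l_coset_def r_coset_def by blast
    qed
    then show ?thesis using N nG by blast
  qed
  ultimately show ?thesis by blast
qed

section \<open>The groups P_x and U_0 Z in terms of isometries\<close>

lemma one_in_weights: "(1 :: real^'n) \<in> weights"
  by (simp add: weights_def vec_eq_iff)

lemma apt_origin: "apt UNIV 0 = point_of (1 :: real^'n)"
proof -
  have "(\<chi> i. exp ((0::real^'n) $ i)) = 1" by (simp add: vec_eq_iff)
  then show ?thesis using apt_UNIV_eq_point_of(1)[of "0 :: real^'n"] by simp
qed

lemma one_in_N_stab:
  assumes "y \<in> weights"
  shows "\<one>\<^bsub>PGL\<^esub> \<in> N_stab (point_of y)"
proof -
  have "(mat 1 :: 'k^'n^'n) = monomial_matrix id (\<lambda>_. 1)"
    by (simp add: mat_def monomial_matrix_def vec_eq_iff)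
  then have r: "monomial_rep \<one>\<^bsub>PGL\<^esub> (\<lambda>_. 1) id" unfolding monomial_rep_iff PGL_one by simp
  have "nu \<one>\<^bsub>PGL\<^esub> (point_of y) = point_of y"
    by (rule nu_eqI[OF r _ assms assms]) (simp add: PGL_one isometries_moves isometries_one)
  then show ?thesis using r unfolding N_stab_def N_eq by blast
qed

text \<open>U_x acts by isometries of y. An element of N_x takes y to weights of the same point,
  that is, to a multiple of y, and the multiple goes into the factor of
  \<open>moves\<close>.\<close>

lemma P_grp_moves:
  assumes y: "y \<in> weights" and "A \<in> P_grp (point_of y)"
  shows "moves A y y"
proof -
  obtain u n where un: "u \<in> U_grp (point_of y)" "n \<in> N_stab (point_of y)" "A = u \<otimes>\<^bsub>PGL\<^esub> n"
    using assms(2) unfolding P_grp_def set_mult_def by blast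
  obtain t w where r: "monomial_rep n t w" "nu n (point_of y) = point_of y" using un(2) unfolding N_stab_def N_eq by blast
  obtain y' where y': "y' \<in> weights" "nu n (point_of y) = point_of y'" "moves n y y'" using nu_moves[OF r(1) y] .
  have "point_of y = point_of y'" using y'(2) r(2) by simp
  then obtain c where c: "c > 0" "y' = c *\<^sub>R y" using point_of_eq_iff[OF y y'(1)] by blast
  have "moves n y y"
  proof -
    obtain M d where M: "invertible M" "n = pgl_class M" "d > 0" "\<And>f. F.weighted_norm y (f v* M) = d * F.weighted_norm y' f"
      using y'(3) unfolding moves_def by blast
    have "F.weighted_norm y (f v* M) = (d * c) * F.weighted_norm y f" for f
      using M(4)[of f] c by (simp add: F.weighted_norm_scale_weight)
    then show ?thesis using M c(1) by (auto intro: movesI[where c = "d * c"])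
  qed
  moreover have "moves u y y" using U_grp_isometries[OF y un(1)] isometries_moves by blast
  ultimately show ?thesis unfolding un(3) using moves_mult by blast
qed

lemma diagonal_isometry:
  assumes "\<And>i. F.abs_val (t i) = 1" "y \<in> weights"
  shows "monomial_matrix id t \<in> isometries y"
proof -
  have "t i \<noteq> 0" for i using assms(1)[of i] by auto
  moreover have "F.weighted_norm y (f v* monomial_matrix id t) = F.weighted_norm y f" for f
    by (simp add: F.weighted_norm_def vmult_monomial_matrix F.av_mult assms(1))
  ultimately show ?thesis unfolding isometries_def by (simp add: invertible_monomial_iff)
qed

text \<open>The isometries of the max norm form GL_n of the valuation ring. An element of Z fixes
  the origin, so its diagonal entries have equal absolute values and become units after division by
  one of them. The converse inclusion is \<open>elimination_diagonal\<close>.\<close>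

lemma U0_hat_eq: "U0_hat = pgl_class ` isometries 1"
proof (intro equalityI subsetI)
  fix A assume "A \<in> U0_hat"
  then obtain u z where uz: "u \<in> U_grp (point_of 1)" "z \<in> Z" "A = u \<otimes>\<^bsub>PGL\<^esub> z"
    unfolding U0_hat_def set_mult_def apt_origin by blast
  have "z \<in> pgl_class ` isometries 1"
  proof -
    obtain t where t: "\<forall>i. t i \<noteq> 0" "z = pgl_class (monomial_matrix id t)" using uz(2) unfolding Z_def T_eq by blast
    have r: "monomial_rep z t id" using t unfolding monomial_rep_iff by simp
    have "point_of (1 :: real^'n) \<in> Lam UNIV" unfolding apt_origin[symmetric] Lam_def by blast
    then have nu: "nu z (point_of 1) = point_of 1" using uz(2) unfolding Z_def by blast
    let ?y' = "\<chi> k. F.abs_val (t k) * (1 :: real^'n) $ inv_into UNIV id k"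
    have y': "?y' \<in> weights" "moves z 1 ?y'"
      using monomial_moves(1,2)[where w = id and t = t, OF bij_id _ one_in_weights] t by simp_all
    have "nu z (point_of 1) = point_of ?y'" by (rule nu_eqI[OF r y'(2) one_in_weights y'(1)])
    then have "point_of 1 = point_of ?y'" using nu by simp
    then obtain c where c: "c > 0" "?y' = c *\<^sub>R 1" unfolding point_of_eq_iff[OF one_in_weights y'(1)] by blast
    have tc: "F.abs_val (t k) = c" for k using arg_cong[OF c(2), of "\<lambda>v. v $ k"] by simp
    \<comment> \<open>Any index serves, since all |t_k| agree.\<close>
    define i0 :: 'n where "i0 = undefined"
    define s where "s k = inverse (t i0) * t k" for k
    have "F.abs_val (s k) = 1" for k using tc c(1) t(1) by (simp add: s_def F.av_mult F.av_inverse)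
    then have "monomial_matrix id s \<in> isometries 1" using diagonal_isometry one_in_weights by blast
    moreover have "pgl_class (monomial_matrix id s) = z"
    proof -
      have "monomial_matrix id s = mat (inverse (t i0)) ** monomial_matrix id t"
        by (simp add: vec_eq_iff mat_mult) (simp add: monomial_matrix_def s_def)
      then show ?thesis using t by (simp add: pgl_class_mat_mult)
    qed
    ultimately show ?thesis by blast
  qed
  then obtain M' where M': "z = pgl_class M'" "M' \<in> isometries 1" by blast
  obtain M where M: "u = pgl_class M" "M \<in> isometries 1" using U_grp_isometries[OF one_in_weights uz(1)] by blast
  have "A = pgl_class (M ** M')" using M M' unfolding uz(3) by (simp add: PGL_mult isometries_def)
  then show "A \<in> pgl_class ` isometries 1" using isometries_mult M(2) M'(2) by blast
next
  fix A assume "A \<in> pgl_class ` isometries 1"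
  then obtain k where k: "A = pgl_class k" "k \<in> isometries 1" by blast
  have nondeg: "f = 0" if "f v* k = 0" for f
    using k(2) that unfolding isometries_def invertible_iff_vmult by blast
  have isom: "F.weighted_norm 1 (f v* k) = F.weighted_norm 1 f" for f using k(2) unfolding isometries_def by blast
  obtain u t where u: "u \<in> F.elementary 1" "\<And>i. F.abs_val (t i) = 1" "k = u ** monomial_matrix id t"
    using F.elimination_diagonal[OF nondeg isom] by metis
  have t: "t i \<noteq> 0" for i using u(2)[of i] by auto
  have r: "monomial_rep (pgl_class (monomial_matrix id t)) t id" unfolding monomial_rep_iff using t by simp
  have "pgl_class (monomial_matrix id t) \<in> Z"
    unfolding Z_def
  proof (intro CollectI conjI ballI)
    show "pgl_class (monomial_matrix id t) \<in> T" unfolding T_eq using t by blast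
    fix x :: "'n apt_point" assume "x \<in> Lam UNIV"
    then obtain v where "x = apt UNIV v" unfolding Lam_def by blast
    then obtain y where y: "y \<in> weights" "x = point_of y" using apt_UNIV_eq_point_of by metis
    show "nu (pgl_class (monomial_matrix id t)) x = x"
      unfolding y(2) by (rule nu_eqI[OF r isometries_moves[OF diagonal_isometry[OF u(2) y(1)]] y(1) y(1)])
  qed
  moreover have "pgl_class u \<in> U_grp (point_of 1)" by (rule elementary_U_grp[OF one_in_weights u(1)])
  moreover have "A = pgl_class u \<otimes>\<^bsub>PGL\<^esub> pgl_class (monomial_matrix id t)"
    using elementary_isometries[OF one_in_weights u(1)] t
    by (simp add: k u(3) PGL_mult isometries_def invertible_monomial_iff)
  ultimately show "A \<in> U0_hat" unfolding U0_hat_def set_mult_def apt_origin by blast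
qed

section \<open>Identified pairs and equality of seminorms\<close>

lemma isometries_axis_solve:
  assumes "a \<in> isometries 1"
  obtains f where "F.weighted_norm 1 f = 1" "f v* a = axis i 1"
proof -
  obtain b where b: "b \<in> isometries 1" "b ** a = mat 1" using isometries_inverse[OF assms] by metis
  have "F.weighted_norm 1 (axis i 1 v* b) = F.weighted_norm 1 (axis i 1)" using b(1) unfolding isometries_def by blast
  then have "F.weighted_norm 1 (axis i 1 v* b) = 1" by (simp add: F.weighted_norm_axis)
  moreover have "(axis i 1 v* b) v* a = axis i 1" by (simp only: vmult_assoc[symmetric] b(2) vmult_mat_1)
  ultimately show thesis using that by blast
qed

text \<open>Take i with z_i = 1 and a unit vector f with f b equal to the i-th coordinate vector.
  Then the left side is 1, while all weights y are at most 1, so the right side is at most c. Used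
  in both directions, this turns proportionality into equality.\<close>

lemma weighted_norm_normalized:
  assumes a: "a \<in> isometries 1" and b: "b \<in> isometries 1"
    and y: "y \<in> weights" "infnorm y = 1" and z: "z \<in> weights" "infnorm z = 1"
    and eq: "\<And>f. F.weighted_norm z (f v* b) = c * F.weighted_norm y (f v* a)" and "c > 0"
  shows "c \<ge> 1"
proof -
  obtain i where i: "z $ i = 1" using infnorm_weights(3)[OF z(1)] z(2) by auto
  obtain f where f: "F.weighted_norm 1 f = 1" "f v* b = axis i 1" using isometries_axis_solve[OF b] .
  have "1 = F.weighted_norm z (f v* b)" using i weightsD[OF z(1)] by (simp add: f(2) F.weighted_norm_axis)
  also have "\<dots> = c * F.weighted_norm y (f v* a)" by (rule eq)
  also have "F.weighted_norm y (f v* a) \<le> F.weighted_norm 1 (f v* a)"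
    unfolding F.weighted_norm_le_iff
  proof
    fix i
    have "y $ i * F.abs_val ((f v* a) $ i) \<le> 1 * F.abs_val ((f v* a) $ i)"
      using infnorm_weights(2)[OF y(1), of i] y(2) by (intro mult_right_mono) auto
    also have "\<dots> \<le> F.weighted_norm 1 (f v* a)" using F.weighted_norm_ge[of 1 i "f v* a"] by simp
    finally show "y $ i * F.abs_val ((f v* a) $ i) \<le> F.weighted_norm 1 (f v* a)" .
  qed
  also have "F.weighted_norm 1 (f v* a) = 1" using a f(1) unfolding isometries_def by simp
  finally show ?thesis using \<open>c > 0\<close> by simp
qed

lemma building_rel_iff:
  "((g, x), (h, y)) \<in> building_rel \<longleftrightarrow> g \<in> U0_hat \<and> x \<in> Lam_bar \<and> h \<in> U0_hat \<and> y \<in> Lam_bar \<and>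
     (\<exists>n\<in>N. nu n x = y \<and> inv\<^bsub>PGL\<^esub> g \<otimes>\<^bsub>PGL\<^esub> h \<otimes>\<^bsub>PGL\<^esub> n \<in> P_grp x)"
  unfolding building_rel_def by blast

text \<open>If the pairs are identified, a^(-1) b n preserves the norm of y up to a factor and n
  takes y to z, so the two seminorms are proportional, hence equal by normalization. If they are
  equal, a^(-1) b carries one weighted norm to the other, and \<open>elimination\<close> splits it
  into an element of U_x and a monomial one.\<close>

lemma building_rel_iff_weighted_norm:
  assumes a: "a \<in> isometries 1" and b: "b \<in> isometries 1"
    and y: "y \<in> weights" "infnorm y = 1" and z: "z \<in> weights" "infnorm z = 1"
  shows "((pgl_class a, point_of y), (pgl_class b, point_of z)) \<in> building_rel \<longleftrightarrow>
    (\<forall>f. F.weighted_norm y (f v* a) = F.weighted_norm z (f v* b))"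
proof -
  have inv: "invertible a" "invertible b" using a b unfolding isometries_def by auto
  obtain a' where a': "a ** a' = mat 1" "a' ** a = mat 1" "a' \<in> isometries 1" using isometries_inverse[OF a] by blast
  have inv': "invertible a'" using a' unfolding invertible_def by blast
  have inva: "inv\<^bsub>PGL\<^esub> (pgl_class a) = pgl_class a'" by (rule PGL_inv[OF a'(1)])
  have "((pgl_class a, point_of y), (pgl_class b, point_of z)) \<in> building_rel \<longleftrightarrow>
      (\<exists>n\<in>N. nu n (point_of y) = point_of z \<and> inv\<^bsub>PGL\<^esub> (pgl_class a) \<otimes>\<^bsub>PGL\<^esub> pgl_class b \<otimes>\<^bsub>PGL\<^esub> n \<in> P_grp (point_of y))"
    unfolding building_rel_iff U0_hat_eq Lam_bar_eq_point_of using a b y(1) z(1) by blast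
  also have "\<dots> \<longleftrightarrow> (\<forall>f. F.weighted_norm y (f v* a) = F.weighted_norm z (f v* b))"
  proof
    assume "\<exists>n\<in>N. nu n (point_of y) = point_of z \<and> inv\<^bsub>PGL\<^esub> (pgl_class a) \<otimes>\<^bsub>PGL\<^esub> pgl_class b \<otimes>\<^bsub>PGL\<^esub> n \<in> P_grp (point_of y)"
    then obtain n t w where n: "monomial_rep n t w" "nu n (point_of y) = point_of z"
      "inv\<^bsub>PGL\<^esub> (pgl_class a) \<otimes>\<^bsub>PGL\<^esub> pgl_class b \<otimes>\<^bsub>PGL\<^esub> n \<in> P_grp (point_of y)"
      unfolding N_eq by blast
    obtain z' where z': "z' \<in> weights" "nu n (point_of y) = point_of z'" "moves n y z'" using nu_moves[OF n(1) y(1)] .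
    have "point_of z = point_of z'" using n(2) z'(2) by simp
    then obtain e where e: "e > 0" "z' = e *\<^sub>R z" using point_of_eq_iff[OF z(1) z'(1)] by blast
    obtain m where m: "invertible m" "n = pgl_class m" using z'(3) unfolding moves_def by blast
    obtain c1 where c1: "c1 > 0" "\<And>f. F.weighted_norm y (f v* m) = c1 * F.weighted_norm z' f"
      using moves_pgl_class[OF z'(3)[unfolded m(2)]] by blast
    have "inv\<^bsub>PGL\<^esub> (pgl_class a) \<otimes>\<^bsub>PGL\<^esub> pgl_class b \<otimes>\<^bsub>PGL\<^esub> n = pgl_class (a' ** b ** m)"
      unfolding inva m(2) by (simp add: PGL_mult inv inv' m(1) invertible_mult)
    then have "moves (pgl_class (a' ** b ** m)) y y" using P_grp_moves[OF y(1) n(3)] by simp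
    then obtain c2 where c2: "c2 > 0" "\<And>f. F.weighted_norm y (f v* (a' ** b ** m)) = c2 * F.weighted_norm y f"
      using moves_pgl_class by blast
    \<comment> \<open>This collects the factors coming from the element of P_x, from n, and from the
      two weight vectors of the same point.\<close>
    define c where "c = c2 / (c1 * e)"
    have c: "c > 0" using c1 c2 e by (simp add: c_def)
    have eq: "F.weighted_norm z (f v* b) = c * F.weighted_norm y (f v* a)" for f
    proof -
      have "(f v* a) v* (a' ** b ** m) = (f v* b) v* m"
      proof -
        have "a ** (a' ** b ** m) = b ** m"
          by (simp only: matrix_mul_assoc a'(1) matrix_mul_lid)
        then show ?thesis by (simp only: vmult_assoc[symmetric])
      qed
      then have "c2 * F.weighted_norm y (f v* a) = c1 * (e * F.weighted_norm z (f v* b))"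
        using c2(2)[of "f v* a"] c1(2)[of "f v* b"] e by (simp add: F.weighted_norm_scale_weight)
      then show ?thesis using c1(1) e(1) by (simp add: c_def field_simps)
    qed
    have "c \<ge> 1" by (rule weighted_norm_normalized[OF a b y z eq c])
    moreover have "inverse c \<ge> 1"
      by (rule weighted_norm_normalized[OF b a z y]) (use c eq in auto)
    ultimately have "c = 1" using c by (simp add: field_simps)
    then show "\<forall>f. F.weighted_norm y (f v* a) = F.weighted_norm z (f v* b)" using eq by simp
  next
    assume eq: "\<forall>f. F.weighted_norm y (f v* a) = F.weighted_norm z (f v* b)"
    \<comment> \<open>For k = u m with u elementary and m monomial, the element n = m^(-1) will
      satisfy a^(-1) b n = u, which lies in U_x.\<close>
    define k where "k = a' ** b"
    have invk: "invertible k" unfolding k_def by (simp add: invertible_mult inv inv')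
    have nondeg: "f = 0" if "f v* k = 0" for f using invk that unfolding invertible_iff_vmult by blast
    have isom: "F.weighted_norm z (f v* k) = F.weighted_norm y f" for f
    proof -
      have "(f v* a') v* a = f" by (simp only: vmult_assoc[symmetric] a' vmult_mat_1)
      then show ?thesis using eq[rule_format, of "f v* a'"] by (simp add: k_def vmult_assoc)
    qed
    obtain u w t where u: "u \<in> F.elementary y" "bij w" "\<And>i. t i \<noteq> 0" "k = u ** monomial_matrix w t"
      using F.elimination[OF nondeg weightsD[OF y(1)] weightsD[OF z(1)] isom] by metis
    define m where "m = pgl_class (monomial_matrix w t)"
    have rm: "monomial_rep m t w" unfolding m_def monomial_rep_iff using u(2,3) by blast
    have mG: "m \<in> carrier PGL" unfolding m_def using u(2,3) invertible_monomial_matrix pgl_class_in_carrier by blast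
    have ui: "u \<in> isometries y" by (rule elementary_isometries[OF y(1) u(1)])
    have ck: "pgl_class k = pgl_class u \<otimes>\<^bsub>PGL\<^esub> m"
      unfolding m_def u(4) using ui invertible_monomial_matrix[OF u(2,3)] by (simp add: PGL_mult isometries_def)
    have uG: "pgl_class u \<in> carrier PGL" using isometries_moves[OF ui] moves_carrier by blast
    have "moves (pgl_class k) z y" using isom by (intro movesI[where c = 1] invk) simp_all
    \<comment> \<open>Since u fixes y, the monomial part m takes z to y; its inverse takes y to z,
      as required of n.\<close>
    then have "moves (inv\<^bsub>PGL\<^esub> (pgl_class u) \<otimes>\<^bsub>PGL\<^esub> pgl_class k) z y"
      using moves_mult moves_inv[OF isometries_moves[OF ui]] by blast
    moreover have "inv\<^bsub>PGL\<^esub> (pgl_class u) \<otimes>\<^bsub>PGL\<^esub> pgl_class k = m"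
      unfolding ck using uG mG by (simp add: PGL.m_assoc[symmetric])
    ultimately have "moves m z y" by simp
    then have mv: "moves (inv\<^bsub>PGL\<^esub> m) y z" by (rule moves_inv)
    have "m \<in> N" using rm unfolding N_eq by blast
    moreover have "subgroup N PGL"
      unfolding N_def T_eq carrier_PGL
      by (rule PGL.normalizer_imp_subgroup) (use invertible_monomial_iff in \<open>auto simp: carrier_PGL\<close>)
    ultimately have nN: "inv\<^bsub>PGL\<^esub> m \<in> N" by (simp add: subgroup.m_inv_closed)
    then obtain t' w' where "monomial_rep (inv\<^bsub>PGL\<^esub> m) t' w'" unfolding N_eq by blast
    then have nu: "nu (inv\<^bsub>PGL\<^esub> m) (point_of y) = point_of z" using mv y(1) z(1) by (rule nu_eqI)
    have "inv\<^bsub>PGL\<^esub> (pgl_class a) \<otimes>\<^bsub>PGL\<^esub> pgl_class b \<otimes>\<^bsub>PGL\<^esub> inv\<^bsub>PGL\<^esub> m = pgl_class u"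
    proof -
      have "inv\<^bsub>PGL\<^esub> (pgl_class a) \<otimes>\<^bsub>PGL\<^esub> pgl_class b = pgl_class k" unfolding inva k_def by (simp add: PGL_mult inv inv')
      then show ?thesis unfolding ck using uG mG by (simp add: PGL.m_assoc)
    qed
    moreover have "pgl_class u \<otimes>\<^bsub>PGL\<^esub> \<one>\<^bsub>PGL\<^esub> \<in> P_grp (point_of y)"
      unfolding P_grp_def set_mult_def
      using elementary_U_grp[OF y(1) u(1)] one_in_N_stab[OF y(1)] by blast
    ultimately have "inv\<^bsub>PGL\<^esub> (pgl_class a) \<otimes>\<^bsub>PGL\<^esub> pgl_class b \<otimes>\<^bsub>PGL\<^esub> inv\<^bsub>PGL\<^esub> m \<in> P_grp (point_of y)"
      using uG by simp
    then show "\<exists>n\<in>N. nu n (point_of y) = point_of z \<and> inv\<^bsub>PGL\<^esub> (pgl_class a) \<otimes>\<^bsub>PGL\<^esub> pgl_class b \<otimes>\<^bsub>PGL\<^esub> n \<in> P_grp (point_of y)"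
      using nN nu by blast
  qed
  finally show ?thesis .
qed

end


section \<open>Topology of the building\<close>

text \<open>h separates exactly the fibres of q, so it induces a continuous injection of Y into
  Z.\<close>

lemma Hausdorff_quotient:
  assumes q: "quotient_map X Y q" and h: "continuous_map X Z h" and Z: "Hausdorff_space Z"
    and eq: "\<And>a b. a \<in> topspace X \<Longrightarrow> b \<in> topspace X \<Longrightarrow> q a = q b \<longleftrightarrow> h a = h b"
  shows "Hausdorff_space Y"
proof -
  obtain g where g: "continuous_map Y Z g" "\<And>x. x \<in> topspace X \<Longrightarrow> g (q x) = h x"
    using quotient_map_lift_exists[OF q h] eq by metis
  have "topspace Y = q ` topspace X" using q by (simp add: quotient_imp_surjective_map)
  then have "inj_on g (topspace Y)" using g(2) eq by (auto simp: inj_on_def)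
  then show ?thesis using Hausdorff_space_injective_preimage[OF Z g(1)] by blast
qed

text \<open>Every open set of the pullback is the preimage of an open set of X, so an open cover of
  S comes from one of its image.\<close>

lemma compactin_pullback_topology:
  assumes "compactin X (f ` S)" "S \<subseteq> A"
  shows "compactin (pullback_topology A f X) S"
  unfolding compactin_def
proof (intro conjI allI impI)
  show "S \<subseteq> topspace (pullback_topology A f X)"
    using assms compactin_subset_topspace[OF assms(1)] by (auto simp: topspace_pullback_topology)
  fix \<U> assume U: "(\<forall>U\<in>\<U>. openin (pullback_topology A f X) U) \<and> S \<subseteq> \<Union> \<U>"
  then obtain V where V: "\<And>U. U \<in> \<U> \<Longrightarrow> openin X (V U)" "\<And>U. U \<in> \<U> \<Longrightarrow> U = f -` V U \<inter> A"
    unfolding openin_pullback_topology by metis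
  have "f ` S \<subseteq> \<Union> (V ` \<U>)"
  proof
    fix y assume "y \<in> f ` S"
    then obtain x U where "x \<in> S" "y = f x" "U \<in> \<U>" "x \<in> U" using U by blast
    then show "y \<in> \<Union> (V ` \<U>)" using V(2)[of U] by blast
  qed
  moreover have "\<And>W. W \<in> V ` \<U> \<Longrightarrow> openin X W" using V(1) by blast
  ultimately obtain \<F> where F: "finite \<F>" "\<F> \<subseteq> V ` \<U>" "f ` S \<subseteq> \<Union> \<F>"
    using compactinD[OF assms(1)] by metis
  then obtain \<G> where G: "finite \<G>" "\<G> \<subseteq> \<U>" "\<F> = V ` \<G>" by (metis finite_subset_image)
  have "S \<subseteq> \<Union> \<G>"
  proof
    fix x assume x: "x \<in> S"
    then obtain U where "U \<in> \<G>" "f x \<in> V U" using F(3) G(3) by blast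
    then show "x \<in> \<Union> \<G>" using V(2)[of U] G(2) x assms(2) by blast
  qed
  with G show "\<exists>\<F>. finite \<F> \<and> \<F> \<subseteq> \<U> \<and> S \<subseteq> \<Union> \<F>" by blast
qed

lemma continuous_map_Max:
  fixes h :: "'i \<Rightarrow> 'a \<Rightarrow> real"
  assumes "finite I" "I \<noteq> {}" "\<And>i. i \<in> I \<Longrightarrow> continuous_map X euclideanreal (h i)"
  shows "continuous_map X euclideanreal (\<lambda>x. Max ((\<lambda>i. h i x) ` I))"
  using assms
proof (induction rule: finite_ne_induct)
  case (insert i I)
  then have "(\<lambda>x. Max ((\<lambda>i. h i x) ` insert i I)) = (\<lambda>x. max (h i x) (Max ((\<lambda>i. h i x) ` I)))" by simp
  then show ?case using insert by (simp only:) (intro continuous_map_real_max, auto)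
qed simp

context pgl_building
begin

section \<open>Compactness of \<open>U0_hat\<close> in the topology of PGL\<close>

lemma K_topology_eq: "K_topology = F.K.mtopology"
  unfolding K_topology_def F.mtopology_eq_valuation_topology ..

abbreviation entry_topology :: "('n \<times> 'n \<Rightarrow> 'k) topology" where
  "entry_topology \<equiv> product_topology (\<lambda>_. K_topology) UNIV"

definition matrix_of_entries :: "('n \<times> 'n \<Rightarrow> 'k) \<Rightarrow> 'k^'n^'n" where
  "matrix_of_entries m = (\<chi> i j. m (i, j))"

lemma matrix_of_entries_entry: "matrix_of_entries (entry g) = matrix_of g" by (simp add: matrix_of_entries_def matrix_of_def)

lemma topspace_entry_topology: "topspace entry_topology = UNIV"
  by (simp add: K_topology_eq)

text \<open>By the ultrametric inequality, changing all entries by less than d changes the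
  coordinate by at most d times a bound for the |f_j|.\<close>

lemma continuous_map_vmult_abs:
  "continuous_map entry_topology euclideanreal (\<lambda>m. F.abs_val ((f v* matrix_of_entries m) $ i))" (is "continuous_map _ _ ?h")
  unfolding continuous_map_def
proof (intro conjI allI impI)
  fix V :: "real set" assume "openin euclideanreal V"
  then have V: "open V" by simp
  show "openin entry_topology {m \<in> topspace entry_topology. ?h m \<in> V}"
  proof (subst openin_subopen, intro ballI)
    fix m assume "m \<in> {m \<in> topspace entry_topology. ?h m \<in> V}"
    then obtain e where e: "e > 0" "\<And>r. dist r (?h m) < e \<Longrightarrow> r \<in> V" using V by (auto simp: open_dist)
    \<comment> \<open>The summand 1 keeps the bound positive when f = 0.\<close>
    define B where "B = (\<Sum>j\<in>UNIV. F.abs_val (f $ j)) + 1"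
    have B: "B > 0" "\<And>j. F.abs_val (f $ j) \<le> B"
    proof -
      have "0 \<le> (\<Sum>j\<in>UNIV. F.abs_val (f $ j))" by (intro sum_nonneg) simp
      then show "B > 0" by (simp add: B_def)
      have "F.abs_val (f $ j) \<le> (\<Sum>j\<in>UNIV. F.abs_val (f $ j))" for j by (intro member_le_sum) auto
      then show "F.abs_val (f $ j) \<le> B" for j using B_def by (simp add: add_increasing2)
    qed
    define d where "d = e / (2 * B)"
    have d: "d > 0" "B * d < e" using e B by (simp_all add: d_def)
    let ?T = "PiE UNIV (\<lambda>ij. F.K.mball (m ij) d)"
    have "openin entry_topology ?T"
      unfolding K_topology_eq by (simp add: openin_PiE)
    moreover have "m \<in> ?T" using d by (simp add: PiE_iff F.K.mball_def)
    moreover have "?h m' \<in> V" if m': "m' \<in> ?T" for m'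
    proof -
      have "F.abs_val (f $ j * (m' (j, i) - m (j, i))) \<le> B * d" for j
      proof -
        have "F.abs_val (m (j, i) - m' (j, i)) < d" using m' by (auto simp: PiE_iff F.K.mball_def)
        then have "F.abs_val (m' (j, i) - m (j, i)) \<le> d" by (simp add: F.av_diff_commute)
        then show ?thesis unfolding F.av_mult using B by (intro mult_mono) auto
      qed
      then have "F.abs_val (\<Sum>j\<in>UNIV. f $ j * (m' (j, i) - m (j, i))) \<le> B * d"
        using B(1) d(1) by (intro F.av_sum_le) auto
      also have "(\<Sum>j\<in>UNIV. f $ j * (m' (j, i) - m (j, i))) = (f v* matrix_of_entries m') $ i - (f v* matrix_of_entries m) $ i"
        by (simp add: vector_matrix_mult_def matrix_of_entries_def right_diff_distrib sum_subtractf)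
      finally have "\<bar>?h m' - ?h m\<bar> \<le> B * d" using F.av_abs_diff order_trans by blast
      then show ?thesis using d(2) by (intro e(2)) (simp add: dist_real_def)
    qed
    ultimately show "\<exists>T. openin entry_topology T \<and> m \<in> T \<and> T \<subseteq> {m \<in> topspace entry_topology. ?h m \<in> V}"
      using topspace_entry_topology by (intro exI[of _ ?T]) auto
  qed
qed simp

lemma continuous_map_weighted_norm_vmult:
  "continuous_map entry_topology euclideanreal (\<lambda>m. F.weighted_norm 1 (f v* matrix_of_entries m))"
  unfolding F.weighted_norm_def
  by (rule continuous_map_Max) (simp_all add: continuous_map_vmult_abs)

text \<open>Rows of an isometry of the max norm have norm 1, so the entries lie in the compact unit
  ball. Inside this product of balls the isometries are cut out by one closed condition for each
  f.\<close>

lemma compactin_isometries: "compactin GL_topology (linear_of ` isometries 1)"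
  unfolding GL_topology_def
proof (rule compactin_pullback_topology)
  show "linear_of ` isometries 1 \<subseteq> carrier GL" by (auto simp: carrier_GL isometries_def)
  let ?O = "PiE UNIV (\<lambda>_ :: 'n \<times> 'n. {x. F.abs_val x \<le> 1})"
  let ?C = "\<Inter>f. {m \<in> topspace entry_topology. F.weighted_norm 1 (f v* matrix_of_entries m) \<in> {F.weighted_norm 1 f}}"
  have "compactin entry_topology ?O"
    unfolding compactin_PiE using F.compactin_unit_ball by (simp add: K_topology_eq)
  moreover have "closedin entry_topology ?C"
    by (intro closedin_INT closedin_continuous_map_preimage[OF continuous_map_weighted_norm_vmult]) auto
  ultimately have "compactin entry_topology (?C \<inter> ?O)" by (intro closed_Int_compactin)
  moreover have "entry ` linear_of ` isometries 1 = ?C \<inter> ?O"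
  proof (intro equalityI subsetI)
    fix m assume "m \<in> entry ` linear_of ` isometries 1"
    then obtain M where M: "M \<in> isometries 1" "m = entry (linear_of M)" by blast
    have mM: "matrix_of_entries m = M" by (simp add: M(2) matrix_of_entries_entry matrix_of_linear_of)
    have weighted_norm: "F.weighted_norm 1 (f v* M) = F.weighted_norm 1 f" for f using M(1) unfolding isometries_def by blast
    have "F.abs_val (m (i, j)) \<le> 1" for i j
    proof -
      have "m (i, j) = M $ i $ j" using mM by (auto simp: matrix_of_entries_def vec_eq_iff)
      moreover have "F.abs_val (M $ i $ j) \<le> F.weighted_norm 1 (axis i 1 v* M)"
        using F.weighted_norm_ge[of 1 j "M $ i"] by (simp add: axis_vmult)
      ultimately show ?thesis by (simp add: weighted_norm F.weighted_norm_axis)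
    qed
    then show "m \<in> ?C \<inter> ?O" using weighted_norm mM topspace_entry_topology by (auto simp: PiE_iff)
  next
    fix m assume m: "m \<in> ?C \<inter> ?O"
    have weighted_norm: "F.weighted_norm 1 (f v* matrix_of_entries m) = F.weighted_norm 1 f" for f using m by auto
    \<comment> \<open>The norm equations exclude a kernel and thus imply invertibility. Hence the
      image under \<open>entry\<close> is closed in the space of all matrices, not merely relative
      to GL.\<close>
    have "f = 0" if "f v* matrix_of_entries m = 0" for f
    proof -
      have "F.weighted_norm 1 f = F.weighted_norm 1 (0 :: 'k^'n)" using weighted_norm[of f] that by simp
      then have "F.weighted_norm 1 f = 0" using F.weighted_norm_attained[of 1 "0 :: 'k^'n"] by auto
      then have "F.abs_val (f $ i) \<le> 0" for i using F.weighted_norm_ge[of 1 i f] by simp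
      then have "F.abs_val (f $ i) = 0" for i using F.av_nonneg order_antisym by blast
      then show ?thesis by (simp add: vec_eq_iff)
    qed
    then have "matrix_of_entries m \<in> isometries 1"
      unfolding isometries_def invertible_iff_vmult using weighted_norm by blast
    moreover have "m = entry (linear_of (matrix_of_entries m))"
    proof
      fix ij :: "'n \<times> 'n"
      have "matrix_of_entries (entry (linear_of (matrix_of_entries m))) = matrix_of_entries m" by (simp add: matrix_of_entries_entry matrix_of_linear_of)
      then show "m ij = entry (linear_of (matrix_of_entries m)) ij" by (cases ij) (simp add: matrix_of_entries_def vec_eq_iff)
    qed
    ultimately show "m \<in> entry ` linear_of ` isometries 1" by blast
  qed
  ultimately show "compactin entry_topology (entry ` linear_of ` isometries 1)" by simp
qed

lemma topspace_GL_topology: "topspace GL_topology = carrier GL"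
  unfolding GL_topology_def topspace_pullback_topology topspace_entry_topology by simp

lemma quotient_map_proj_class: "quotient_map GL_topology PGL_topology proj_class"
  unfolding PGL_topology_def by (rule quotient_map_quotient_topology)

lemma compactin_U0_hat: "compactin PGL_topology U0_hat"
proof -
  have "compactin PGL_topology (proj_class ` linear_of ` isometries 1)"
    using compactin_isometries quotient_map_proj_class image_compactin quotient_imp_continuous_map by blast
  then show ?thesis by (simp add: U0_hat_eq image_image pgl_class_def[abs_def])
qed

section \<open>Scalar-invariant functions on PGL and continuity of the seminorm\<close>

definition mat_norm :: "'k^'n^'n \<Rightarrow> real" where
  "mat_norm M = Max (range (\<lambda>i. F.weighted_norm 1 (M $ i)))"

text \<open>The normalization by \<open>mat_norm\<close> makes this independent of the choice of the representative.\<close>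

definition coord :: "'k^'n \<Rightarrow> 'n \<Rightarrow> ('v \<Rightarrow> 'v) set \<Rightarrow> real" where
  "coord f i A = (let M = (SOME M. invertible M \<and> A = pgl_class M) in F.abs_val ((f v* M) $ i) / mat_norm M)"

lemma mat_norm_scale: "mat_norm (mat c ** M) = F.abs_val c * mat_norm M"
proof -
  have "(mat c ** M) $ i = c *s (M $ i)" for i by (simp add: vec_eq_iff mat_mult)
  then show ?thesis unfolding mat_norm_def
    by (subst mono_Max_commute[of "\<lambda>x. F.abs_val c * x"])
      (auto simp: mono_def mult_left_mono image_image F.weighted_norm_scale)
qed

lemma mat_norm_pos:
  assumes "invertible M"
  shows "mat_norm M > 0"
proof -
  define i0 :: 'n where "i0 = undefined"
  have "M $ i0 \<noteq> 0"
  proof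
    assume "M $ i0 = 0"
    then have "axis i0 1 v* M = 0" by (simp add: axis_vmult)
    then have "axis i0 (1 :: 'k) = 0" using assms unfolding invertible_iff_vmult by blast
    then show False by (simp add: axis_eq_0_iff)
  qed
  then obtain j where "M $ i0 $ j \<noteq> 0" by (auto simp: vec_eq_iff)
  then have "0 < F.abs_val (M $ i0 $ j)" by simp
  also have "\<dots> \<le> F.weighted_norm 1 (M $ i0)" using F.weighted_norm_ge[of 1 j "M $ i0"] by simp
  also have "\<dots> \<le> mat_norm M" unfolding mat_norm_def by (intro Max_ge) auto
  finally show ?thesis .
qed

text \<open>The representative chosen by \<open>SOME\<close> is c M for some scalar c, and |c|
  cancels against \<open>mat_norm\<close>.\<close>

lemma coord_pgl_class:
  assumes "invertible M"
  shows "coord f i (pgl_class M) = F.abs_val ((f v* M) $ i) / mat_norm M"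
proof -
  define L where "L = (SOME L. invertible L \<and> pgl_class M = pgl_class L)"
  have "invertible L \<and> pgl_class M = pgl_class L" unfolding L_def by (rule someI[of _ M]) (simp add: assms)
  then obtain c where c: "c \<noteq> 0" "L = mat c ** M" unfolding pgl_class_eq_iff by blast
  have "f v* L = c *s (f v* M)" unfolding c(2) mat_comm vmult_assoc vmult_mat ..
  then show ?thesis
    using c(1) by (simp add: coord_def Let_def flip: L_def) (simp add: c(2) mat_norm_scale F.av_mult)
qed

text \<open>All rows of an isometry have max norm 1, so the denominator equals 1 and the seminorm of
  an integral representative is recovered on \<open>U0_hat\<close>.\<close>

lemma coord_isometry:
  assumes "M \<in> isometries 1"
  shows "coord f i (pgl_class M) = F.abs_val ((f v* M) $ i)"
proof -
  have "F.weighted_norm 1 (M $ i) = 1" for i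
  proof -
    have "F.weighted_norm 1 (axis i 1 v* M) = F.weighted_norm 1 (axis i 1)" using assms unfolding isometries_def by blast
    then show ?thesis by (simp add: axis_vmult F.weighted_norm_axis)
  qed
  then have "mat_norm M = 1" by (simp add: mat_norm_def)
  then show ?thesis using assms coord_pgl_class[of M] by (simp add: isometries_def)
qed

text \<open>Continuity on PGL may be checked after composition with the quotient map from GL, where
  \<open>coord\<close> becomes a fraction of continuous functions with positive denominator. The
  restriction to \<open>U0_hat\<close> then comes for free.\<close>

lemma continuous_map_coord: "continuous_map PGL_topology euclideanreal (coord f i)"
proof (rule continuous_compose_quotient_map[OF quotient_map_proj_class])
  have pull: "continuous_map GL_topology euclideanreal (\<lambda>g. h (entry g))"
    if "continuous_map entry_topology euclideanreal h" for h
    using continuous_map_pullback[OF that, of "carrier GL" entry] by (simp add: GL_topology_def o_def)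
  have num: "continuous_map GL_topology euclideanreal (\<lambda>g. F.abs_val ((f v* matrix_of g) $ i))"
    using pull[OF continuous_map_vmult_abs] by (simp add: matrix_of_entries_entry)
  have row: "continuous_map GL_topology euclideanreal (\<lambda>g. F.weighted_norm 1 (matrix_of g $ i))" for i
    using pull[OF continuous_map_weighted_norm_vmult, of "axis i 1"] by (simp add: matrix_of_entries_entry axis_vmult)
  have den: "continuous_map GL_topology euclideanreal (\<lambda>g. mat_norm (matrix_of g))"
    unfolding mat_norm_def by (rule continuous_map_Max) (simp_all add: row)
  have inv: "invertible (matrix_of g)" if "g \<in> carrier GL" for g
    using that by (auto simp: carrier_GL matrix_of_linear_of)
  have "continuous_map GL_topology euclideanreal (\<lambda>g. F.abs_val ((f v* matrix_of g) $ i) / mat_norm (matrix_of g))"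
    using mat_norm_pos[OF inv] by (intro continuous_map_real_divide num den) (force simp: topspace_GL_topology)
  moreover have "F.abs_val ((f v* matrix_of g) $ i) / mat_norm (matrix_of g) = (coord f i \<circ> proj_class) g"
    if g: "g \<in> topspace GL_topology" for g
  proof -
    obtain M where M: "invertible M" "g = linear_of M" using g by (auto simp: topspace_GL_topology carrier_GL)
    then show ?thesis using coord_pgl_class[OF M(1)] by (simp add: matrix_of_linear_of pgl_class_def)
  qed
  ultimately show "continuous_map GL_topology euclideanreal (coord f i \<circ> proj_class)"
    by (rule continuous_map_eq)
qed

definition seminorm_of :: "('v \<Rightarrow> 'v) set \<times> 'n apt_point \<Rightarrow> 'k^'n \<Rightarrow> real" where
  "seminorm_of q f = Max (range (\<lambda>i. weight_of (snd q) $ i * coord f i (fst q)))"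

abbreviation pre_building :: "(('v \<Rightarrow> 'v) set \<times> 'n apt_point) topology" where
  "pre_building \<equiv> prod_topology (subtopology PGL_topology U0_hat) Lam_bar_topology"

lemma continuous_map_seminorm_of:
  "continuous_map pre_building (product_topology (\<lambda>_. euclideanreal) UNIV) seminorm_of"
  unfolding continuous_map_componentwise_UNIV
proof
  fix f
  have weight_of: "continuous_map pre_building euclideanreal (\<lambda>q. weight_of (snd q) $ i)" for i
  proof -
    have "continuous_map euclidean euclideanreal (\<lambda>y :: real^'n. y $ i)"
      by (simp add: continuous_on_component continuous_on_id)
    then have "continuous_map Lam_bar_topology euclideanreal (\<lambda>x :: 'n apt_point. weight_of x $ i)"
      by (rule continuous_map_compose[OF continuous_map_weight_of, unfolded o_def])
    then show ?thesis by (rule continuous_map_compose[OF continuous_map_snd, unfolded o_def])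
  qed
  have coord: "continuous_map pre_building euclideanreal (\<lambda>q. coord f i (fst q))" for i
    by (rule continuous_map_compose[OF continuous_map_fst continuous_map_from_subtopology[OF continuous_map_coord], unfolded o_def])
  show "continuous_map pre_building euclideanreal (\<lambda>q. seminorm_of q f)"
    unfolding seminorm_of_def
    by (rule continuous_map_Max) (auto intro: continuous_map_real_mult weight_of coord)
qed

lemma seminorm_of_eq:
  assumes "M \<in> isometries 1"
  shows "seminorm_of (pgl_class M, x) f = F.weighted_norm (weight_of x) (f v* M)"
  unfolding seminorm_of_def F.weighted_norm_def using coord_isometry[OF assms] by simp

lemma topspace_pre_building: "topspace pre_building = U0_hat \<times> Lam_bar"
  using compactin_subset_topspace[OF compactin_U0_hat] by (auto simp: topspace_Lam_bar)

lemma building_rel_iff_seminorm: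
  assumes "a \<in> U0_hat \<times> Lam_bar" "b \<in> U0_hat \<times> Lam_bar"
  shows "(a, b) \<in> building_rel \<longleftrightarrow> seminorm_of a = seminorm_of b"
proof -
  obtain M x where a: "a = (pgl_class M, x)" "M \<in> isometries 1" "x \<in> Lam_bar" using assms(1) U0_hat_eq by auto
  obtain L y where b: "b = (pgl_class L, y)" "L \<in> isometries 1" "y \<in> Lam_bar" using assms(2) U0_hat_eq by auto
  note wx = weight_of_Lam_bar[OF a(3)] and wy = weight_of_Lam_bar[OF b(3)]
  show ?thesis
    using building_rel_iff_weighted_norm[OF a(2) b(2) wx(1,2) wy(1,2)]
    unfolding wx(3) wy(3) a(1) b(1) fun_eq_iff seminorm_of_eq[OF a(2)] seminorm_of_eq[OF b(2)] .
qed

text \<open>Equality of seminorms is visibly an equivalence relation, so the images of points under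
  \<open>building_rel\<close> are its classes and are separated by the seminorm.\<close>

lemma building_class_eq_iff:
  assumes "a \<in> U0_hat \<times> Lam_bar" "b \<in> U0_hat \<times> Lam_bar"
  shows "building_rel `` {a} = building_rel `` {b} \<longleftrightarrow> seminorm_of a = seminorm_of b"
proof -
  have "building_rel `` {q} = {r \<in> U0_hat \<times> Lam_bar. seminorm_of q = seminorm_of r}"
    if q: "q \<in> U0_hat \<times> Lam_bar" for q
  proof -
    have "building_rel `` {q} \<subseteq> U0_hat \<times> Lam_bar" unfolding building_rel_def by blast
    then show ?thesis using building_rel_iff_seminorm[OF q] by blast
  qed
  then show ?thesis using assms by auto
qed

lemma quotient_map_X_bar: "quotient_map pre_building X_bar (\<lambda>q. building_rel `` {q})"
  unfolding X_bar_def by (rule quotient_map_quotient_topology)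

lemma compact_space_X_bar: "compact_space X_bar"
proof -
  have "compact_space (subtopology PGL_topology U0_hat)"
    using compactin_U0_hat compactin_subspace by blast
  then have "compact_space pre_building"
    using compact_space_Lam_bar[where 'n = 'n] by (simp add: compact_space_prod_topology)
  then have "compactin X_bar ((\<lambda>q. building_rel `` {q}) ` topspace pre_building)"
    unfolding compact_space_def
    by (rule image_compactin[OF _ quotient_imp_continuous_map[OF quotient_map_X_bar]])
  then show ?thesis
    unfolding compact_space_def quotient_imp_surjective_map[OF quotient_map_X_bar] .
qed

lemma Hausdorff_space_X_bar: "Hausdorff_space X_bar"
proof (rule Hausdorff_quotient[OF quotient_map_X_bar continuous_map_seminorm_of])
  show "Hausdorff_space (product_topology (\<lambda>_ :: 'k^'n. euclideanreal) UNIV)"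
    by (simp add: Hausdorff_space_product_topology)
  show "building_rel `` {a} = building_rel `` {b} \<longleftrightarrow> seminorm_of a = seminorm_of b"
    if "a \<in> topspace pre_building" "b \<in> topspace pre_building" for a b
    using that building_class_eq_iff unfolding topspace_pre_building by blast
qed

end

theorem theorem5p5:
  fixes scale :: "'k::field_char_0 \<Rightarrow> 'v::ab_group_add \<Rightarrow> 'v"
    and p :: nat
    and val :: "'k \<Rightarrow> ereal"
    and bas :: "'n::finite \<Rightarrow> 'v"
  assumes "pgl_building scale p val bas"
  shows "compact_space (pgl_building.X_bar scale val bas) \<and>
         Hausdorff_space (pgl_building.X_bar scale val bas)"
  using pgl_building.compact_space_X_bar[OF assms] pgl_building.Hausdorff_space_X_bar[OF assms] by blast

end
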